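(* Let $R$ be a commutative ring, $\delta\in R$ arbitrary, and $n\geq 0$. The inclusion $\iota\colon R\mathfrak S_n\to\mathcal P_n(R,\delta)$ induces a map \[ \iota_\ast\colon H_i(\mathfrak S_n;\mathbb 1)\longrightarrow \mathrm{Tor}_i^{\mathcal P_n(R,\delta)}(\mathbb 1,\mathbb 1) \] which is an isomorphism whenever $n\geq 2i+1$.
   Context: For a commutative ring $R$, an element $\delta\in R$ and $n\geq 0$, the partition algebra $\mathcal P_n=\mathcal P_n(R,\delta)$ is the free $R$-module with basis the set partitions ("diagrams") of $\{-n,\dots,-1,1,\dots,n\}$ (negative elements: left nodes; positive: right nodes). The product $d_1d_2$ of diagrams is obtained by identifying the right nodes of $d_1$ with the left nodes of $d_2$ (middle nodes), taking the induced partition on the outer nodes by connectivity, and multiplying by $\delta^c$ where $c$ is the number of components consisting only of middle nodes. Permutation diagrams (all blocks of the form $\{-i,j\}$) give the algebra inclusion $\iota\colon R\mathfrak S_n\to\mathcal P_n$. The trivial module $\mathbb 1$ of $\mathcal P_n$ is $R$ with permutation diagrams acting as the identity and all other diagrams acting as $0$ (on both sides); the trivial module of $R\mathfrak S_n$ is $R$ with permutations acting trivially, and $H_i(\mathfrak S_n;\mathbb 1)=\mathrm{Tor}_i^{R\mathfrak S_n}(\mathbb 1,\mathbb 1)$. *)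

theory Defs
  imports Main "HOL-Library.Disjoint_Sets" "HOL-Combinatorics.Permutations"
begin

section \<open>Partition diagrams\<close>

text \<open>Nodes: left nodes -n..-1, right nodes 1..n (as integers).\<close>
definition nodes :: "nat \<Rightarrow> int set" where
  "nodes n = {-int n..-1} \<union> {1..int n}"

definition diagrams :: "nat \<Rightarrow> int set set set" where
  "diagrams n = {d. partition_on (nodes n) d}"

text \<open>Stacking d1 (left) and d2 (right): d1's nodes are kept (its right nodes 1..n become
the middle nodes); d2's left node -j is identified with middle node j, and d2's right
node k is placed at n+k.\<close>
definition shift2 :: "nat \<Rightarrow> int \<Rightarrow> int" where
  "shift2 n x = (if x < 0 then - x else x + int n)"

definition stack_nodes :: "nat \<Rightarrow> int set" where
  "stack_nodes n = {-int n..-1} \<union> {1..2 * int n}"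

definition outer_nodes :: "nat \<Rightarrow> int set" where
  "outer_nodes n = {-int n..-1} \<union> {int n + 1..2 * int n}"

definition stack_rel :: "nat \<Rightarrow> int set set \<Rightarrow> int set set \<Rightarrow> (int \<times> int) set" where
  "stack_rel n d1 d2 =
     {(x, y). \<exists>B\<in>d1. x \<in> B \<and> y \<in> B} \<union>
     {(shift2 n x, shift2 n y) | x y. \<exists>B\<in>d2. x \<in> B \<and> y \<in> B}"

definition stack_components :: "nat \<Rightarrow> int set set \<Rightarrow> int set set \<Rightarrow> int set set" where
  "stack_components n d1 d2 = stack_nodes n // ((stack_rel n d1 d2)\<^sup>*)"

definition unshift :: "nat \<Rightarrow> int \<Rightarrow> int" where
  "unshift n x = (if x > int n then x - int n else x)"

text \<open>The diagram part of the product d1 d2.\<close>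
definition diag_comp :: "nat \<Rightarrow> int set set \<Rightarrow> int set set \<Rightarrow> int set set" where
  "diag_comp n d1 d2 =
     {unshift n ` (C \<inter> outer_nodes n) | C. C \<in> stack_components n d1 d2 \<and> C \<inter> outer_nodes n \<noteq> {}}"

text \<open>Number of components consisting only of middle nodes.\<close>
definition diag_loops :: "nat \<Rightarrow> int set set \<Rightarrow> int set set \<Rightarrow> nat" where
  "diag_loops n d1 d2 = card {C \<in> stack_components n d1 d2. C \<inter> outer_nodes n = {}}"

text \<open>Product of basis diagrams: d1 d2 = delta^c (d1 \<circ> d2).\<close>
definition part_mult :: "nat \<Rightarrow> 'r::comm_ring_1 \<Rightarrow> int set set \<Rightarrow> int set set \<Rightarrow> int set set \<times> 'r" where
  "part_mult n \<delta> d1 d2 = (diag_comp n d1 d2, \<delta> ^ diag_loops n d1 d2)"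

definition is_perm_diagram :: "nat \<Rightarrow> int set set \<Rightarrow> bool" where
  "is_perm_diagram n d \<longleftrightarrow> d \<in> diagrams n \<and> (\<forall>B\<in>d. \<exists>i j. B = {-i, j} \<and> 1 \<le> i \<and> 1 \<le> j)"

text \<open>Augmentation of the trivial module of the partition algebra.\<close>
definition part_eps :: "nat \<Rightarrow> int set set \<Rightarrow> 'r::comm_ring_1" where
  "part_eps n d = (if is_perm_diagram n d then 1 else 0)"

section \<open>Symmetric group and the inclusion\<close>

definition perms :: "nat \<Rightarrow> (nat \<Rightarrow> nat) set" where
  "perms n = {p. p permutes {1..n}}"

text \<open>Group ring product of basis elements: sigma * tau = sigma \<circ> tau.\<close>
definition perm_mult :: "(nat \<Rightarrow> nat) \<Rightarrow> (nat \<Rightarrow> nat) \<Rightarrow> (nat \<Rightarrow> nat) \<times> 'r::comm_ring_1" where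
  "perm_mult p q = (p \<circ> q, 1)"

definition perm_eps :: "(nat \<Rightarrow> nat) \<Rightarrow> 'r::comm_ring_1" where
  "perm_eps p = 1"

text \<open>The inclusion iota: sigma maps to the diagram with blocks {-sigma(j), j}; this is
multiplicative: iota(sigma) iota(tau) = iota(sigma \<circ> tau).\<close>
definition perm_diagram :: "nat \<Rightarrow> (nat \<Rightarrow> nat) \<Rightarrow> int set set" where
  "perm_diagram n p = {{- int (p j), int j} | j. j \<in> {1..n}}"

section \<open>Bar complex of an augmented algebra with a multiplicative basis\<close>

text \<open>For an R-algebra A that is free over R with basis D, whose product of basis elements
is a scalar multiple of a basis element (m x y = (z, r) meaning x y = r z), and with
augmentation eps (the trivial module), the (unnormalised) bar complex computing
Tor^A_*(1,1) has C_i free on D^i with differential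
d[x1|...|xi] = eps(x1)[x2|...|xi] + sum_{j=1}^{i-1} (-1)^j [x1|...|x_j x_{j+1}|...|xi]
               + (-1)^i eps(xi)[x1|...|x_{i-1}].\<close>

definition bar_cells :: "'b set \<Rightarrow> nat \<Rightarrow> 'b list set" where
  "bar_cells D i = {xs. set xs \<subseteq> D \<and> length xs = i}"

definition bar_chains :: "'b set \<Rightarrow> nat \<Rightarrow> ('b list \<Rightarrow> 'r::comm_ring_1) set" where
  "bar_chains D i = {c. \<forall>xs. xs \<notin> bar_cells D i \<longrightarrow> c xs = 0}"

text \<open>Coefficient of ys in the boundary of the basis cell xs.\<close>
definition bar_bd :: "('b \<Rightarrow> 'b \<Rightarrow> 'b \<times> 'r::comm_ring_1) \<Rightarrow> ('b \<Rightarrow> 'r) \<Rightarrow> 'b list \<Rightarrow> 'b list \<Rightarrow> 'r" where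
  "bar_bd m eps xs ys =
     (if xs = [] then 0 else
        (if ys = tl xs then eps (hd xs) else 0)
      + (\<Sum>j\<in>{1..<length xs}.
           if ys = take (j - 1) xs @ fst (m (xs ! (j - 1)) (xs ! j)) # drop (j + 1) xs
           then (-1) ^ j * snd (m (xs ! (j - 1)) (xs ! j)) else 0)
      + (if ys = butlast xs then (-1) ^ length xs * eps (last xs) else 0))"

definition bar_diff :: "'b set \<Rightarrow> ('b \<Rightarrow> 'b \<Rightarrow> 'b \<times> 'r::comm_ring_1) \<Rightarrow> ('b \<Rightarrow> 'r) \<Rightarrow> nat
    \<Rightarrow> ('b list \<Rightarrow> 'r) \<Rightarrow> ('b list \<Rightarrow> 'r)" where
  "bar_diff D m eps i c = (\<lambda>ys. \<Sum>xs\<in>bar_cells D i. c xs * bar_bd m eps xs ys)"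

definition bar_cycles :: "'b set \<Rightarrow> ('b \<Rightarrow> 'b \<Rightarrow> 'b \<times> 'r::comm_ring_1) \<Rightarrow> ('b \<Rightarrow> 'r) \<Rightarrow> nat
    \<Rightarrow> ('b list \<Rightarrow> 'r) set" where
  "bar_cycles D m eps i = {c \<in> bar_chains D i. bar_diff D m eps i c = (\<lambda>_. 0)}"

definition bar_boundaries :: "'b set \<Rightarrow> ('b \<Rightarrow> 'b \<Rightarrow> 'b \<times> 'r::comm_ring_1) \<Rightarrow> ('b \<Rightarrow> 'r) \<Rightarrow> nat
    \<Rightarrow> ('b list \<Rightarrow> 'r) set" where
  "bar_boundaries D m eps i = {bar_diff D m eps (Suc i) b | b. b \<in> bar_chains D (Suc i)}"

text \<open>Chain map on bar complexes induced by a basis map f (here iota tensor ... tensor iota).\<close>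
definition bar_push :: "'b set \<Rightarrow> ('b \<Rightarrow> 'c) \<Rightarrow> nat \<Rightarrow> ('b list \<Rightarrow> 'r::comm_ring_1) \<Rightarrow> ('c list \<Rightarrow> 'r)" where
  "bar_push D f i c = (\<lambda>ys. \<Sum>xs\<in>bar_cells D i. if map f xs = ys then c xs else 0)"

text \<open>The chain map f_* induces a bijection H_i(C) \<rightarrow> H_i(C') (H_i = cycles / boundaries).\<close>
definition induces_homology_iso ::
  "'b set \<Rightarrow> ('b \<Rightarrow> 'b \<Rightarrow> 'b \<times> 'r::comm_ring_1) \<Rightarrow> ('b \<Rightarrow> 'r) \<Rightarrow>
   'c set \<Rightarrow> ('c \<Rightarrow> 'c \<Rightarrow> 'c \<times> 'r) \<Rightarrow> ('c \<Rightarrow> 'r) \<Rightarrow> ('b \<Rightarrow> 'c) \<Rightarrow> nat \<Rightarrow> bool" where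
  "induces_homology_iso D m eps D' m' eps' f i \<longleftrightarrow>
     (\<forall>z\<in>bar_cycles D' m' eps' i. \<exists>w\<in>bar_cycles D m eps i.
         (\<lambda>ys. bar_push D f i w ys - z ys) \<in> bar_boundaries D' m' eps' i) \<and>
     (\<forall>w\<in>bar_cycles D m eps i.
         bar_push D f i w \<in> bar_boundaries D' m' eps' i \<longrightarrow> w \<in> bar_boundaries D m eps i)"

end

(*
  A diagram that is not a permutation has two right nodes in one block or an isolated right node, so
  the ideal I of non-permutation diagrams is a union of left ideals J_a, one for each such defect a.
  An intersection of fewer than n of the J_a is empty or has a right unit, namely a product of
  elementary idempotents; no power of delta appears because some right node is not forced to be
  isolated. Appending the right unit contracts the bar complex of such an intersection, so by a
  Mayer--Vietoris induction the bar complex of I as a left module is acyclic in low degrees.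
  Filtering bar words by the number of permutations after the last letter of I, the subcomplex of
  words with a letter in I is acyclic in degrees at most n - 1, and discarding it leaves the bar
  complex of the symmetric group. The approach follows Boyde's idempotent covers.
*)

theory Submission
  imports Defs "HOL-Library.Poly_Mapping"
begin


section \<open>Linear extension on free modules\<close>

text \<open>Permutation diagrams are closed under products, and the other diagrams form a two-sided
  ideal killed by the augmentation. Hence the bar complex is the direct sum of the words with a
  letter in I and the words without one. Injectivity on homology follows from this splitting alone;
  acyclicity serves surjectivity.

  The parameter is arbitrary, so a right unit must have coefficient exactly 1. The obvious diagram
  isolating both -j and j does not do: its square is delta times itself. The node -j is attached
  instead to the block of an auxiliary node k, and n - 1 defects are too few to require every node
  to be isolated, which leaves such a k.

  Associativity of the product also contains an identity between loop numbers. It is proved by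
  counting: a diagram is an F_2-linear relation between subsets, and the number of ways to pass
  through the middle of a stack is 2 to the number of loops.\<close>

abbreviation "coef \<equiv> Poly_Mapping.lookup"
abbreviation "supp \<equiv> Poly_Mapping.keys"
abbreviation "sgl \<equiv> Poly_Mapping.single"

definition scal :: "'r::comm_ring_1 \<Rightarrow> ('a \<Rightarrow>\<^sub>0 'r) \<Rightarrow> ('a \<Rightarrow>\<^sub>0 'r)" where
  "scal r c = Poly_Mapping.map ((*) r) c"

text \<open>Finite support allows one boundary map on words of all lengths, with no carrier set in
  the statements.\<close>

definition lin :: "('a \<Rightarrow> ('b \<Rightarrow>\<^sub>0 'r)) \<Rightarrow> ('a \<Rightarrow>\<^sub>0 'r::comm_ring_1) \<Rightarrow> ('b \<Rightarrow>\<^sub>0 'r)" where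
  "lin f c = (\<Sum>k\<in>supp c. scal (coef c k) (f k))"

definition push :: "('a \<Rightarrow> 'b) \<Rightarrow> ('a \<Rightarrow>\<^sub>0 'r::comm_ring_1) \<Rightarrow> ('b \<Rightarrow>\<^sub>0 'r)" where
  "push f = lin (\<lambda>k. sgl (f k) 1)"

lemma lookup_scal [simp]: "coef (scal r c) k = r * coef c k"
  by (simp add: scal_def Poly_Mapping.map.rep_eq when_def)

lemma scal_0_left [simp]: "scal 0 c = 0" and scal_0_right [simp]: "scal r 0 = 0"
  and scal_1 [simp]: "scal 1 c = c" and scal_scal: "scal r (scal s c) = scal (r * s) c"
  and scal_add_right: "scal r (c + d) = scal r c + scal r d"
  and scal_add_left: "scal (r + s) c = scal r c + scal s c"
  and scal_diff_right: "scal r (c - d) = scal r c - scal r d"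
  and scal_minus_right: "scal r (- c) = - scal r c"
  and scal_minus_left: "scal (- r) c = - scal r c"
  and scal_single [simp]: "scal r (sgl k s) = sgl k (r * s)"
  by (rule poly_mapping_eqI; simp add: lookup_add lookup_minus lookup_single when_def algebra_simps)+

lemma scal_sum: "scal r (sum f A) = (\<Sum>x\<in>A. scal r (f x))"
  by (rule poly_mapping_eqI) (simp add: lookup_sum sum_distrib_left)

lemma keys_scal_subset: "supp (scal r c) \<subseteq> supp c"
  by (auto simp: in_keys_iff)

lemma keys_uminus [simp]: "supp (- c) = supp (c :: 'a \<Rightarrow>\<^sub>0 'r::comm_ring_1)"
  by (auto simp: in_keys_iff)

lemma keys_diff_subset:
  "supp (c - d) \<subseteq> supp c \<union> supp (d :: 'a \<Rightarrow>\<^sub>0 'r::comm_ring_1)"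
  by (auto simp: in_keys_iff lookup_minus)

lemma lin_superset:
  assumes "finite A" "supp c \<subseteq> A"
  shows "lin f c = (\<Sum>k\<in>A. scal (coef c k) (f k))"
  unfolding lin_def using assms by (intro sum.mono_neutral_left) (auto simp: in_keys_iff)

lemma lin_add: "lin f (c + d) = lin f c + lin f d"
proof -
  let ?A = "supp c \<union> supp d"
  have "supp (c + d) \<subseteq> ?A" by (rule keys_add)
  then show ?thesis
    by (simp add: lin_superset[of ?A] lookup_add scal_add_left sum.distrib)
qed

lemma lin_0 [simp]: "lin f 0 = 0"
  by (simp add: lin_def)

lemma lin_scal: "lin f (scal r c) = scal r (lin f c)"
proof -
  have "lin f (scal r c) = (\<Sum>k\<in>supp c. scal (coef (scal r c) k) (f k))"
    by (rule lin_superset) (simp_all add: keys_scal_subset)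
  then show ?thesis by (simp add: scal_sum scal_scal lin_def)
qed

lemma lin_minus: "lin f (- c) = - lin f c"
  using lin_scal[of f "-1" c] by (simp add: scal_minus_left)

lemma lin_diff: "lin f (c - d) = lin f c - lin f d"
  using lin_add[of f c "- d"] by (simp add: lin_minus)

lemma lin_sum: "lin f (sum g A) = (\<Sum>x\<in>A. lin f (g x))"
  by (induction A rule: infinite_finite_induct) (auto simp: lin_add)

lemma lin_single [simp]: "lin f (sgl k r) = scal r (f k)"
  by (simp add: lin_superset[of "{k}"])

lemma lin_cong: "(\<And>k. k \<in> supp c \<Longrightarrow> f k = g k) \<Longrightarrow> lin f c = lin g c"
  by (simp add: lin_def)

lemma lin_zero_fun [simp]: "lin (\<lambda>_. 0) c = 0"
  by (simp add: lin_def)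

lemma lin_plus_fun: "lin (\<lambda>k. f k + g k) c = lin f c + lin g c"
  by (simp add: lin_def scal_add_right sum.distrib)

lemma lin_scal_fun: "lin (\<lambda>k. scal r (f k)) c = scal r (lin f c)"
  by (simp add: lin_def scal_sum scal_scal mult.commute)

lemma lin_minus_fun: "lin (\<lambda>k. - f k) c = - lin f c"
  by (simp add: lin_def scal_minus_right sum_negf)

lemma lin_diff_fun: "lin (\<lambda>k. f k - g k) c = lin f c - lin g c"
  using lin_plus_fun[of f "\<lambda>k. - g k" c] by (simp add: lin_minus_fun)

lemma lin_lin: "lin f (lin g c) = lin (\<lambda>k. lin f (g k)) c"
  by (simp add: lin_def[of g] lin_def[of "\<lambda>k. lin f (g k)"] lin_sum lin_scal)

lemma keys_lin_subset: "supp (lin f c) \<subseteq> (\<Union>k\<in>supp c. supp (f k))"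
proof
  fix y assume "y \<in> supp (lin f c)"
  then have "(\<Sum>k\<in>supp c. coef c k * coef (f k) y) \<noteq> 0"
    by (simp add: in_keys_iff lin_def lookup_sum)
  then obtain k where "k \<in> supp c" "coef c k * coef (f k) y \<noteq> 0"
    by (meson sum.neutral)
  then show "y \<in> (\<Union>k\<in>supp c. supp (f k))"
    by (auto simp: in_keys_iff intro!: bexI[of _ k])
qed

lemma lin_single_self: "lin (\<lambda>k. sgl k 1) c = c"
proof (rule poly_mapping_eqI)
  fix y
  have "coef (lin (\<lambda>k. sgl k 1) c) y
      = (\<Sum>k\<in>supp c. if k = y then coef c k else 0)"
    by (simp add: lin_def lookup_sum lookup_single when_def if_distrib cong: if_cong)
  then show "coef (lin (\<lambda>k. sgl k 1) c) y = coef c y"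
    by (simp add: in_keys_iff)
qed

lemma push_single [simp]: "push f (sgl k r) = sgl (f k) r"
  by (simp add: push_def)

lemma push_0 [simp]: "push f 0 = 0"
  and push_add: "push f (c + d) = push f c + push f d"
  and push_diff: "push f (c - d) = push f c - push f d"
  and push_minus: "push f (- c) = - push f c"
  and push_scal: "push f (scal r c) = scal r (push f c)"
  by (simp_all add: push_def lin_add lin_diff lin_minus lin_scal)

lemma lin_push: "lin f (push g c) = lin (\<lambda>k. f (g k)) c"
  by (simp add: push_def lin_lin)

lemma push_lin: "push f (lin g c) = lin (\<lambda>k. push f (g k)) c"
  by (simp add: push_def lin_lin)

lemma push_push: "push f (push g c) = push (\<lambda>k. f (g k)) c"
  by (simp add: push_def lin_lin)

lemma push_ident [simp]: "push (\<lambda>k. k) c = c"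
  by (simp add: push_def lin_single_self)

lemma keys_push_subset: "supp (push f c) \<subseteq> f ` supp c"
  using keys_lin_subset[of "\<lambda>k. sgl (f k) 1" c] by (auto simp: push_def split: if_splits)

lemma lookup_push_inj:
  assumes "inj f"
  shows "coef (push f c) (f k) = coef c k"
proof -
  have "coef (push f c) (f k) = (\<Sum>j\<in>supp c. if j = k then coef c j else 0)"
    by (simp add: push_def lin_def lookup_sum lookup_single when_def inj_eq[OF assms] if_distrib cong: if_cong)
  then show ?thesis by (simp add: in_keys_iff)
qed

lemma lookup_push_notin: "k \<notin> f ` supp c \<Longrightarrow> coef (push f c) k = 0"
  using keys_push_subset[of f c] by (auto simp: in_keys_iff)

section \<open>Merging adjacent letters\<close>

fun merge :: "('a \<Rightarrow> 'a \<Rightarrow> 'a \<times> 'r) \<Rightarrow> 'a \<Rightarrow> 'a list \<Rightarrow> ('a list \<Rightarrow>\<^sub>0 'r::comm_ring_1)" where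
  "merge m x [] = 0"
| "merge m x (y # w) = sgl (fst (m x y) # w) (snd (m x y))"

text \<open>The recursion gives the merge of letters j and j + 1, counted from 1, the sign (-1)^j,
  and turns the vanishing of the squared boundary into an induction on the word.\<close>

fun word_bd :: "('a \<Rightarrow> 'a \<Rightarrow> 'a \<times> 'r) \<Rightarrow> 'a list \<Rightarrow> ('a list \<Rightarrow>\<^sub>0 'r::comm_ring_1)" where
  "word_bd m [] = 0"
| "word_bd m (x # w) = - merge m x w - push (Cons x) (word_bd m w)"

abbreviation chain_bd :: "('a \<Rightarrow> 'a \<Rightarrow> 'a \<times> 'r) \<Rightarrow> ('a list \<Rightarrow>\<^sub>0 'r) \<Rightarrow> ('a list \<Rightarrow>\<^sub>0 'r::comm_ring_1)" where
  "chain_bd m \<equiv> lin (word_bd m)"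

text \<open>Comparing monomials instead of pairs identifies products of coefficient 0, whatever
  their letters are.\<close>

definition twisted_assoc :: "('a \<Rightarrow> 'a \<Rightarrow> 'a \<times> 'r::comm_ring_1) \<Rightarrow> bool" where
  "twisted_assoc m \<longleftrightarrow> (\<forall>x y z.
     sgl (fst (m (fst (m x y)) z)) (snd (m x y) * snd (m (fst (m x y)) z)) =
     sgl (fst (m x (fst (m y z)))) (snd (m y z) * snd (m x (fst (m y z)))))"

lemma merge_merge:
  assumes "twisted_assoc m"
  shows "lin (merge m x) (merge m y w) = scal (snd (m x y)) (merge m (fst (m x y)) w)"
proof (cases w)
  case (Cons z v)
  have "push (\<lambda>a. a # v) (sgl (fst (m (fst (m x y)) z)) (snd (m x y) * snd (m (fst (m x y)) z))) =
      push (\<lambda>a. a # v) (sgl (fst (m x (fst (m y z)))) (snd (m y z) * snd (m x (fst (m y z)))))"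
    using assms unfolding twisted_assoc_def by metis
  then show ?thesis using Cons by simp
qed simp

lemma merge_push_Cons:
  "lin (merge m x) (push (Cons y) c) = scal (snd (m x y)) (push (Cons (fst (m x y))) c)"
  unfolding push_def by (simp add: lin_lin lin_scal_fun[symmetric])

text \<open>Merging \<open>x\<close> into \<open>w\<close> keeps the number of letters of
  \<open>w\<close>, so no sign appears. Merges away from the front agree literally; those at the
  front agree by associativity.\<close>

lemma chain_bd_merge:
  assumes "twisted_assoc m"
  shows "chain_bd m (merge m x w) = lin (merge m x) (word_bd m w)"
proof (cases w)
  case (Cons y v)
  then show ?thesis
    by (simp add: lin_diff lin_minus merge_merge[OF assms] merge_push_Cons scal_diff_right scal_minus_right)
qed simp

text \<open>In the double boundary of \<open>x # w\<close>, the term \<open>merge m x w\<close>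
  contributes minus its own boundary, and the term with \<open>x\<close> in front contributes
  \<open>x\<close> merged into the boundary of \<open>w\<close>. These cancel by
  \<open>chain_bd_merge\<close>.\<close>

lemma chain_bd_word_bd:
  assumes "twisted_assoc m"
  shows "chain_bd m (word_bd m w) = 0"
proof (induction w)
  case (Cons x w)
  have "chain_bd m (push (Cons x) (word_bd m w))
      = - lin (merge m x) (word_bd m w) - push (Cons x) (chain_bd m (word_bd m w))"
    by (simp add: lin_push push_lin lin_diff_fun lin_minus_fun)
  then show ?case
    by (simp add: lin_diff lin_minus chain_bd_merge[OF assms] Cons)
qed simp

lemma chain_bd_chain_bd:
  assumes "twisted_assoc m"
  shows "chain_bd m (chain_bd m c) = 0"
  by (simp add: lin_lin chain_bd_word_bd[OF assms])

text \<open>Each adjacent pair lies on one side of the shared letter \<open>x\<close>; on the right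
  side the merge numbers are shifted by \<open>length u\<close>.\<close>

lemma word_bd_append:
  "word_bd m (u @ x # v) = push (\<lambda>w. w @ v) (word_bd m (u @ [x]))
     + scal ((-1) ^ length u) (push (\<lambda>w. u @ w) (word_bd m (x # v)))"
proof (induction u)
  case (Cons y u)
  have "merge m y (u @ x # v) = push (\<lambda>w. w @ v) (merge m y (u @ [x]))"
    by (cases u) auto
  then show ?case
    by (simp add: Cons push_add push_diff push_minus push_push push_scal scal_minus_left scal_minus_right
        scal_diff_right del: word_bd.simps(2) add: word_bd.simps(2)[of m y])
qed simp

lemma keys_word_bdE:
  assumes "k \<in> supp (word_bd m w)"
  obtains a x y c where "w = a @ x # y # c" "k = a @ fst (m x y) # c" "snd (m x y) \<noteq> 0"
proof -
  have "\<exists>a x y c. w = a @ x # y # c \<and> k = a @ fst (m x y) # c \<and> snd (m x y) \<noteq> 0"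
    using assms
  proof (induction w arbitrary: k)
    case (Cons x w)
    then consider "k \<in> supp (merge m x w)" | "k \<in> supp (push (Cons x) (word_bd m w))"
      using keys_diff_subset by fastforce
    then show ?case
    proof cases
      case 1
      then obtain y v where "w = y # v" by (cases w) auto
      with 1 show ?thesis by (intro exI[of _ "[]"]) (auto split: if_splits)
    next
      case 2
      then obtain k' where "k' \<in> supp (word_bd m w)" "k = x # k'"
        using keys_push_subset by fastforce
      with Cons.IH show ?thesis by (metis append_Cons)
    qed
  qed simp
  with that show ?thesis by blast
qed

text \<open>Unrolls the recursion into an indexed sum like that of \<open>bar_bd\<close>, for the
  comparison in \<open>bar_bd_eq\<close>.\<close>

lemma word_bd_nth:
  "word_bd m w = (\<Sum>j\<in>{1..<length w}. sgl
     (take (j - 1) w @ fst (m (w ! (j - 1)) (w ! j)) # drop (j + 1) w) ((-1) ^ j * snd (m (w ! (j - 1)) (w ! j))))"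
proof (induction w)
  case (Cons x w)
  let ?g = "\<lambda>w j. sgl
     (take (j - 1) w @ fst (m (w ! (j - 1)) (w ! j)) # drop (j + 1) w) ((-1) ^ j * snd (m (w ! (j - 1)) (w ! j)))"
  show ?case
  proof (cases "w = []")
    case False
    have "(\<Sum>j\<in>{1..<length (x # w)}. ?g (x # w) j) = ?g (x # w) 1 + (\<Sum>j\<in>{Suc 1..<Suc (length w)}. ?g (x # w) j)"
      using False by (subst sum.atLeast_Suc_lessThan) auto
    also have "(\<Sum>j\<in>{Suc 1..<Suc (length w)}. ?g (x # w) j) = (\<Sum>j\<in>{1..<length w}. ?g (x # w) (Suc j))"
      by (rule sum.shift_bounds_Suc_ivl)
    also have "\<dots> = (\<Sum>j\<in>{1..<length w}. - push (Cons x) (?g w j))"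
    proof (rule sum.cong)
      fix j assume "j \<in> {1..<length w}"
      then obtain i where "j = Suc i" by (cases j) auto
      then show "?g (x # w) (Suc j) = - push (Cons x) (?g w j)"
        by (simp add: single_uminus[symmetric])
    qed simp
    also have "\<dots> = - push (Cons x) (word_bd m w)"
      by (simp add: Cons push_def lin_sum sum_negf)
    also have "?g (x # w) 1 = - merge m x w"
      using False by (cases w) (auto simp: single_uminus)
    finally show ?thesis by simp
  qed simp
qed simp


section \<open>Projection of chains onto a set of words\<close>

definition restr :: "'a set \<Rightarrow> ('a \<Rightarrow>\<^sub>0 'r::comm_ring_1) \<Rightarrow> ('a \<Rightarrow>\<^sub>0 'r)" where
  "restr A = lin (\<lambda>k. if k \<in> A then sgl k 1 else 0)"

lemma supp_restr: "supp (restr A c) \<subseteq> supp c \<inter> A"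
  using keys_lin_subset[of "\<lambda>k. if k \<in> A then sgl k 1 else 0" c] unfolding restr_def
  by (auto split: if_splits)

lemma restr_split: "restr A c + restr (- A) c = c"
proof -
  have "restr A c + restr (- A) c
      = lin (\<lambda>k. (if k \<in> A then sgl k 1 else 0) + (if k \<in> - A then sgl k 1 else 0)) c"
    by (simp add: restr_def lin_plus_fun)
  also have "\<dots> = lin (\<lambda>k. sgl k 1) c" by (intro lin_cong) auto
  finally show ?thesis by (simp add: lin_single_self)
qed

section \<open>Augmented algebras and their bar complexes\<close>

text \<open>The letter None stands for the generator of the trivial module, so that the two augmentation
terms of the bar differential become merges with the end letters of a word.\<close>

definition ext_mult :: "'b set \<Rightarrow> ('b \<Rightarrow> 'b \<Rightarrow> 'b \<times> 'r::comm_ring_1) \<Rightarrow> ('b \<Rightarrow> 'r)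
    \<Rightarrow> 'b option \<Rightarrow> 'b option \<Rightarrow> 'b option \<times> 'r" where
  "ext_mult D m eps x y = (case x of
     None \<Rightarrow> (case y of None \<Rightarrow> (None, 0) | Some b \<Rightarrow> (None, if b \<in> D then eps b else 0))
   | Some a \<Rightarrow> (case y of None \<Rightarrow> (None, if a \<in> D then eps a else 0)
       | Some b \<Rightarrow> if a \<in> D \<and> b \<in> D then (Some (fst (m a b)), snd (m a b)) else (None, 0)))"

definition bar_word :: "'b list \<Rightarrow> 'b option list" where
  "bar_word v = None # map Some v @ [None]"

lemma inj_bar_word: "inj bar_word"
  by (auto simp: inj_def bar_word_def inj_map_eq_map)

text \<open>\<open>P\<close> spans a two-sided ideal in the kernel of the augmentation, and
  \<open>P_compl\<close> says that the remaining basis elements multiply among themselves. Together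
  these split the bar complex by whether a word meets \<open>P\<close>.\<close>

locale augmented_algebra =
  fixes D :: "'b set" and m :: "'b \<Rightarrow> 'b \<Rightarrow> 'b \<times> 'r::comm_ring_1" and eps :: "'b \<Rightarrow> 'r" and P :: "'b set"
  assumes finite_D: "finite D"
    and closed: "x \<in> D \<Longrightarrow> y \<in> D \<Longrightarrow> fst (m x y) \<in> D"
    and assoc: "x \<in> D \<Longrightarrow> y \<in> D \<Longrightarrow> z \<in> D \<Longrightarrow> fst (m (fst (m x y)) z) = fst (m x (fst (m y z)))"
    and assoc_coef: "x \<in> D \<Longrightarrow> y \<in> D \<Longrightarrow> z \<in> D \<Longrightarrow>
      snd (m x y) * snd (m (fst (m x y)) z) = snd (m y z) * snd (m x (fst (m y z)))"
    and eps_mult: "x \<in> D \<Longrightarrow> y \<in> D \<Longrightarrow> eps x * eps y = snd (m x y) * eps (fst (m x y))"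
    and P_subset: "P \<subseteq> D"
    and eps_P: "x \<in> P \<Longrightarrow> eps x = 0"
    and P_left: "x \<in> D \<Longrightarrow> y \<in> P \<Longrightarrow> fst (m x y) \<in> P"
    and P_right: "x \<in> P \<Longrightarrow> y \<in> D \<Longrightarrow> fst (m x y) \<in> P"
    and P_compl: "x \<in> D - P \<Longrightarrow> y \<in> D - P \<Longrightarrow> fst (m x y) \<in> D - P"
begin

abbreviation "om \<equiv> ext_mult D m eps"
abbreviation "bd \<equiv> chain_bd om"

lemma om_simps [simp]:
  "om None None = (None, 0)"
  "b \<in> D \<Longrightarrow> om None (Some b) = (None, eps b)"
  "b \<in> D \<Longrightarrow> om (Some b) None = (None, eps b)"
  "a \<in> D \<Longrightarrow> b \<in> D \<Longrightarrow> om (Some a) (Some b) = (Some (fst (m a b)), snd (m a b))"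
  by (auto simp: ext_mult_def)

lemma om_notin: "b \<notin> D \<Longrightarrow> om x (Some b) = (None, 0)" "b \<notin> D \<Longrightarrow> om (Some b) x = (None, 0)"
  by (auto simp: ext_mult_def split: option.splits)

text \<open>Products with letters outside \<open>D\<close> have coefficient 0, so associativity
  holds on the whole type and \<open>bd_bd\<close> needs no support hypothesis. With
  \<open>None\<close> at one end and letters of \<open>D\<close> elsewhere, associativity is
  multiplicativity of \<open>eps\<close>.\<close>

lemma twisted_assoc_om: "twisted_assoc om"
proof -
  have "sgl (fst (om (fst (om x y)) z)) (snd (om x y) * snd (om (fst (om x y)) z)) =
     sgl (fst (om x (fst (om y z)))) (snd (om y z) * snd (om x (fst (om y z))))" for x y z
  proof -
    have D: "x = None \<or> (\<exists>a\<in>D. x = Some a) \<or> (\<exists>a. a \<notin> D \<and> x = Some a)" for x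
      by (cases x) auto
    show ?thesis
      using D[of x] D[of y] D[of z]
      by (elim disjE bexE exE conjE)
        (simp_all add: om_notin closed assoc assoc_coef eps_mult,
         simp_all add: eps_mult[symmetric] mult.commute)
  qed
  then show ?thesis by (simp add: twisted_assoc_def)
qed

lemma bd_bd [simp]: "bd (bd c) = 0"
  by (rule chain_bd_chain_bd[OF twisted_assoc_om])

text \<open>A letter of \<open>P\<close> cannot be absorbed at an end, where its augmentation is 0,
  and survives inner merges because \<open>P\<close> is an ideal; merges outside \<open>P\<close>
  create none because \<open>D - P\<close> is closed.\<close>

lemma word_bd_bar_word:
  assumes "set v \<subseteq> D" "k \<in> supp (word_bd om (bar_word v))"
  obtains v' where "k = bar_word v'" "length v = Suc (length v')" "set v' \<subseteq> D"
    "set v \<inter> P = {} \<longleftrightarrow> set v' \<inter> P = {}"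
proof -
  obtain a p q c where w: "bar_word v = a @ p # q # c" and k: "k = a @ fst (om p q) # c"
    and nz: "snd (om p q) \<noteq> 0"
    using assms(2) by (rule keys_word_bdE)
  show thesis
  proof (cases a)
    case Nil
    show thesis
    proof (cases v)
      case (Cons x u)
      with Nil w assms(1) nz have "x \<in> D" "x \<notin> P" "p = None" "q = Some x" "c = map Some u @ [None]"
        by (auto simp: bar_word_def dest: eps_P)
      with Nil k Cons assms(1) show thesis by (intro that[of u]) (auto simp: bar_word_def)
    qed (use Nil w nz in \<open>auto simp: bar_word_def\<close>)
  next
    case (Cons a0 a')
    then have w': "a0 = None" "map Some v @ [None] = a' @ p # q # c"
      using w by (auto simp: bar_word_def)
    show thesis
    proof (cases c rule: rev_cases)
      case Nil
      with w' have "map Some v = a' @ [p]" "q = None" by auto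
      then obtain u x where v: "v = u @ [x]" "a' = map Some u" "p = Some x"
        by (auto simp: map_eq_append_conv)
      with assms(1) nz \<open>q = None\<close> have "x \<in> D" "x \<notin> P" by (auto dest: eps_P)
      with v k w' Cons Nil assms(1) \<open>q = None\<close> show thesis
        by (intro that[of u]) (auto simp: bar_word_def)
    next
      case (snoc c' z)
      with w' have "map Some v = a' @ p # q # c'" "z = None" by auto
      then obtain u x y u' where v: "v = u @ x # y # u'" "a' = map Some u" "p = Some x" "q = Some y"
        "c' = map Some u'"
        by (auto simp: map_eq_append_conv map_eq_Cons_conv Cons_eq_map_conv)
      with assms(1) have xy: "x \<in> D" "y \<in> D" by auto
      then have "fst (m x y) \<in> P \<longleftrightarrow> x \<in> P \<or> y \<in> P"
        using P_left P_right P_compl by blast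
      with xy v k w' Cons snoc assms(1) \<open>z = None\<close> closed show thesis
        by (intro that[of "u @ fst (m x y) # u'"]) (auto simp: bar_word_def)
    qed
  qed
qed

subsection \<open>Resolving left ideals\<close>

definition left_ideal :: "'b set \<Rightarrow> bool" where
  "left_ideal X \<longleftrightarrow> X \<subseteq> P \<and> (\<forall>d\<in>D. \<forall>x\<in>X. fst (m d x) \<in> X)"

text \<open>The degree \<open>s\<close> words of the bar complex for Tor(1, RX), where RX is the
  left module spanned by \<open>X\<close>: \<open>None\<close> is the generator of the trivial
  module, then come \<open>s\<close> algebra letters, and the last letter is the module
  element.\<close>

definition ideal_words :: "nat \<Rightarrow> 'b set \<Rightarrow> 'b option list set" where
  "ideal_words s X = {None # map Some v | v. set v \<subseteq> D \<and> length v = Suc s \<and> last v \<in> X}"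

text \<open>Exactness in degree \<open>s\<close>. For a left ideal \<open>X\<close> every chain of
  degree 0 is a cycle, so \<open>s = 0\<close> asserts that Tor_0 vanishes.\<close>

definition acyclic_at :: "nat \<Rightarrow> 'b set \<Rightarrow> bool" where
  "acyclic_at s X \<longleftrightarrow> (\<forall>z. supp z \<subseteq> ideal_words s X \<and> bd z = 0 \<longrightarrow>
     (\<exists>y. supp y \<subseteq> ideal_words (Suc s) X \<and> bd y = z))"

lemma left_ideal_Int: "left_ideal X \<Longrightarrow> left_ideal Y \<Longrightarrow> left_ideal (X \<inter> Y)"
  and left_ideal_P: "left_ideal P"
  by (auto simp: left_ideal_def P_left)

text \<open>The only merge that could remove the last letter pairs it with \<open>None\<close>, and
  then its augmentation is 0. All other merges keep the last letter in \<open>X\<close> because it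
  is multiplied only from the left.\<close>

lemma supp_word_bd_ideal:
  assumes X: "left_ideal X" and w: "w \<in> ideal_words s X" and k: "k \<in> supp (word_bd om w)"
  shows "s > 0 \<and> k \<in> ideal_words (s - 1) X"
proof -
  obtain v where v: "w = None # map Some v" "set v \<subseteq> D" "length v = Suc s" "last v \<in> X"
    using w by (auto simp: ideal_words_def)
  obtain a p q c where w: "w = a @ p # q # c" and k: "k = a @ fst (om p q) # c"
    and nz: "snd (om p q) \<noteq> 0"
    using k by (rule keys_word_bdE)
  show ?thesis
  proof (cases a)
    case Nil
    with w v obtain x u where u: "v = x # u" "p = None" "q = Some x" "c = map Some u"
      by (auto simp: Cons_eq_map_conv)
    with v nz have "x \<in> D" "x \<notin> P" by (auto dest: eps_P)
    with u v X have "u \<noteq> []" by (auto simp: left_ideal_def)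
    with u v Nil k \<open>x \<in> D\<close> show ?thesis
      by (cases s) (auto simp: ideal_words_def)
  next
    case (Cons a0 a')
    with w v obtain u x y u' where u: "v = u @ x # y # u'" "a' = map Some u" "p = Some x" "q = Some y"
        "c = map Some u'" "a0 = None"
      by (auto simp: map_eq_append_conv map_eq_Cons_conv Cons_eq_map_conv)
    then have "x \<in> D" "y \<in> D" using v by auto
    moreover have "last (u @ fst (m x y) # u') \<in> X"
      using u v X \<open>x \<in> D\<close> by (auto simp: left_ideal_def split: if_splits)
    ultimately show ?thesis
      using u v k Cons closed[of x y]
      by (auto simp: ideal_words_def intro!: exI[of _ "u @ fst (m x y) # u'"])
  qed
qed

lemma supp_bd_ideal:
  assumes "left_ideal X" "supp c \<subseteq> ideal_words s X"
  shows "s > 0 \<Longrightarrow> supp (bd c) \<subseteq> ideal_words (s - 1) X" and "s = 0 \<Longrightarrow> bd c = 0"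
proof -
  show "supp (bd c) \<subseteq> ideal_words (s - 1) X"
    using keys_lin_subset[of "word_bd om" c] supp_word_bd_ideal[OF assms(1)] assms(2) by blast
  show "bd c = 0" if "s = 0"
  proof -
    have "supp (bd c) = {}"
      using keys_lin_subset[of "word_bd om" c] supp_word_bd_ideal[OF assms(1)] assms(2) that by blast
    then show ?thesis by simp
  qed
qed

lemma acyclic_empty: "acyclic_at s {}"
  by (auto simp: acyclic_at_def ideal_words_def intro: exI[of _ 0])

text \<open>Appending the right unit e is a contracting homotopy.\<close>

lemma acyclic_right_unit:
  assumes X: "left_ideal X" and e: "e \<in> X" and unit: "\<And>x. x \<in> X \<Longrightarrow> m x e = (x, 1)"
  shows "acyclic_at s X"
  unfolding acyclic_at_def
proof (intro allI impI)
  fix z assume z: "supp z \<subseteq> ideal_words s X \<and> bd z = 0"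
  have XD: "X \<subseteq> D" using X P_subset by (auto simp: left_ideal_def)
  let ?h = "push (\<lambda>w. w @ [Some e])"
  have word: "word_bd om (w @ [Some e]) = ?h (word_bd om w) + scal ((-1) ^ s) (sgl w 1)"
    if w: "w \<in> ideal_words s X" for w
  proof -
    obtain v x where v: "w = None # map Some v @ [Some x]" "length v = s" "x \<in> X"
    proof -
      obtain v where v: "w = None # map Some v" "length v = Suc s" "last v \<in> X"
        using w by (auto simp: ideal_words_def)
      then obtain u y where "v = u @ [y]" by (cases v rule: rev_cases) auto
      with v show thesis by (intro that[of u y]) auto
    qed
    have "x \<in> D" "e \<in> D" using v XD e by auto
    \<comment> \<open>The unit law turns the merge of \<open>x\<close> with \<open>e\<close> back
      into \<open>w\<close> with coefficient 1.\<close>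
    then have "push (\<lambda>w'. (None # map Some v) @ w') (word_bd om [Some x, Some e]) = - sgl w 1"
      using v unit[of x] by (simp add: push_minus)
    moreover have "scal ((-1) ^ Suc s) (- sgl w 1) = scal ((-1 :: 'r) ^ s) (sgl w 1)"
      by (rule poly_mapping_eqI) (simp del: scal_single)
    ultimately show ?thesis
      using word_bd_append[of om "None # map Some v" "Some x" "[Some e]"] v
      by (simp del: word_bd.simps scal_single)
  qed
  \<comment> \<open>The merge with \<open>e\<close> is merge number \<open>s + 2\<close>; this
    factor undoes its sign.\<close>
  let ?y = "scal ((-1) ^ s) (?h z)"
  have "bd (?h z) = lin (\<lambda>w. ?h (word_bd om w) + scal ((-1) ^ s) (sgl w 1)) z"
    unfolding lin_push using z word by (intro lin_cong) blast
  also have "\<dots> = ?h (bd z) + scal ((-1) ^ s) z"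
    by (simp only: lin_plus_fun push_lin lin_scal_fun lin_single_self)
  also have "?h (bd z) = 0"
    using z by simp
  finally have "bd ?y = scal ((-1) ^ s) (scal ((-1) ^ s) z)"
    by (simp only: lin_scal add_0_left)
  moreover have "(-1) ^ s * (-1) ^ s = (1 :: 'r)"
    by (simp only: power_mult_distrib[symmetric]) simp
  ultimately have "bd ?y = z" by (simp only: scal_scal scal_1)
  moreover have "supp ?y \<subseteq> ideal_words (Suc s) X"
  proof -
    have "w @ [Some e] \<in> ideal_words (Suc s) X" if w: "w \<in> ideal_words s X" for w
    proof -
      obtain v where "w = None # map Some v" "set v \<subseteq> D" "length v = Suc s"
        using w by (auto simp: ideal_words_def)
      then have "w @ [Some e] = None # map Some (v @ [e])" "set (v @ [e]) \<subseteq> D"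
        "length (v @ [e]) = Suc (Suc s)" "last (v @ [e]) \<in> X"
        using e XD by auto
      then show ?thesis unfolding ideal_words_def by blast
    qed
    then have "supp (?h z) \<subseteq> ideal_words (Suc s) X"
      using keys_push_subset[of "\<lambda>w. w @ [Some e]" z] z by blast
    then show ?thesis by (rule subset_trans[OF keys_scal_subset])
  qed
  ultimately show "\<exists>y. supp y \<subseteq> ideal_words (Suc s) X \<and> bd y = z" by blast
qed

text \<open>Mayer--Vietoris by hand: split \<open>z\<close> as \<open>z1 + z2\<close> with
  \<open>z1\<close> ending in \<open>X\<close> and \<open>z2\<close> in \<open>Y\<close>. The common
  boundary, up to sign, is a cycle for \<open>X \<inter> Y\<close> one degree lower; a filling
  \<open>y\<close> of it corrects the pieces to the cycles \<open>z1 - y\<close> and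
  \<open>z2 + y\<close>, which are filled separately. In degree 0 both boundaries vanish and
  \<open>y = 0\<close> serves.\<close>

lemma acyclic_Un:
  assumes X: "left_ideal X" and Y: "left_ideal Y"
    and aX: "acyclic_at s X" and aY: "acyclic_at s Y" and aXY: "s > 0 \<Longrightarrow> acyclic_at (s - 1) (X \<inter> Y)"
  shows "acyclic_at s (X \<union> Y)"
  unfolding acyclic_at_def
proof (intro allI impI)
  fix z assume z: "supp z \<subseteq> ideal_words s (X \<union> Y) \<and> bd z = 0"
  define z1 where "z1 = restr (ideal_words s X) z"
  define z2 where "z2 = restr (- ideal_words s X) z"
  have split: "z = z1 + z2" by (simp add: z1_def z2_def restr_split)
  have s1: "supp z1 \<subseteq> ideal_words s X" using supp_restr by (force simp: z1_def)
  have s2: "supp z2 \<subseteq> ideal_words s Y"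
  proof -
    have "supp z2 \<subseteq> ideal_words s (X \<union> Y) - ideal_words s X"
      using supp_restr[of "- ideal_words s X" z] z by (auto simp: z2_def)
    then show ?thesis by (force simp: ideal_words_def)
  qed
  have sum0: "bd z1 + bd z2 = 0" using z split by (simp add: lin_add)
  have mono: "ideal_words t A \<subseteq> ideal_words t B" if "A \<subseteq> B" for t A B
    using that by (auto simp: ideal_words_def)
  have "\<exists>y. supp y \<subseteq> ideal_words s (X \<inter> Y) \<and> bd y = bd z1"
  proof (cases "s > 0")
    case True
    have "bd z1 = - bd z2" using sum0 by (rule eq_neg_iff_add_eq_0[THEN iffD2])
    then have "supp (bd z1) \<subseteq> ideal_words (s - 1) X \<inter> ideal_words (s - 1) Y"
      using supp_bd_ideal(1)[OF X s1 True] supp_bd_ideal(1)[OF Y s2 True] by simp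
    also have "\<dots> = ideal_words (s - 1) (X \<inter> Y)"
      by (auto simp: ideal_words_def inj_map_eq_map)
    finally show ?thesis using aXY[OF True] True by (simp add: acyclic_at_def)
  next
    case False
    then show ?thesis using supp_bd_ideal(2)[OF X s1] by (intro exI[of _ 0]) auto
  qed
  then obtain y where y: "supp y \<subseteq> ideal_words s (X \<inter> Y)" "bd y = bd z1" by blast
  have "supp (z1 - y) \<subseteq> ideal_words s X"
    using keys_diff_subset[of z1 y] s1 y(1) mono[of "X \<inter> Y" X s] by blast
  moreover have "bd (z1 - y) = 0" using y(2) by (simp add: lin_diff)
  ultimately obtain y1 where y1: "supp y1 \<subseteq> ideal_words (Suc s) X" "bd y1 = z1 - y"
    using aX by (auto simp: acyclic_at_def)
  have "supp (z2 + y) \<subseteq> ideal_words s Y"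
    using keys_add[of z2 y] s2 y(1) mono[of "X \<inter> Y" Y s] by blast
  moreover have "bd (z2 + y) = 0" using y(2) sum0 by (simp add: lin_add add.commute)
  ultimately obtain y2 where y2: "supp y2 \<subseteq> ideal_words (Suc s) Y" "bd y2 = z2 + y"
    using aY by (auto simp: acyclic_at_def)
  have "supp (y1 + y2) \<subseteq> ideal_words (Suc s) (X \<union> Y)"
    using keys_add[of y1 y2] y1(1) y2(1) mono[of X "X \<union> Y" "Suc s"] mono[of Y "X \<union> Y" "Suc s"] by blast
  moreover have "bd (y1 + y2) = z" using y1 y2 split by (simp add: lin_add)
  ultimately show "\<exists>y. supp y \<subseteq> ideal_words (Suc s) (X \<union> Y) \<and> bd y = z" by blast
qed

lemma left_ideal_UN: "(\<And>a. a \<in> F \<Longrightarrow> left_ideal (J a)) \<Longrightarrow> left_ideal (\<Union>a\<in>F. J a)"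
  unfolding left_ideal_def by blast

text \<open>A Mayer--Vietoris induction: each step trades one homological degree for one more
intersected ideal. The intersection with P only matters for empty S.\<close>

lemma acyclic_Inter_Union:
  assumes "finite F" "finite S"
    and J: "\<And>a. a \<in> F \<union> S \<Longrightarrow> left_ideal (J a)"
    and units: "\<And>T. T \<subseteq> F \<union> S \<Longrightarrow> T \<noteq> {} \<Longrightarrow> card T \<le> N \<Longrightarrow> (\<Inter>a\<in>T. J a) \<noteq> {} \<Longrightarrow>
       \<exists>e\<in>(\<Inter>a\<in>T. J a). \<forall>x\<in>(\<Inter>a\<in>T. J a). m x e = (x, 1)"
    and "s + card S < N"
  shows "acyclic_at s (P \<inter> (\<Inter>a\<in>S. J a) \<inter> (\<Union>a\<in>F. J a))"
  using assms
proof (induction F arbitrary: s S rule: finite_induct)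
  case empty
  then show ?case by (simp add: acyclic_empty)
next
  case (insert b F)
  let ?I = "\<lambda>T. P \<inter> (\<Inter>a\<in>T. J a)"
  let ?X = "?I (insert b S)" and ?Y = "?I S \<inter> (\<Union>a\<in>F. J a)"
  have eq: "?I S \<inter> (\<Union>a\<in>insert b F. J a) = ?X \<union> ?Y" by auto
  have card: "card (insert b S) \<le> Suc (card S)"
    by (simp add: insert.prems(1) card_insert_if)
  have idI: "left_ideal (?I T)" if T: "T \<subseteq> insert b (F \<union> S)" for T
    unfolding left_ideal_def
  proof (intro conjI ballI)
    fix d x assume d: "d \<in> D" and x: "x \<in> ?I T"
    have "fst (m d x) \<in> J a" if "a \<in> T" for a
      using insert.prems(2)[of a] T that d x by (auto simp: left_ideal_def)
    then show "fst (m d x) \<in> ?I T" using P_left d x by blast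
  qed blast
  have idX: "left_ideal ?X" by (rule idI) auto
  have "left_ideal (?I S)" by (rule idI) auto
  moreover have "left_ideal (\<Union>a\<in>F. J a)" by (rule left_ideal_UN) (simp add: insert.prems(2))
  ultimately have idY: "left_ideal ?Y" by (rule left_ideal_Int)
  have "acyclic_at s ?X"
  proof (cases "?X = {}")
    case False
    have "left_ideal (J b)" using insert.prems(2) by simp
    then have X: "?X = (\<Inter>a\<in>insert b S. J a)" by (auto simp: left_ideal_def)
    \<comment> \<open>From \<open>s + card S < N\<close>, at most \<open>N\<close> ideals are
      intersected here, so \<open>units\<close> applies.\<close>
    have "\<exists>e\<in>?X. \<forall>x\<in>?X. m x e = (x, 1)"
      using insert.prems(4) card False unfolding X by (intro insert.prems(3)) auto
    then show ?thesis using acyclic_right_unit[OF idX] by auto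
  qed (simp only: acyclic_empty)
  moreover have "acyclic_at s ?Y"
    using insert.prems by (intro insert.IH) auto
  moreover have "acyclic_at (s - 1) (?X \<inter> ?Y)" if "s > 0"
  proof -
    \<comment> \<open>\<open>?X\<close> and \<open>?Y\<close> meet in a set of the shape of the
      claim with \<open>b\<close> added to \<open>S\<close>; the lower degree keeps
      \<open>s + card S\<close> below \<open>N\<close>.\<close>
    have "acyclic_at (s - 1) (?I (insert b S) \<inter> (\<Union>a\<in>F. J a))"
      using insert.prems that card by (intro insert.IH) auto
    moreover have "?X \<inter> ?Y = ?I (insert b S) \<inter> (\<Union>a\<in>F. J a)" by auto
    ultimately show ?thesis by simp
  qed
  ultimately show ?case
    unfolding eq using acyclic_Un[OF idX idY] by blast
qed

subsection \<open>Words containing a letter of the ideal\<close>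

definition mixed_words :: "nat \<Rightarrow> 'b option list set" where
  "mixed_words i = bar_word ` {v \<in> bar_cells D i. set v \<inter> P \<noteq> {}}"

text \<open>The cut comes right after the last letter in \<open>P\<close>, so \<open>v\<close> is
  the tail, and \<open>q\<close> filters by its length. The bound \<open>length v < i\<close> keeps
  the subtraction exact: \<open>w\<close> has \<open>i - length v\<close> letters besides
  \<open>None\<close>, hence degree one less than that.\<close>

definition short_tail_words :: "nat \<Rightarrow> nat \<Rightarrow> 'b option list set" where
  "short_tail_words i q = {w @ map Some v @ [None] | w v. w \<in> ideal_words (i - Suc (length v)) P \<and>
     set v \<subseteq> D - P \<and> length v < q \<and> length v < i}"

text \<open>If \<open>w'\<close> were longer than \<open>w\<close>, its last letter, which is in
  \<open>P\<close>, would occur in \<open>v\<close>; the length hypothesis excludes the opposite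
  case. Nothing is assumed about \<open>w\<close>, so coefficients can be compared at arbitrary
  words.\<close>

lemma ideal_words_append_eq:
  assumes "w' \<in> ideal_words s P" "set v \<subseteq> D - P" "length v' \<le> length v"
    and eq: "w @ map Some v @ [None] = w' @ map Some v' @ [None]"
  shows "w = w' \<and> v = v'"
proof -
  have last: "last w' \<in> Some ` P"
    using assms(1) by (auto simp: ideal_words_def last_map)
  from eq have "w @ map Some v = w' @ map Some v'" by simp
  then obtain us where us: "w = w' @ us \<and> us @ map Some v = map Some v' \<or> w @ us = w' \<and> map Some v = us @ map Some v'"
    unfolding append_eq_append_conv2 by blast
  have "us = []"
  proof (rule ccontr)
    assume ne: "us \<noteq> []"
    from us have "w @ us = w' \<and> map Some v = us @ map Some v'"
    proof
      assume "w = w' @ us \<and> us @ map Some v = map Some v'"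
      then have "length (us @ map Some v) = length (map Some v')" by presburger
      then have "length us + length v = length v'" by simp
      with assms(3) have "length us = 0" by linarith
      with ne show ?thesis by simp
    qed
    with ne have "last w' \<in> set (map Some v)" by auto
    with last assms(2) show False by auto
  qed
  with us show ?thesis by (auto simp: inj_map_eq_map)
qed

lemma short_tail_words_subset: "short_tail_words i q \<subseteq> mixed_words i"
proof
  fix k assume "k \<in> short_tail_words i q"
  then obtain u v where "k = (None # map Some u) @ map Some v @ [None]" "set u \<subseteq> D"
    "length u = Suc (i - Suc (length v))" "last u \<in> P" "set v \<subseteq> D - P" "length v < i"
    by (auto simp: short_tail_words_def ideal_words_def)
  moreover from this have "last u \<in> set u" by (intro last_in_set) auto
  ultimately have "k = bar_word (u @ v)" "set (u @ v) \<subseteq> D" "length (u @ v) = i" "last u \<in> set (u @ v) \<inter> P"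
    by (auto simp: bar_word_def)
  then show "k \<in> mixed_words i"
    unfolding mixed_words_def bar_cells_def by blast
qed

lemma mixed_words_subset: "mixed_words i \<subseteq> short_tail_words i i"
proof
  fix k assume "k \<in> mixed_words i"
  then obtain v where v: "k = bar_word v" "set v \<subseteq> D" "length v = i" "\<exists>x\<in>set v. x \<in> P"
    by (auto simp: mixed_words_def bar_cells_def)
  then obtain a x c where "v = a @ x # c" "x \<in> P" "\<forall>y\<in>set c. y \<notin> P"
    using split_list_last_prop[OF v(4)] by blast
  with v have "None # map Some (a @ [x]) \<in> ideal_words (i - Suc (length c)) P"
    unfolding ideal_words_def by (intro CollectI exI[of _ "a @ [x]"]) auto
  moreover have "k = (None # map Some (a @ [x])) @ map Some c @ [None]" "set c \<subseteq> D - P" "length c < i"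
    using v \<open>v = a @ x # c\<close> \<open>\<forall>y\<in>set c. y \<notin> P\<close> by (auto simp: bar_word_def)
  ultimately show "k \<in> short_tail_words i i"
    unfolding short_tail_words_def by blast
qed

text \<open>A merge reaching into the tail shortens it: the last letter of \<open>w\<close> absorbs
  a tail letter and stays in \<open>P\<close>, two tail letters merge outside \<open>P\<close>, or
  the final \<open>None\<close> absorbs a tail letter. For an empty tail the only such merge has
  coefficient 0. So the filtration quotients are copies of the bar complex of the ideal, one for
  each tail.\<close>

lemma bd_append_tail:
  assumes c: "supp c \<subseteq> ideal_words (i - Suc (length v)) P" and v: "set v \<subseteq> D - P" "length v < i"
  shows "supp (bd (push (\<lambda>w. w @ map Some v @ [None]) c) - push (\<lambda>w. w @ map Some v @ [None]) (bd c))
    \<subseteq> short_tail_words (i - 1) (length v)"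
proof -
  let ?t = "map Some v @ [None]"
  have word: "supp (word_bd om (w @ ?t) - push (\<lambda>w. w @ ?t) (word_bd om w)) \<subseteq> short_tail_words (i - 1) (length v)"
    if w: "w \<in> ideal_words (i - Suc (length v)) P" for w
  proof
    obtain u x where u: "w = None # map Some u @ [Some x]" "length u = i - Suc (length v)" "x \<in> P" "set u \<subseteq> D"
    proof -
      obtain v' where v': "w = None # map Some v'" "set v' \<subseteq> D" "length v' = Suc (i - Suc (length v))" "last v' \<in> P"
        using w by (auto simp: ideal_words_def)
      then obtain u y where "v' = u @ [y]" by (cases v' rule: rev_cases) auto
      with v' show thesis by (intro that[of u y]) auto
    qed
    have xD: "x \<in> D" using u P_subset by auto
    fix k assume "k \<in> supp (word_bd om (w @ ?t) - push (\<lambda>w. w @ ?t) (word_bd om w))"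
    also have "word_bd om (w @ ?t) - push (\<lambda>w. w @ ?t) (word_bd om w)
        = scal ((-1) ^ Suc (length u)) (push (\<lambda>w. (None # map Some u) @ w) (word_bd om (Some x # ?t)))"
      using word_bd_append[of om "None # map Some u" "Some x" ?t] u by simp
    finally obtain k' where k': "k' \<in> supp (word_bd om (Some x # ?t))" "k = (None # map Some u) @ k'"
      using keys_scal_subset keys_push_subset by fastforce
    obtain a p q c where w: "Some x # ?t = a @ p # q # c" and k'2: "k' = a @ fst (om p q) # c"
      and nz: "snd (om p q) \<noteq> 0"
      using k'(1) by (rule keys_word_bdE)
    have "\<exists>x' v'. k' = Some x' # map Some v' @ [None] \<and> x' \<in> P \<and> set v' \<subseteq> D - P \<and> length v = Suc (length v')"
    proof (cases a)
      case Nil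
      show ?thesis
      proof (cases v)
        case Nil': Nil
        with Nil w nz xD eps_P[OF u(3)] show ?thesis by auto
      next
        case (Cons y v')
        with v(1) Nil w k'2 xD P_right[OF u(3), of y] show ?thesis
          by (intro exI[of _ "fst (m x y)"] exI[of _ v']) auto
      qed
    next
      case (Cons a0 a')
      with w have a0: "a0 = Some x" "map Some v @ [None] = a' @ p # q # c" by auto
      show ?thesis
      proof (cases c rule: rev_cases)
        case Nil
        with a0 have "map Some v = a' @ [p]" "q = None" by auto
        then obtain v' y where "v = v' @ [y]" "a' = map Some v'" "p = Some y"
          by (auto simp: map_eq_append_conv)
        with Nil Cons a0 k'2 u v(1) \<open>q = None\<close> show ?thesis
          by (intro exI[of _ x] exI[of _ v']) auto
      next
        case (snoc c' z)
        with a0 have "map Some v = a' @ p # q # c'" "z = None" by auto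
        then obtain b y y' b' where b: "v = b @ y # y' # b'" "a' = map Some b" "p = Some y" "q = Some y'"
            "c' = map Some b'"
          by (auto simp: map_eq_append_conv map_eq_Cons_conv Cons_eq_map_conv)
        with v(1) P_compl[of y y'] Cons a0 snoc k'2 u \<open>z = None\<close> show ?thesis
          by (intro exI[of _ x] exI[of _ "b @ fst (m y y') # b'"]) auto
      qed
    qed
    then obtain x' v' where x': "k' = Some x' # map Some v' @ [None]" "x' \<in> P" "set v' \<subseteq> D - P"
      "length v = Suc (length v')" by blast
    have "None # map Some (u @ [x']) \<in> ideal_words (i - 1 - Suc (length v')) P"
      using u x' P_subset unfolding ideal_words_def by (intro CollectI exI[of _ "u @ [x']"]) auto
    then show "k \<in> short_tail_words (i - 1) (length v)"
      using x' k' v unfolding short_tail_words_def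
      by (intro CollectI exI[of _ "None # map Some (u @ [x'])"] exI[of _ v']) auto
  qed
  have "bd (push (\<lambda>w. w @ ?t) c) - push (\<lambda>w. w @ ?t) (bd c)
      = lin (\<lambda>w. word_bd om (w @ ?t) - push (\<lambda>w. w @ ?t) (word_bd om w)) c"
    by (simp add: lin_push push_lin lin_diff_fun)
  also have "supp \<dots> \<subseteq> (\<Union>w\<in>supp c. supp (word_bd om (w @ ?t) - push (\<lambda>w. w @ ?t) (word_bd om w)))"
    by (rule keys_lin_subset)
  also have "\<dots> \<subseteq> short_tail_words (i - 1) (length v)" using word c by blast
  finally show ?thesis .
qed

lemma short_tail_words_mono: "q \<le> q' \<Longrightarrow> short_tail_words i q \<subseteq> short_tail_words i q'"
  unfolding short_tail_words_def by fastforce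

text \<open>No merge lengthens the tail, so each stage of the filtration is a subcomplex.\<close>

lemma bd_short_tail:
  assumes "supp c \<subseteq> short_tail_words i q"
  shows "supp (bd c) \<subseteq> short_tail_words (i - 1) q"
proof -
  have "supp (word_bd om k) \<subseteq> short_tail_words (i - 1) q" if mem: "k \<in> short_tail_words i q" for k
  proof -
    obtain w v where k: "k = w @ map Some v @ [None]" and w: "w \<in> ideal_words (i - Suc (length v)) P"
      and v: "set v \<subseteq> D - P" "length v < q" "length v < i"
      using mem by (auto simp: short_tail_words_def)
    let ?f = "\<lambda>w. w @ map Some v @ [None]"
    let ?c = "sgl w (1 :: 'r)"
    have c: "supp ?c \<subseteq> ideal_words (i - Suc (length v)) P" using w by auto
    have "supp (bd (push ?f ?c) - push ?f (bd ?c)) \<subseteq> short_tail_words (i - 1) q"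
      using bd_append_tail[OF c v(1,3)] short_tail_words_mono[of "length v" q "i - 1"] v(2) by auto
    moreover have "supp (push ?f (bd ?c)) \<subseteq> short_tail_words (i - 1) q"
    proof (cases "i - Suc (length v) = 0")
      case True
      then show ?thesis using supp_bd_ideal(2)[OF left_ideal_P c] by (simp del: lin_single)
    next
      case False
      then have "supp (bd ?c) \<subseteq> ideal_words (i - 1 - Suc (length v)) P"
        using supp_bd_ideal(1)[OF left_ideal_P c] by (simp add: diff_commute)
      then have "supp (push ?f (bd ?c)) \<subseteq> ?f ` ideal_words (i - 1 - Suc (length v)) P"
        using keys_push_subset[of ?f "bd ?c"] by blast
      also have "\<dots> \<subseteq> short_tail_words (i - 1) q"
      proof
        fix k assume "k \<in> ?f ` ideal_words (i - 1 - Suc (length v)) P"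
        moreover have "length v < i - 1" using False by simp
        ultimately show "k \<in> short_tail_words (i - 1) q"
          using v unfolding short_tail_words_def by blast
      qed
      finally show ?thesis .
    qed
    ultimately have "supp (bd (push ?f ?c)) \<subseteq> short_tail_words (i - 1) q"
      using keys_add[of "bd (push ?f ?c) - push ?f (bd ?c)" "push ?f (bd ?c)"] by auto
    then show ?thesis by (simp add: k)
  qed
  then show ?thesis using assms keys_lin_subset[of "word_bd om" c] by blast
qed

text \<open>Induction on the filtration: the part of \<open>z\<close> with tails of length exactly
  \<open>q\<close> is filled tail by tail in the bar complex of the ideal, and the error has shorter
  tails.\<close>

lemma exact_short_tail:
  assumes acyclic: "\<And>s. s < i \<Longrightarrow> acyclic_at s P"
    and "supp z \<subseteq> short_tail_words i q" "bd z = 0"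
  shows "\<exists>y. supp y \<subseteq> mixed_words (Suc i) \<and> bd y = z"
  using assms(2,3)
proof (induction q arbitrary: z)
  case 0
  then have "z = 0" by (simp add: short_tail_words_def)
  then show ?case by (intro exI[of _ 0]) simp
next
  case (Suc q)
  show ?case
  proof (cases "q < i")
    case False
    then have "short_tail_words i (Suc q) \<subseteq> short_tail_words i q"
      by (fastforce simp: short_tail_words_def)
    with Suc show ?thesis by blast
  next
    case True
    define s where "s = i - Suc q"
    define T where "T = {v. set v \<subseteq> D - P \<and> length v = q}"
    define f where "f v w = w @ map Some v @ [None]" for v :: "'b list" and w
    have finT: "finite T" unfolding T_def by (rule finite_lists_length_eq) (simp add: finite_D)
    have inj: "inj (f v)" for v by (auto simp: inj_def f_def)
    have uniq: "w = w' \<and> v = v'"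
      if "f v w = f v' w'" "v \<in> T" "w' \<in> ideal_words t P" "length v' \<le> q" for v v' w w' t
      using ideal_words_append_eq[of w' t v v' w] that by (auto simp: T_def f_def)
    \<comment> \<open>The coefficients of \<open>z\<close> at words with tail \<open>v\<close>, read
      as a chain of the ideal's bar complex.\<close>
    define zv where "zv v = Poly_Mapping.map_key (f v) z" for v
    have coef_zv: "coef (zv v) w = coef z (f v w)" for v w
      by (simp add: zv_def map_key.rep_eq inj)
    have supp_zv: "supp (zv v) \<subseteq> ideal_words s P" if v: "v \<in> T" for v
    proof
      fix w assume "w \<in> supp (zv v)"
      then have "f v w \<in> short_tail_words i (Suc q)"
        using Suc.prems(1) by (auto simp: in_keys_iff coef_zv)
      then obtain w' v' where "f v w = f v' w'" "w' \<in> ideal_words (i - Suc (length v')) P" "length v' \<le> q"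
        by (auto simp: short_tail_words_def f_def)
      with uniq v have "w = w'" "v = v'" by blast+
      then show "w \<in> ideal_words s P"
        using \<open>w' \<in> _\<close> v by (simp add: s_def T_def)
    qed
    \<comment> \<open>Distinct tails of length \<open>q\<close> occupy disjoint sets of words, so
      the summands can be read off one by one.\<close>
    have coef_sum: "coef (\<Sum>v'\<in>T. push (f v') (g v')) (f v w) = coef (g v) w"
      if "v \<in> T" "\<And>v. v \<in> T \<Longrightarrow> supp (g v) \<subseteq> ideal_words t P" for g t v w
    proof -
      have "coef (push (f v') (g v')) (f v w) = (if v' = v then coef (g v) w else 0)" if "v' \<in> T" for v'
      proof (cases "v' = v")
        case False
        have "f v w \<notin> f v' ` supp (g v')"
        proof
          assume "f v w \<in> f v' ` supp (g v')"
          then obtain w' where "f v w = f v' w'" "w' \<in> supp (g v')" by blast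
          then have "v = v'"
            using uniq[of v w v' w' t] \<open>v \<in> T\<close> that \<open>\<And>v. v \<in> T \<Longrightarrow> supp (g v) \<subseteq> ideal_words t P\<close>[of v']
            by (auto simp: T_def)
          with False show False by simp
        qed
        then show ?thesis using False by (simp add: lookup_push_notin)
      qed (simp add: lookup_push_inj[OF inj])
      then show ?thesis using finT \<open>v \<in> T\<close> by (simp add: lookup_sum)
    qed
    have supp_sum: "supp (sum g T) \<subseteq> A" if "\<And>v. v \<in> T \<Longrightarrow> supp (g v) \<subseteq> A" for A and g :: "_ \<Rightarrow> ('b option list \<Rightarrow>\<^sub>0 'r)"
    proof
      fix k assume "k \<in> supp (sum g T)"
      then have "(\<Sum>v\<in>T. coef (g v) k) \<noteq> 0" by (simp add: in_keys_iff lookup_sum)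
      then obtain v where "v \<in> T" "coef (g v) k \<noteq> 0" by (meson sum.neutral)
      with that[of v] show "k \<in> A" by (auto simp: in_keys_iff)
    qed
    define top where "top = (\<Sum>v\<in>T. push (f v) (zv v))"
    have supp_low: "supp (z - top) \<subseteq> short_tail_words i q"
    proof
      fix k assume k: "k \<in> supp (z - top)"
      have "supp top \<subseteq> short_tail_words i (Suc q)"
        unfolding top_def
      proof (rule supp_sum)
        fix v assume v: "v \<in> T"
        have "supp (push (f v) (zv v)) \<subseteq> f v ` ideal_words s P"
          using keys_push_subset[of "f v"] supp_zv[OF v] by blast
        also have "\<dots> \<subseteq> short_tail_words i (Suc q)"
          using v True by (auto simp: T_def s_def f_def short_tail_words_def)
        finally show "supp (push (f v) (zv v)) \<subseteq> short_tail_words i (Suc q)" .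
      qed
      with k Suc.prems(1) have "k \<in> short_tail_words i (Suc q)" using keys_diff_subset[of z top] by blast
      then obtain w v where wv: "k = f v w" "w \<in> ideal_words (i - Suc (length v)) P"
        "set v \<subseteq> D - P" "length v < Suc q" "length v < i"
        by (auto simp: short_tail_words_def f_def)
      have "length v \<noteq> q"
      proof
        assume "length v = q"
        then have "v \<in> T" using wv by (simp add: T_def)
        then have "coef (z - top) k = 0"
          using coef_sum[of v zv s w] supp_zv by (simp add: top_def lookup_minus wv coef_zv)
        with k show False by (simp add: in_keys_iff)
      qed
      with wv have "length v < q" by simp
      with wv show "k \<in> short_tail_words i q" unfolding short_tail_words_def f_def by blast
    qed
    have supp_err: "supp (bd (push (f v) c) - push (f v) (bd c)) \<subseteq> short_tail_words (j - 1) q"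
      if "v \<in> T" "supp c \<subseteq> ideal_words (j - Suc q) P" "q < j" for v c j
      using bd_append_tail[of c j v] that unfolding f_def T_def by auto
    \<comment> \<open>Up to shorter tails, the boundary of \<open>z\<close> is the sum of the
      boundaries of the \<open>zv v\<close> with \<open>v\<close> attached. As it vanishes, that sum
      lives on tails shorter than \<open>q\<close>; but all its words have tails of length exactly
      \<open>q\<close>.\<close>
    have bd_zv: "bd (zv v) = 0" if v: "v \<in> T" for v
    proof (cases "s > 0")
      case False
      then show ?thesis using supp_bd_ideal(2)[OF left_ideal_P supp_zv[OF v]] by simp
    next
      case s: True
      have supp_bd_zv: "supp (bd (zv v)) \<subseteq> ideal_words (s - 1) P" if "v \<in> T" for v
        using supp_bd_ideal(1)[OF left_ideal_P supp_zv[OF that] s] .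
      let ?err = "\<Sum>v\<in>T. bd (push (f v) (zv v)) - push (f v) (bd (zv v))"
      have "supp ?err \<subseteq> short_tail_words (i - 1) q"
        by (rule supp_sum, rule supp_err[OF _ _ True]) (simp_all add: supp_zv flip: s_def)
      then have low: "supp (bd (z - top) + ?err) \<subseteq> short_tail_words (i - 1) q"
        using bd_short_tail[OF supp_low] keys_add[of "bd (z - top)" ?err] by blast
      have "bd (z - top) + ?err = - (\<Sum>v\<in>T. push (f v) (bd (zv v)))"
        using Suc.prems(2) by (simp add: top_def lin_diff lin_sum sum_subtractf)
      with low have low': "supp (\<Sum>v\<in>T. push (f v) (bd (zv v))) \<subseteq> short_tail_words (i - 1) q"
        by simp
      have "coef (bd (zv v)) w = 0" for w
      proof (rule ccontr)
        assume nz: "coef (bd (zv v)) w \<noteq> 0"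
        then have "f v w \<in> short_tail_words (i - 1) q"
          using low' coef_sum[of v "\<lambda>v. bd (zv v)" "s - 1" w] v supp_bd_zv by (auto simp: in_keys_iff)
        then obtain w' v' where "f v w = f v' w'" "w' \<in> ideal_words (i - 1 - Suc (length v')) P" "length v' < q"
          by (auto simp: short_tail_words_def f_def)
        then have "v = v'" using uniq[of v w v' w'] v by auto
        with \<open>length v' < q\<close> v show False by (simp add: T_def)
      qed
      then show ?thesis by (intro poly_mapping_eqI) simp
    qed
    have "\<exists>y. supp y \<subseteq> ideal_words (Suc s) P \<and> bd y = zv v" if "v \<in> T" for v
      using acyclic[of s] supp_zv[OF that] bd_zv[OF that] True by (simp add: acyclic_at_def s_def)
    then obtain yv where yv: "\<And>v. v \<in> T \<Longrightarrow> supp (yv v) \<subseteq> ideal_words (Suc s) P \<and> bd (yv v) = zv v"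
      by metis
    have Suc_s: "Suc s = Suc i - Suc q" using True by (simp add: s_def)
    define y where "y = (\<Sum>v\<in>T. push (f v) (yv v))"
    have "supp y \<subseteq> mixed_words (Suc i)"
      unfolding y_def
    proof (rule supp_sum)
      fix v assume v: "v \<in> T"
      have "supp (push (f v) (yv v)) \<subseteq> f v ` ideal_words (Suc s) P"
        using keys_push_subset[of "f v"] yv[OF v] by blast
      also have "\<dots> \<subseteq> short_tail_words (Suc i) (Suc q)"
      proof
        fix k assume "k \<in> f v ` ideal_words (Suc s) P"
        then obtain w where "k = w @ map Some v @ [None]" "w \<in> ideal_words (Suc s) P"
          by (auto simp: f_def)
        moreover have "Suc s = Suc i - Suc (length v)" "set v \<subseteq> D - P" "length v < Suc q" "length v < Suc i"
          using v True Suc_s by (auto simp: T_def)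
        ultimately show "k \<in> short_tail_words (Suc i) (Suc q)"
          unfolding short_tail_words_def by (intro CollectI exI[of _ w] exI[of _ v]) simp
      qed
      finally show "supp (push (f v) (yv v)) \<subseteq> mixed_words (Suc i)"
        using short_tail_words_subset by blast
    qed
    \<comment> \<open>The boundary of \<open>y\<close> is \<open>top\<close> up to shorter tails, so
      the difference falls under the induction hypothesis.\<close>
    moreover have "supp (z - bd y) \<subseteq> short_tail_words i q"
    proof -
      let ?err = "\<Sum>v\<in>T. bd (push (f v) (yv v)) - push (f v) (bd (yv v))"
      have "bd y = ?err + top"
        using yv by (simp add: y_def top_def lin_sum sum_subtractf)
      then have eq: "z - bd y = (z - top) - ?err" by simp
      have "supp ?err \<subseteq> short_tail_words i q"
      proof (rule supp_sum)
        fix v assume v: "v \<in> T"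
        then have "supp (yv v) \<subseteq> ideal_words (Suc i - Suc q) P" using yv Suc_s by simp
        from supp_err[OF v this] True
        show "supp (bd (push (f v) (yv v)) - push (f v) (bd (yv v))) \<subseteq> short_tail_words i q" by simp
      qed
      then show ?thesis
        unfolding eq using supp_low keys_diff_subset[of "z - top" ?err] by blast
    qed
    moreover have "bd (z - bd y) = 0" using Suc.prems(2) by (simp add: lin_diff)
    ultimately obtain y' where "supp y' \<subseteq> mixed_words (Suc i)" "bd y' = z - bd y" "supp y \<subseteq> mixed_words (Suc i)"
      using Suc.IH by blast
    then show ?thesis
      using keys_add[of y' y] by (intro exI[of _ "y' + y"]) (auto simp: lin_add)
  qed
qed

subsection \<open>Comparison with the bar complex\<close>

definition to_words :: "nat \<Rightarrow> ('b list \<Rightarrow> 'r) \<Rightarrow> ('b option list \<Rightarrow>\<^sub>0 'r)" where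
  "to_words i c = (\<Sum>xs\<in>bar_cells D i. sgl (bar_word xs) (c xs))"

lemma finite_bar_cells: "finite (bar_cells D i)"
  unfolding bar_cells_def by (rule finite_lists_length_eq[OF finite_D])

lemma coef_to_words: "coef (to_words i c) (bar_word xs) = (if xs \<in> bar_cells D i then c xs else 0)"
proof -
  have "coef (to_words i c) (bar_word xs) = (\<Sum>ys\<in>bar_cells D i. if ys = xs then c ys else 0)"
    by (simp add: to_words_def lookup_sum lookup_single when_def inj_eq[OF inj_bar_word])
  then show ?thesis using finite_bar_cells by simp
qed

lemma supp_to_words: "supp (to_words i c) \<subseteq> bar_word ` {xs \<in> bar_cells D i. c xs \<noteq> 0}"
proof
  fix k assume "k \<in> supp (to_words i c)"
  then have "(\<Sum>xs\<in>bar_cells D i. coef (sgl (bar_word xs) (c xs)) k) \<noteq> 0"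
    by (simp add: in_keys_iff to_words_def lookup_sum)
  then obtain xs where "xs \<in> bar_cells D i" "coef (sgl (bar_word xs) (c xs)) k \<noteq> 0"
    by (meson sum.neutral)
  then show "k \<in> bar_word ` {xs \<in> bar_cells D i. c xs \<noteq> 0}"
    by (auto simp: lookup_single when_def split: if_splits)
qed

text \<open>The leading \<open>None\<close> turns merge number j of \<open>xs\<close> into number j
  + 1 of the bar word, whence the global minus sign. The first and last merges absorb an end letter
  into \<open>None\<close> and give the augmentation terms.\<close>

lemma bar_bd_eq:
  assumes "set xs \<subseteq> D"
  shows "bar_bd m eps xs ys = - coef (word_bd om (bar_word xs)) (bar_word ys)"
proof (cases "xs = []")
  case True
  then show ?thesis by (simp add: bar_bd_def bar_word_def)
next
  case False
  define i where "i = length xs"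
  define w where "w = bar_word xs"
  define g where "g j = (if take j w @ fst (om (w ! j) (w ! Suc j)) # drop (j + 2) w = bar_word ys
      then (-1) ^ Suc j * snd (om (w ! j) (w ! Suc j)) else 0)" for j
  have i: "i > 0" "length w = i + 2" using False by (auto simp: i_def w_def bar_word_def)
  have mem: "xs ! j \<in> D" if "j < i" for j using that assms by (auto simp: i_def)
  have "coef (word_bd om w) (bar_word ys) = (\<Sum>j\<in>{Suc 0..<Suc (Suc i)}.
      if take (j - 1) w @ fst (om (w ! (j - 1)) (w ! j)) # drop (j + 1) w = bar_word ys
      then (-1) ^ j * snd (om (w ! (j - 1)) (w ! j)) else 0)"
  proof -
    have "{1..<length w} = {Suc 0..<Suc (Suc i)}" using i(2) by simp
    then show ?thesis by (simp only: word_bd_nth lookup_sum lookup_single when_def)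
  qed
  also have "\<dots> = (\<Sum>j\<in>{0..<Suc i}. g j)"
    by (subst sum.shift_bounds_Suc_ivl) (simp add: g_def cong: if_cong)
  also have "\<dots> = g 0 + (\<Sum>j\<in>{1..<i}. g j) + g i"
    using i(1) by (simp add: sum.atLeast_Suc_lessThan)
  also have "g 0 = - (if ys = tl xs then eps (hd xs) else 0)"
  proof -
    obtain x u where xs: "xs = x # u" using False by (cases xs) auto
    then have "fst (om None (Some x)) # map Some u @ [None] = bar_word (tl xs)" "x \<in> D"
      using assms by (auto simp: bar_word_def)
    then show ?thesis
      by (auto simp: g_def w_def xs bar_word_def inj_map_eq_map)
  qed
  also have "g i = - (if ys = butlast xs then (-1) ^ length xs * eps (last xs) else 0)"
  proof -
    obtain x u where xs: "xs = u @ [x]" using False by (cases xs rule: rev_cases) auto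
    have x: "x \<in> D" using assms xs by simp
    have w: "w = (None # map Some u) @ [Some x, None]" by (simp add: w_def bar_word_def xs)
    have len: "i = length (None # map Some u)" by (simp add: i_def xs)
    have "take i w = None # map Some u" "w ! i = Some x" "w ! Suc i = None" "drop (i + 2) w = []"
      unfolding w len by (simp_all only: append_eq_conv_conj nth_append_length) (simp_all add: nth_append)
    then show ?thesis using x
      by (auto simp: g_def xs bar_word_def inj_map_eq_map i_def)
  qed
  also have "(\<Sum>j\<in>{1..<i}. g j) = - (\<Sum>j\<in>{1..<i}.
           if ys = take (j - 1) xs @ fst (m (xs ! (j - 1)) (xs ! j)) # drop (j + 1) xs
           then (-1) ^ j * snd (m (xs ! (j - 1)) (xs ! j)) else 0)"
    unfolding sum_negf[symmetric]
  proof (rule sum.cong)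
    fix j assume j: "j \<in> {1..<i}"
    then obtain l where l: "j = Suc l" by (cases j) auto
    have "xs ! l \<in> D" "xs ! j \<in> D" using j l by (auto intro: mem)
    moreover have "w ! j = Some (xs ! l)" "w ! Suc j = Some (xs ! j)"
      using j l by (auto simp: w_def bar_word_def nth_append i_def)
    moreover have "take j w = None # map Some (take l xs)" "drop (j + 2) w = map Some (drop (j + 1) xs) @ [None]"
      using j l by (auto simp: w_def bar_word_def take_map drop_map i_def)
    ultimately have "take j w @ fst (om (w ! j) (w ! Suc j)) # drop (j + 2) w
        = bar_word (take l xs @ fst (m (xs ! l) (xs ! j)) # drop (j + 1) xs)"
      "snd (om (w ! j) (w ! Suc j)) = snd (m (xs ! l) (xs ! j))"
      by (simp_all add: bar_word_def)
    then show "g j = - (if ys = take (j - 1) xs @ fst (m (xs ! (j - 1)) (xs ! j)) # drop (j + 1) xs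
           then (-1) ^ j * snd (m (xs ! (j - 1)) (xs ! j)) else 0)"
      by (auto simp: g_def l inj_eq[OF inj_bar_word])
  qed simp
  finally show ?thesis using False by (simp add: bar_bd_def w_def i_def)
qed

lemma bar_bd_nonzero:
  assumes "set xs \<subseteq> D" "bar_bd m eps xs ys \<noteq> 0"
  shows "length xs = Suc (length ys)" "set ys \<subseteq> D" "set xs \<inter> P = {} \<longleftrightarrow> set ys \<inter> P = {}"
proof -
  have "bar_word ys \<in> supp (word_bd om (bar_word xs))"
    using assms by (simp add: bar_bd_eq in_keys_iff)
  then obtain v' where "bar_word ys = bar_word v'" "length xs = Suc (length v')" "set v' \<subseteq> D"
    "set xs \<inter> P = {} \<longleftrightarrow> set v' \<inter> P = {}"
    by (rule word_bd_bar_word[OF assms(1)])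
  then show "length xs = Suc (length ys)" "set ys \<subseteq> D" "set xs \<inter> P = {} \<longleftrightarrow> set ys \<inter> P = {}"
    by (simp_all add: inj_eq[OF inj_bar_word])
qed

lemma bar_diff_eq: "bar_diff D m eps i c ys = - coef (bd (to_words i c)) (bar_word ys)"
proof -
  have "coef (bd (to_words i c)) (bar_word ys)
      = (\<Sum>xs\<in>bar_cells D i. c xs * coef (word_bd om (bar_word xs)) (bar_word ys))"
    by (simp add: to_words_def lin_sum lookup_sum)
  also have "\<dots> = (\<Sum>xs\<in>bar_cells D i. - (c xs * bar_bd m eps xs ys))"
    by (rule sum.cong) (auto simp: bar_bd_eq bar_cells_def)
  finally show ?thesis by (simp add: bar_diff_def sum_negf)
qed

lemma bar_boundary_if_mixed:
  assumes acyclic: "\<And>s. s < i \<Longrightarrow> acyclic_at s P"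
    and c: "c \<in> bar_cycles D m eps i" and mixed: "\<And>xs. set xs \<inter> P = {} \<Longrightarrow> c xs = 0"
  shows "c \<in> bar_boundaries D m eps i"
proof -
  let ?z = "to_words i c"
  have "{xs \<in> bar_cells D i. c xs \<noteq> 0} \<subseteq> {xs \<in> bar_cells D i. set xs \<inter> P \<noteq> {}}"
    using mixed by auto
  then have "supp ?z \<subseteq> mixed_words i"
    unfolding mixed_words_def using supp_to_words[of i c] by blast
  then have supp: "supp ?z \<subseteq> short_tail_words i i"
    using mixed_words_subset by blast
  \<comment> \<open>\<open>bar_diff\<close> records only coefficients at bar words; this suffices
    because boundaries of bar words are supported on bar words.\<close>
  have "bd ?z = 0"
  proof (rule poly_mapping_eqI)
    fix k
    show "coef (bd ?z) k = coef 0 k"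
    proof (cases "k \<in> supp (bd ?z)")
      case True
      then obtain w where "w \<in> supp ?z" "k \<in> supp (word_bd om w)"
        using keys_lin_subset[of "word_bd om" ?z] by blast
      then obtain xs where "xs \<in> bar_cells D i" "k \<in> supp (word_bd om (bar_word xs))"
        using supp_to_words[of i c] by blast
      then obtain ys where k: "k = bar_word ys"
        using word_bd_bar_word[of xs k] by (auto simp: bar_cells_def)
      have "bar_diff D m eps i c ys = 0" using c by (simp add: bar_cycles_def)
      then show ?thesis by (simp add: k bar_diff_eq)
    qed (simp add: in_keys_iff)
  qed
  then obtain y where y: "supp y \<subseteq> mixed_words (Suc i)" "bd y = ?z"
    using exact_short_tail[OF acyclic supp] by blast
  \<comment> \<open>The minus sign compensates the one in \<open>bar_diff_eq\<close>.\<close>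
  define b where "b xs = (if xs \<in> bar_cells D (Suc i) then - coef y (bar_word xs) else 0)" for xs
  have "to_words (Suc i) b = - y"
  proof (rule poly_mapping_eqI)
    fix k
    show "coef (to_words (Suc i) b) k = coef (- y) k"
    proof (cases "k \<in> bar_word ` bar_cells D (Suc i)")
      case True
      then show ?thesis by (auto simp: coef_to_words b_def)
    next
      case False
      then have "k \<notin> supp y" "k \<notin> supp (to_words (Suc i) b)"
        using y(1) supp_to_words[of "Suc i" b] by (auto simp: mixed_words_def)
      then show ?thesis by (simp add: in_keys_iff)
    qed
  qed
  then have "bar_diff D m eps (Suc i) b = c"
    using c by (auto simp: bar_diff_eq lin_minus y(2) coef_to_words bar_cycles_def bar_chains_def)
  moreover have "b \<in> bar_chains D (Suc i)" by (simp add: b_def bar_chains_def)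
  ultimately show ?thesis by (auto simp: bar_boundaries_def)
qed

text \<open>Words without a letter in \<open>P\<close> are the images of words over \<open>E\<close>
  and span a direct summand; \<open>pull\<close> is the projection to it. A cycle differs from the
  push of its pull by a cycle of mixed words, which bounds by acyclicity. Conversely, a filling of a
  pushed cycle is pulled back to a filling over \<open>E\<close>.\<close>

lemma induces_homology_iso_if_acyclic:
  fixes f :: "'c \<Rightarrow> 'b" and m' :: "'c \<Rightarrow> 'c \<Rightarrow> 'c \<times> 'r"
  assumes acyclic: "\<And>s. s < i \<Longrightarrow> acyclic_at s P"
    and inj: "inj_on f E" and image: "f ` E = D - P"
    and closed': "\<And>p q. p \<in> E \<Longrightarrow> q \<in> E \<Longrightarrow> fst (m' p q) \<in> E"
    and mult: "\<And>p q. p \<in> E \<Longrightarrow> q \<in> E \<Longrightarrow> m (f p) (f q) = (f (fst (m' p q)), snd (m' p q))"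
    and eps: "\<And>p. p \<in> E \<Longrightarrow> eps (f p) = eps' p"
  shows "induces_homology_iso E m' eps' D m eps f i"
proof -
  have map_inj: "map f xs = map f ys \<longleftrightarrow> xs = ys" if "set xs \<subseteq> E" "set ys \<subseteq> E" for xs ys
    using that by (intro inj_on_map_eq_map inj_on_subset[OF inj]) auto
  have pure_cells: "{xs \<in> bar_cells D j. set xs \<inter> P = {}} = map f ` bar_cells E j" for j
  proof (intro set_eqI iffI)
    fix xs assume "xs \<in> {xs \<in> bar_cells D j. set xs \<inter> P = {}}"
    then have xs: "set xs \<subseteq> f ` E" "length xs = j" by (auto simp: bar_cells_def image)
    then have "xs \<in> lists (f ` E)" by auto
    then obtain ys where "ys \<in> lists E" "xs = map f ys" unfolding lists_image by blast
    with xs show "xs \<in> map f ` bar_cells E j" by (auto simp: bar_cells_def)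
  next
    fix xs assume "xs \<in> map f ` bar_cells E j"
    then have "set xs \<subseteq> f ` E" "length xs = j" by (auto simp: bar_cells_def intro: image_mono[THEN subsetD])
    then show "xs \<in> {xs \<in> bar_cells D j. set xs \<inter> P = {}}"
      unfolding image by (auto simp: bar_cells_def)
  qed
  have finE: "finite (bar_cells E j)" for j
  proof (rule finite_imageD)
    show "finite (map f ` bar_cells E j)"
      unfolding pure_cells[symmetric] using finite_bar_cells by simp
    show "inj_on (map f) (bar_cells E j)"
      using map_inj by (auto simp: inj_on_def bar_cells_def)
  qed
  have bar_bd_map: "bar_bd m eps (map f xs) (map f ys) = bar_bd m' eps' xs ys"
    if xs: "set xs \<subseteq> E" and ys: "set ys \<subseteq> E" for xs ys
  proof (cases "xs = []")
    case False
    have 1: "(if map f ys = tl (map f xs) then eps (hd (map f xs)) else 0) = (if ys = tl xs then eps' (hd xs) else 0)"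
    proof -
      have "set (tl xs) \<subseteq> E" "hd xs \<in> E" using xs False by (cases xs; auto)+
      then show ?thesis
        using map_inj[OF ys, of "tl xs"] False by (simp add: map_tl[symmetric] hd_map eps)
    qed
    have 2: "(if map f ys = butlast (map f xs) then (-1) ^ length (map f xs) * eps (last (map f xs)) else 0)
        = (if ys = butlast xs then (-1) ^ length xs * eps' (last xs) else 0)"
    proof -
      have "set (butlast xs) \<subseteq> E" "last xs \<in> E" using xs False by (auto dest: in_set_butlastD)
      then show ?thesis
        using map_inj[OF ys, of "butlast xs"] False by (simp add: map_butlast[symmetric] last_map eps)
    qed
    have 3: "(if map f ys = take (j - 1) (map f xs) @ fst (m (map f xs ! (j - 1)) (map f xs ! j)) # drop (j + 1) (map f xs)
           then (-1) ^ j * snd (m (map f xs ! (j - 1)) (map f xs ! j)) else 0)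
        = (if ys = take (j - 1) xs @ fst (m' (xs ! (j - 1)) (xs ! j)) # drop (j + 1) xs
           then (-1) ^ j * snd (m' (xs ! (j - 1)) (xs ! j)) else 0)" if j: "j \<in> {1..<length xs}" for j
    proof -
      have E: "xs ! (j - 1) \<in> E" "xs ! j \<in> E" using j xs by (auto simp: subset_iff)
      have nth: "map f xs ! (j - 1) = f (xs ! (j - 1))" "map f xs ! j = f (xs ! j)"
        using j by (simp_all add: less_imp_diff_less)
      let ?w = "take (j - 1) xs @ fst (m' (xs ! (j - 1)) (xs ! j)) # drop (j + 1) xs"
      have "set ?w \<subseteq> E"
        using xs closed'[OF E] set_take_subset[of "j - 1" xs] set_drop_subset[of "j + 1" xs] by auto
      moreover have "take (j - 1) (map f xs) @ fst (m (map f xs ! (j - 1)) (map f xs ! j)) # drop (j + 1) (map f xs) = map f ?w"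
        and "snd (m (map f xs ! (j - 1)) (map f xs ! j)) = snd (m' (xs ! (j - 1)) (xs ! j))"
        using nth mult[OF E] by (simp_all only: take_map drop_map map_append list.map fst_conv snd_conv)
      ultimately show ?thesis using map_inj[OF ys, of ?w] by presburger
    qed
    show ?thesis
      unfolding bar_bd_def map_is_Nil_conv if_not_P[OF False]
      by (intro arg_cong2[where f = "(+)"] 1 2 sum.cong 3) simp_all
  qed (simp add: bar_bd_def)
  \<comment> \<open>Chains are functions on all lists, so coefficients at lists not over
    \<open>E\<close> must be controlled as well.\<close>
  have bar_bd_outside: "bar_bd m' eps' xs ys = 0" if xs: "set xs \<subseteq> E" and ys: "\<not> set ys \<subseteq> E" for xs ys
  proof (cases "xs = []")
    case False
    have "set (tl xs) \<subseteq> E" "set (butlast xs) \<subseteq> E"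
      using xs False by (auto dest: in_set_butlastD list.set_sel(2))
    then have ends: "ys \<noteq> tl xs" "ys \<noteq> butlast xs" using ys by blast+
    have inner: "ys \<noteq> take (j - 1) xs @ fst (m' (xs ! (j - 1)) (xs ! j)) # drop (j + 1) xs"
      if j: "j \<in> {1..<length xs}" for j
    proof -
      have E: "xs ! (j - 1) \<in> E" "xs ! j \<in> E" using j xs by (auto simp: subset_iff)
      have "set (take (j - 1) xs @ fst (m' (xs ! (j - 1)) (xs ! j)) # drop (j + 1) xs) \<subseteq> E"
        using xs closed'[OF E] set_take_subset[of "j - 1" xs] set_drop_subset[of "j + 1" xs] by auto
      then show ?thesis using ys by blast
    qed
    have "(\<Sum>j\<in>{1..<length xs}.
           if ys = take (j - 1) xs @ fst (m' (xs ! (j - 1)) (xs ! j)) # drop (j + 1) xs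
           then (-1) ^ j * snd (m' (xs ! (j - 1)) (xs ! j)) else 0) = 0"
      by (intro sum.neutral ballI if_not_P inner)
    then show ?thesis
      unfolding bar_bd_def if_not_P[OF False] if_not_P[OF ends(1)] if_not_P[OF ends(2)] by simp
  qed (simp add: bar_bd_def)
  define pull where "pull j c xs = (if xs \<in> bar_cells E j then c (map f xs) else 0)"
    for j :: nat and c :: "'b list \<Rightarrow> 'r" and xs
  have pull_chain: "pull j c \<in> bar_chains E j" for j c
    by (simp add: pull_def bar_chains_def)
  \<comment> \<open>\<open>pull\<close> commutes with the boundary because a word meeting
    \<open>P\<close> has no word avoiding \<open>P\<close> in its boundary.\<close>
  have diff_pull: "bar_diff E m' eps' j (pull j c) ys = bar_diff D m eps j c (map f ys)"
    if ys: "set ys \<subseteq> E" for j c ys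
  proof -
    have "set (map f ys) \<subseteq> f ` E" using ys by (simp add: image_mono)
    then have ysP: "set (map f ys) \<inter> P = {}" unfolding image by auto
    have "bar_diff D m eps j c (map f ys) = (\<Sum>xs\<in>{xs \<in> bar_cells D j. set xs \<inter> P = {}}. c xs * bar_bd m eps xs (map f ys))"
      unfolding bar_diff_def
    proof (rule sum.mono_neutral_right[OF finite_bar_cells])
      show "\<forall>xs\<in>bar_cells D j - {xs \<in> bar_cells D j. set xs \<inter> P = {}}. c xs * bar_bd m eps xs (map f ys) = 0"
      proof
        fix xs assume "xs \<in> bar_cells D j - {xs \<in> bar_cells D j. set xs \<inter> P = {}}"
        then have "bar_bd m eps xs (map f ys) = 0"
          using bar_bd_nonzero(3)[of xs "map f ys"] ysP unfolding bar_cells_def by blast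
        then show "c xs * bar_bd m eps xs (map f ys) = 0" by simp
      qed
    qed auto
    also have "\<dots> = (\<Sum>xs\<in>bar_cells E j. c (map f xs) * bar_bd m eps (map f xs) (map f ys))"
      unfolding pure_cells
      by (subst sum.reindex) (auto simp: inj_on_def bar_cells_def map_inj)
    also have "\<dots> = bar_diff E m' eps' j (pull j c) ys"
      unfolding bar_diff_def using ys by (intro sum.cong) (auto simp: pull_def bar_bd_map bar_cells_def)
    finally show ?thesis by simp
  qed
  have diff_outside: "bar_diff E m' eps' j c ys = 0" if "\<not> set ys \<subseteq> E" for j c ys
    unfolding bar_diff_def using bar_bd_outside that by (intro sum.neutral) (auto simp: bar_cells_def)
  have push_map: "bar_push E f j c (map f xs) = c xs" if "c \<in> bar_chains E j" "set xs \<subseteq> E" for j xs and c :: "'c list \<Rightarrow> 'r"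
  proof -
    have "bar_push E f j c (map f xs) = (\<Sum>ys\<in>bar_cells E j. if ys = xs then c ys else 0)"
      unfolding bar_push_def using that map_inj by (intro sum.cong) (auto simp: bar_cells_def)
    also have "\<dots> = c xs"
      using finE that by (auto simp: bar_chains_def)
    finally show ?thesis .
  qed
  have push_outside: "bar_push E f j c ys = 0" if "ys \<notin> map f ` bar_cells E j" for j ys and c :: "'c list \<Rightarrow> 'r"
    unfolding bar_push_def using that by (intro sum.neutral) auto
  have pull_push: "pull j (bar_push E f j c) = c" if "c \<in> bar_chains E j" for j and c :: "'c list \<Rightarrow> 'r"
    using that push_map[OF that] by (auto simp: pull_def bar_chains_def bar_cells_def)
  show ?thesis
    unfolding induces_homology_iso_def
  proof (intro conjI ballI impI)
    fix z assume z: "z \<in> bar_cycles D m eps i"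
    define w where "w = pull i z"
    have "bar_diff E m' eps' i w = (\<lambda>_. 0)"
    proof
      fix ys show "bar_diff E m' eps' i w ys = 0"
        using z diff_pull[of ys i z] diff_outside[of ys i w]
        by (cases "set ys \<subseteq> E") (auto simp: w_def bar_cycles_def)
    qed
    then have w: "w \<in> bar_cycles E m' eps' i" using pull_chain by (simp add: bar_cycles_def w_def)
    then have w_chain: "w \<in> bar_chains E i" by (simp add: bar_cycles_def)
    let ?c = "\<lambda>ys. bar_push E f i w ys - z ys"
    have push_pure: "set xs \<subseteq> D" "set xs \<inter> P = {}" if "bar_push E f i w xs \<noteq> 0" for xs
      using push_outside[of xs i w] that pure_cells[of i] by (auto simp: bar_cells_def)
    have "bar_diff D m eps i (bar_push E f i w) ys = 0" for ys
    proof (cases "ys \<in> map f ` bar_cells E (length ys)")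
      case True
      then obtain us where us: "ys = map f us" "set us \<subseteq> E" by (auto simp: bar_cells_def)
      then have "bar_diff D m eps i (bar_push E f i w) ys = bar_diff E m' eps' i w us"
        using diff_pull[of us i "bar_push E f i w"] pull_push[OF w_chain] by simp
      then show ?thesis using w by (simp add: bar_cycles_def)
    next
      case False
      then have out: "\<not> (set ys \<subseteq> D \<and> set ys \<inter> P = {})"
        unfolding pure_cells[symmetric] by (auto simp: bar_cells_def)
      have "bar_push E f i w xs * bar_bd m eps xs ys = 0" for xs
      proof (rule ccontr)
        assume "\<not> ?thesis"
        then have "bar_push E f i w xs \<noteq> 0" "bar_bd m eps xs ys \<noteq> 0" by auto
        with push_pure[of xs] bar_bd_nonzero[of xs ys] out show False by blast
      qed
      then show ?thesis by (simp add: bar_diff_def)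
    qed
    moreover have "bar_diff D m eps i ?c ys = bar_diff D m eps i (bar_push E f i w) ys - bar_diff D m eps i z ys" for ys
      by (simp add: bar_diff_def left_diff_distrib sum_subtractf)
    ultimately have "bar_diff D m eps i ?c = (\<lambda>_. 0)"
      using z by (auto simp: bar_cycles_def)
    moreover have "?c \<in> bar_chains D i"
    proof -
      have "bar_push E f i w xs = 0" if "xs \<notin> bar_cells D i" for xs
        using push_outside[of xs i w] pure_cells[of i] that by blast
      then show ?thesis using z by (auto simp: bar_cycles_def bar_chains_def)
    qed
    moreover have "?c xs = 0" if xs: "set xs \<inter> P = {}" for xs
    proof (cases "xs \<in> map f ` bar_cells E i")
      case True
      then obtain us where us: "xs = map f us" "us \<in> bar_cells E i" by blast
      then have "bar_push E f i w xs = w us" using push_map[OF w_chain] by (auto simp: bar_cells_def)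
      then show ?thesis using us by (simp add: w_def pull_def)
    next
      case False
      then have "xs \<notin> bar_cells D i" using xs unfolding pure_cells[symmetric] by blast
      then have "z xs = 0" using z by (simp add: bar_cycles_def bar_chains_def)
      then show ?thesis using push_outside[OF False] by simp
    qed
    ultimately have "?c \<in> bar_boundaries D m eps i"
      by (intro bar_boundary_if_mixed acyclic) (auto simp: bar_cycles_def)
    then show "\<exists>w\<in>bar_cycles E m' eps' i. (\<lambda>ys. bar_push E f i w ys - z ys) \<in> bar_boundaries D m eps i"
      using w by blast
  next
    fix w assume w: "w \<in> bar_cycles E m' eps' i" and "bar_push E f i w \<in> bar_boundaries D m eps i"
    then obtain b where b: "bar_push E f i w = bar_diff D m eps (Suc i) b"
      by (auto simp: bar_boundaries_def)
    have w_chain: "w \<in> bar_chains E i" using w by (simp add: bar_cycles_def)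
    have "w = bar_diff E m' eps' (Suc i) (pull (Suc i) b)"
    proof
      fix ys show "w ys = bar_diff E m' eps' (Suc i) (pull (Suc i) b) ys"
      proof (cases "set ys \<subseteq> E")
        case True
        then show ?thesis using diff_pull[OF True, of "Suc i" b] push_map[OF w_chain True] b by simp
      next
        case False
        then have "w ys = 0" using w_chain by (auto simp: bar_chains_def bar_cells_def)
        then show ?thesis using diff_outside[OF False] by simp
      qed
    qed
    then show "w \<in> bar_boundaries E m' eps' i"
      using pull_chain by (auto simp: bar_boundaries_def)
  qed
qed

end


section \<open>Diagrams as relations between subsets\<close>

text \<open>A diagram acts on functions with values in the booleans that are constant on blocks, that is,
on unions of blocks. This is the partition algebra acting on tensor powers of a two-dimensional
space; it is faithful on diagrams, and it sees the number of loops as an exponent of 2.\<close>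

definition saturated :: "'a set set \<Rightarrow> 'a set \<Rightarrow> bool" where
  "saturated d U \<longleftrightarrow> (\<forall>B\<in>d. \<forall>x\<in>B. \<forall>y\<in>B. x \<in> U \<longrightarrow> y \<in> U)"

text \<open>Left nodes are named by their absolute values, so that the right set of one diagram can
  serve as the left set of the next.\<close>

definition diag_rel :: "nat \<Rightarrow> int set set \<Rightarrow> int set \<Rightarrow> int set \<Rightarrow> bool" where
  "diag_rel n d A C \<longleftrightarrow> A \<subseteq> {1..int n} \<and> C \<subseteq> {1..int n} \<and> saturated d (uminus ` A \<union> C)"

text \<open>Addition of F_2-valued functions. By \<open>diag_rel_symd\<close> the relation of a
  diagram is a subgroup, so its nonempty fibres are cosets of one subgroup.\<close>

definition symd :: "'a set \<Rightarrow> 'a set \<Rightarrow> 'a set" where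
  "symd A B = (A - B) \<union> (B - A)"

lemma symd_simps [simp]: "symd A A = {}" "symd (symd A B) B = A" "symd A {} = A"
  by (auto simp: symd_def)

lemma mem_uminus_image [simp]: "(x :: int) \<in> uminus ` A \<longleftrightarrow> - x \<in> A"
  by (metis image_iff minus_minus)

lemma diag_rel_subset: "diag_rel n d A C \<Longrightarrow> A \<subseteq> {1..int n} \<and> C \<subseteq> {1..int n}"
  by (simp add: diag_rel_def)

lemma diag_rel_empty: "diag_rel n d {} {}"
  by (simp add: diag_rel_def saturated_def)

lemma saturated_symd:
  assumes "saturated d U" "saturated d V" shows "saturated d (symd U V)"
proof -
  have "x \<in> U \<longleftrightarrow> y \<in> U" "x \<in> V \<longleftrightarrow> y \<in> V" if "B \<in> d" "x \<in> B" "y \<in> B" for B x y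
    using assms that unfolding saturated_def by blast+
  then show ?thesis unfolding saturated_def symd_def by blast
qed

lemma diag_rel_symd:
  assumes "diag_rel n d A C" "diag_rel n d A' C'"
  shows "diag_rel n d (symd A A') (symd C C')"
proof -
  have sub: "A \<subseteq> {1..int n}" "C \<subseteq> {1..int n}" "A' \<subseteq> {1..int n}" "C' \<subseteq> {1..int n}"
    using assms by (auto simp: diag_rel_def)
  have "x \<in> uminus ` symd A A' \<union> symd C C' \<longleftrightarrow> x \<in> symd (uminus ` A \<union> C) (uminus ` A' \<union> C')" for x
  proof (cases "x > 0")
    case True
    then have "- x \<notin> A" "- x \<notin> A'" using sub by auto
    then show ?thesis by (simp add: symd_def)
  next
    case False
    then have "x \<notin> C" "x \<notin> C'" using sub by auto
    then show ?thesis by (simp add: symd_def)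
  qed
  then have "uminus ` symd A A' \<union> symd C C' = symd (uminus ` A \<union> C) (uminus ` A' \<union> C')" by blast
  moreover have "symd A A' \<subseteq> {1..int n}" "symd C C' \<subseteq> {1..int n}"
    using sub by (auto simp: symd_def)
  ultimately show ?thesis using assms saturated_symd unfolding diag_rel_def by metis
qed

section \<open>Partitions and their saturated sets\<close>

lemma partition_on_same_block:
  assumes "partition_on S P" "K \<in> P" "K' \<in> P" "x \<in> K" "x \<in> K'" shows "K = K'"
  using partition_onD2[OF assms(1)] assms(2-) unfolding disjoint_def by blast

lemma saturated_block:
  assumes "partition_on S d" "B \<in> d" shows "saturated d B"
  unfolding saturated_def
proof (intro ballI impI)
  fix B' x y assume "B' \<in> d" "x \<in> B'" "y \<in> B'" "x \<in> B"
  then have "B' = B" using partition_on_same_block assms by metis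
  then show "y \<in> B" using \<open>y \<in> B'\<close> by simp
qed

lemma saturated_subset_block:
  assumes "saturated d U" "B \<in> d" "x \<in> B" "x \<in> U" shows "B \<subseteq> U"
  using assms by (auto simp: saturated_def)

text \<open>The blocks are the minimal nonempty saturated sets, so these sets determine the
  partition.\<close>

lemma partition_eqI:
  assumes d: "partition_on S d" and d': "partition_on S d'"
    and sat: "\<And>U. U \<subseteq> S \<Longrightarrow> saturated d U \<longleftrightarrow> saturated d' U"
  shows "d = d'"
proof -
  have *: "d \<subseteq> d'" if d: "partition_on S d" and d': "partition_on S d'"
    and sat: "\<And>U. U \<subseteq> S \<Longrightarrow> saturated d U \<longleftrightarrow> saturated d' U" for d d' :: "'a set set"
  proof
    fix B assume B: "B \<in> d"
    then have "B \<noteq> {}" "B \<subseteq> S" using partition_onD1[OF d] partition_onD3[OF d] by auto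
    then obtain x where x: "x \<in> B" "x \<in> S" by blast
    then obtain B' where B': "B' \<in> d'" "x \<in> B'" using partition_onD1[OF d'] by blast
    have "B' \<subseteq> S" using partition_onD1[OF d'] B' by blast
    have "saturated d' B" using saturated_block[OF d B] sat[OF \<open>B \<subseteq> S\<close>] by simp
    then have "B' \<subseteq> B" using saturated_subset_block B' x by metis
    moreover have "saturated d B'" using saturated_block[OF d' B'(1)] sat[OF \<open>B' \<subseteq> S\<close>] by simp
    then have "B \<subseteq> B'" using saturated_subset_block B B' x by metis
    ultimately show "B \<in> d'" using B' by simp
  qed
  show ?thesis using *[OF d d' sat] *[OF d' d] sat by auto
qed

text \<open>Faithfulness of the action on subsets: identities between diagrams reduce to identities
  between relations.\<close>

lemma diagram_eqI:
  assumes "d \<in> diagrams n" "d' \<in> diagrams n" "\<And>A C. diag_rel n d A C \<longleftrightarrow> diag_rel n d' A C"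
  shows "d = d'"
proof (rule partition_eqI[of "nodes n"])
  fix U assume U: "U \<subseteq> nodes n"
  let ?A = "{x \<in> {1..int n}. - x \<in> U}" and ?C = "U \<inter> {1..int n}"
  have "uminus ` ?A \<union> ?C = U"
    using U by (auto simp: nodes_def)
  then show "saturated d U \<longleftrightarrow> saturated d' U"
    using assms(3)[of ?A ?C] by (auto simp: diag_rel_def)
qed (use assms in \<open>auto simp: diagrams_def\<close>)

text \<open>Makes the number of unions of k blocks equal to 2^k, for the loop count.\<close>

lemma Union_blocks_inj: "partition_on S P \<Longrightarrow> inj_on Union (Pow P)"
proof (rule inj_onI)
  have *: "X \<subseteq> Y" if P: "partition_on S P" and XY: "X \<in> Pow P" "Y \<in> Pow P" "\<Union>X = \<Union>Y" for X Y
  proof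
    fix K assume K: "K \<in> X"
    then have "K \<in> P" "K \<noteq> {}" using XY partition_onD3[OF P] by auto
    then obtain x where "x \<in> K" by blast
    then obtain K' where "K' \<in> Y" "x \<in> K'" using XY K by blast
    then have "K' = K" using XY \<open>x \<in> K\<close> \<open>K \<in> P\<close> partition_on_same_block[OF P] by blast
    then show "K \<in> Y" using \<open>K' \<in> Y\<close> by simp
  qed
  fix X Y assume "partition_on S P" "X \<in> Pow P" "Y \<in> Pow P" "\<Union>X = \<Union>Y"
  then show "X = Y" using *[of X Y] *[of Y X] by auto
qed

lemma saturated_Union:
  assumes "partition_on S P" "X \<subseteq> P" shows "saturated P (\<Union>X)"
  unfolding saturated_def
proof (intro ballI impI)
  fix B x y assume B: "B \<in> P" "x \<in> B" "y \<in> B" "x \<in> \<Union>X"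
  then obtain K where "K \<in> X" "x \<in> K" by blast
  then have "K = B" using B assms(2) partition_on_same_block[OF assms(1)] by blast
  then show "y \<in> \<Union>X" using B \<open>K \<in> X\<close> by blast
qed

subsection \<open>Stacking diagrams\<close>

context
  fixes n :: nat and d1 d2 :: "int set set"
  assumes d1: "d1 \<in> diagrams n" and d2: "d2 \<in> diagrams n"
begin

abbreviation (input) "R \<equiv> stack_rel n d1 d2"
abbreviation (input) "comps \<equiv> stack_components n d1 d2"

lemma block_nodes: "B \<in> d1 \<Longrightarrow> x \<in> B \<Longrightarrow> x \<in> nodes n" "B \<in> d2 \<Longrightarrow> x \<in> B \<Longrightarrow> x \<in> nodes n"
  using d1 d2 by (auto simp: diagrams_def dest: partition_onD1)

lemma shift2_stack: "x \<in> nodes n \<Longrightarrow> shift2 n x \<in> stack_nodes n"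
  by (auto simp: nodes_def stack_nodes_def shift2_def)

lemma stack_rel_subset: "R \<subseteq> stack_nodes n \<times> stack_nodes n"
proof -
  have "nodes n \<subseteq> stack_nodes n" by (auto simp: nodes_def stack_nodes_def)
  then show ?thesis
    using block_nodes shift2_stack unfolding stack_rel_def by blast
qed

lemma partition_stack_components: "partition_on (stack_nodes n) comps"
proof -
  let ?S = "stack_nodes n"
  \<comment> \<open>\<open>R\<^sup>*\<close> is reflexive on all integers; it is cut down to an
    equivalence relation on the stack.\<close>
  let ?E = "Restr (R\<^sup>*) ?S"
  have "sym R" unfolding stack_rel_def sym_def by blast
  then have "sym (R\<^sup>*)" by (rule sym_rtrancl)
  then have "equiv ?S ?E"
    by (auto simp: equiv_def refl_on_def sym_def trans_def intro: rtrancl_trans)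
  then have "partition_on ?S (?S // ?E)" by (rule partition_on_quotient)
  moreover have "y \<in> ?S" if "(x, y) \<in> R\<^sup>*" "x \<in> ?S" for x y
    using that stack_rel_subset by (induction rule: rtrancl_induct) auto
  then have "?E `` {x} = R\<^sup>* `` {x}" if "x \<in> ?S" for x
    using that by blast
  then have "?S // ?E = comps"
    unfolding stack_components_def quotient_def by auto
  ultimately show ?thesis by simp
qed

lemma saturated_comps_iff: "saturated comps U \<longleftrightarrow> (\<forall>(x, y)\<in>R. x \<in> U \<longrightarrow> y \<in> U)"
proof
  assume sat: "saturated comps U"
  have "y \<in> U" if "(x, y) \<in> R" "x \<in> U" for x y
  proof -
    have "R\<^sup>* `` {x} \<in> comps"
      using that stack_rel_subset by (auto simp: stack_components_def quotient_def)
    then have "R\<^sup>* `` {x} \<subseteq> U"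
      using saturated_subset_block[OF sat, of "R\<^sup>* `` {x}" x] that by simp
    moreover have "y \<in> R\<^sup>* `` {x}" using that by auto
    ultimately show ?thesis by (rule subsetD)
  qed
  then show "\<forall>(x, y)\<in>R. x \<in> U \<longrightarrow> y \<in> U" by blast
next
  assume closed: "\<forall>(x, y)\<in>R. x \<in> U \<longrightarrow> y \<in> U"
  have "sym R" unfolding stack_rel_def sym_def by blast
  then have "sym (R\<^sup>*)" by (rule sym_rtrancl)
  have step: "y \<in> U" if "(x, y) \<in> R\<^sup>*" "x \<in> U" for x y
    using that closed by (induction rule: rtrancl_induct) auto
  show "saturated comps U"
    unfolding saturated_def
  proof (intro ballI impI)
    fix K x y assume "K \<in> comps" "x \<in> K" "y \<in> K" "x \<in> U"
    then obtain z where "(z, x) \<in> R\<^sup>*" "(z, y) \<in> R\<^sup>*"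
      by (auto simp: stack_components_def quotient_def)
    then have "(x, y) \<in> R\<^sup>*" using \<open>sym (R\<^sup>*)\<close> by (meson rtrancl_trans symE)
    with step \<open>x \<in> U\<close> show "y \<in> U" by blast
  qed
qed

text \<open>Each edge of the stack comes from one of the two diagrams, and \<open>d1\<close> sees
  only \<open>A\<close> and \<open>B\<close>, \<open>d2\<close> only \<open>B\<close> and
  \<open>C\<close>. So labellings constant on components are pairs of compatible labellings that
  share the middle set \<open>B\<close>.\<close>

lemma saturated_comps:
  assumes A: "A \<subseteq> {1..int n}" and B: "B \<subseteq> {1..int n}" and C: "C \<subseteq> {1..int n}"
  shows "saturated comps (uminus ` A \<union> B \<union> (\<lambda>x. x + int n) ` C) \<longleftrightarrow> diag_rel n d1 A B \<and> diag_rel n d2 B C"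
proof -
  let ?U = "uminus ` A \<union> B \<union> (\<lambda>x. x + int n) ` C"
  have 1: "x \<in> ?U \<longleftrightarrow> x \<in> uminus ` A \<union> B" if "x \<in> nodes n" for x
    using that C by (auto simp: nodes_def)
  have 2: "shift2 n x \<in> ?U \<longleftrightarrow> x \<in> uminus ` B \<union> C" if "x \<in> nodes n" for x
    using that A B C by (auto simp: nodes_def shift2_def subset_iff)
  have "(\<forall>(x, y)\<in>R. x \<in> V \<longrightarrow> y \<in> V) \<longleftrightarrow>
      (\<forall>b\<in>d1. \<forall>x\<in>b. \<forall>y\<in>b. x \<in> V \<longrightarrow> y \<in> V) \<and>
      (\<forall>b\<in>d2. \<forall>x\<in>b. \<forall>y\<in>b. shift2 n x \<in> V \<longrightarrow> shift2 n y \<in> V)" (is "?L \<longleftrightarrow> ?R") for V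
  proof
    assume ?L
    then have closed: "y \<in> V" if "(x, y) \<in> R" "x \<in> V" for x y using that by auto
    have 1: "(x, y) \<in> R" if "b \<in> d1" "x \<in> b" "y \<in> b" for b x y
      using that by (auto simp: stack_rel_def)
    have 2: "(shift2 n x, shift2 n y) \<in> R" if "b \<in> d2" "x \<in> b" "y \<in> b" for b x y
      using that by (auto simp: stack_rel_def)
    show ?R
      by (intro conjI ballI impI; (rule closed[OF 1], assumption+ | rule closed[OF 2], assumption+))
  next
    assume ?R
    then show ?L by (auto simp: stack_rel_def)
  qed
  then have "(\<forall>(x, y)\<in>R. x \<in> ?U \<longrightarrow> y \<in> ?U) \<longleftrightarrow>
      (\<forall>b\<in>d1. \<forall>x\<in>b. \<forall>y\<in>b. x \<in> ?U \<longrightarrow> y \<in> ?U) \<and>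
      (\<forall>b\<in>d2. \<forall>x\<in>b. \<forall>y\<in>b. shift2 n x \<in> ?U \<longrightarrow> shift2 n y \<in> ?U)" .
  also have "\<dots> \<longleftrightarrow> saturated d1 (uminus ` A \<union> B) \<and> saturated d2 (uminus ` B \<union> C)"
    unfolding saturated_def
    by (intro arg_cong2[where f = "(\<and>)"] ball_cong refl arg_cong2[where f = "(\<longrightarrow>)"] 1 2 block_nodes)
  finally show ?thesis
    using assms by (simp add: saturated_comps_iff diag_rel_def)
qed

lemma unshift_outer:
  "A \<subseteq> {1..int n} \<Longrightarrow> C \<subseteq> {1..int n} \<Longrightarrow> x \<in> outer_nodes n \<Longrightarrow>
    unshift n x \<in> uminus ` A \<union> C \<longleftrightarrow> x \<in> uminus ` A \<union> (\<lambda>x. x + int n) ` C"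
  by (auto simp: outer_nodes_def unshift_def subset_iff image_iff) force+

text \<open>Product of diagrams becomes composition of relations. A labelling of the stack restricts
  to the outer nodes; conversely, an outer labelling spreads along the components it meets, which
  determines a middle set.\<close>

lemma diag_rel_comp:
  "diag_rel n (diag_comp n d1 d2) A C \<longleftrightarrow> (\<exists>B. diag_rel n d1 A B \<and> diag_rel n d2 B C)"
proof
  assume "\<exists>B. diag_rel n d1 A B \<and> diag_rel n d2 B C"
  then obtain B where B: "diag_rel n d1 A B" "diag_rel n d2 B C" by blast
  then have sub: "A \<subseteq> {1..int n}" "B \<subseteq> {1..int n}" "C \<subseteq> {1..int n}"
    by (auto simp: diag_rel_def)
  let ?U = "uminus ` A \<union> B \<union> (\<lambda>x. x + int n) ` C"
  have sat: "saturated comps ?U" using saturated_comps[OF sub] B by simp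
  have iff: "unshift n x \<in> uminus ` A \<union> C \<longleftrightarrow> x \<in> ?U" if "x \<in> outer_nodes n" for x
    using unshift_outer[OF sub(1,3) that] that sub(2) by (auto simp: outer_nodes_def)
  have "saturated (diag_comp n d1 d2) (uminus ` A \<union> C)"
    unfolding saturated_def
  proof (intro ballI impI)
    fix b x y assume "b \<in> diag_comp n d1 d2" "x \<in> b" "y \<in> b" and x: "x \<in> uminus ` A \<union> C"
    then obtain K x' y' where K: "K \<in> comps" "x' \<in> K" "y' \<in> K" "x' \<in> outer_nodes n" "y' \<in> outer_nodes n"
      and eq: "x = unshift n x'" "y = unshift n y'"
      by (auto simp: diag_comp_def)
    have "x' \<in> ?U" using x iff[OF K(4)] eq by simp
    then have "y' \<in> ?U" using saturated_subset_block[OF sat K(1,2)] K(3) by blast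
    then show "y \<in> uminus ` A \<union> C" using iff[OF K(5)] eq by simp
  qed
  then show "diag_rel n (diag_comp n d1 d2) A C" using sub by (simp add: diag_rel_def)
next
  assume "diag_rel n (diag_comp n d1 d2) A C"
  then have sub: "A \<subseteq> {1..int n}" "C \<subseteq> {1..int n}" and sat: "saturated (diag_comp n d1 d2) (uminus ` A \<union> C)"
    by (auto simp: diag_rel_def)
  let ?V = "uminus ` A \<union> (\<lambda>x. x + int n) ` C"
  have V: "?V \<subseteq> outer_nodes n" using sub by (auto simp: outer_nodes_def subset_iff)
  have outer: "y \<in> ?V" if "K \<in> comps" "x \<in> K" "x \<in> ?V" "y \<in> K" "y \<in> outer_nodes n" for K x y
  proof -
    have x: "x \<in> outer_nodes n" using that(3) V by (rule subsetD[rotated])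
    let ?b = "unshift n ` (K \<inter> outer_nodes n)"
    have "?b \<in> diag_comp n d1 d2"
      using that(1,2) x by (auto simp: diag_comp_def)
    moreover have "unshift n x \<in> ?b" "unshift n y \<in> ?b" using that x by auto
    moreover have "unshift n x \<in> uminus ` A \<union> C" using unshift_outer[OF sub x] that(3) by simp
    ultimately have "unshift n y \<in> uminus ` A \<union> C"
      using saturated_subset_block[OF sat] by blast
    then show ?thesis using unshift_outer[OF sub that(5)] by simp
  qed
  \<comment> \<open>The smallest saturated set containing \<open>?V\<close>. It meets no outer node
    outside \<open>?V\<close>, since the outer labelling is already constant on blocks of the
    product.\<close>
  define U where "U = \<Union>{K \<in> comps. K \<inter> ?V \<noteq> {}}"
  define B where "B = U \<inter> {1..int n}"
  have S: "stack_nodes n = \<Union>comps" using partition_stack_components by (rule partition_onD1)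
  have split: "stack_nodes n = outer_nodes n \<union> {1..int n}" by (auto simp: stack_nodes_def outer_nodes_def)
  have VU: "?V \<subseteq> U"
  proof
    fix x assume x: "x \<in> ?V"
    then have "x \<in> outer_nodes n" using V by (rule subsetD[rotated])
    then obtain K where "K \<in> comps" "x \<in> K" using S split by blast
    moreover from this have "K \<inter> ?V \<noteq> {}" using x by (intro notI) blast
    ultimately show "x \<in> U" unfolding U_def by (intro UnionI) simp_all
  qed
  have UV: "U \<subseteq> ?V \<union> {1..int n}"
  proof
    fix y assume "y \<in> U"
    then obtain K where "K \<in> comps" "y \<in> K" "K \<inter> ?V \<noteq> {}" unfolding U_def by (auto simp only: Union_iff mem_Collect_eq)
    moreover from \<open>K \<inter> ?V \<noteq> {}\<close> obtain x where "x \<in> K" "x \<in> ?V" by (auto simp only: ex_in_conv[symmetric] Int_iff)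
    moreover have "y \<in> outer_nodes n \<or> y \<in> {1..int n}" using \<open>K \<in> comps\<close> \<open>y \<in> K\<close> S split by blast
    ultimately show "y \<in> ?V \<union> {1..int n}" using outer[of K x y] by (simp only: Un_iff) iprover
  qed
  have cut: "U' = V' \<union> U' \<inter> I" if "V' \<subseteq> U'" "U' \<subseteq> V' \<union> I" for U' V' I :: "int set"
    using that by blast
  have "U = ?V \<union> B" unfolding B_def by (rule cut[OF VU UV])
  also have "\<dots> = uminus ` A \<union> B \<union> (\<lambda>x. x + int n) ` C" by (simp only: Un_ac)
  finally have "U = uminus ` A \<union> B \<union> (\<lambda>x. x + int n) ` C" .
  moreover have "saturated comps U"
    unfolding U_def by (rule saturated_Union[OF partition_stack_components]) blast
  moreover have "B \<subseteq> {1..int n}" by (simp add: B_def)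
  ultimately show "\<exists>B. diag_rel n d1 A B \<and> diag_rel n d2 B C"
    using saturated_comps[OF sub(1) _ sub(2), of B] by auto
qed

lemma diag_comp_in_diagrams: "diag_comp n d1 d2 \<in> diagrams n"
proof -
  have "partition_on (outer_nodes n \<inter> stack_nodes n) ((\<inter>) (outer_nodes n) ` comps - {{}})"
    by (rule partition_on_restrict[OF partition_stack_components])
  moreover have "outer_nodes n \<inter> stack_nodes n = outer_nodes n"
    by (auto simp: outer_nodes_def stack_nodes_def)
  moreover have "inj_on (unshift n) (outer_nodes n)"
    by (auto simp: inj_on_def unshift_def outer_nodes_def)
  ultimately have "partition_on (unshift n ` outer_nodes n) ((`) (unshift n) ` ((\<inter>) (outer_nodes n) ` comps - {{}}) - {{}})"
    using partition_on_inj_image by fastforce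
  moreover have "unshift n ` outer_nodes n = nodes n"
  proof
    show "nodes n \<subseteq> unshift n ` outer_nodes n"
    proof
      fix x assume "x \<in> nodes n"
      then show "x \<in> unshift n ` outer_nodes n"
        by (intro image_eqI[of _ _ "if x < 0 then x else x + int n"])
          (auto simp: nodes_def unshift_def outer_nodes_def)
    qed
  qed (auto simp: nodes_def unshift_def outer_nodes_def)
  moreover have "(`) (unshift n) ` ((\<inter>) (outer_nodes n) ` comps - {{}}) - {{}} = diag_comp n d1 d2"
    unfolding diag_comp_def by (auto simp: Int_commute)
  ultimately show ?thesis by (simp add: diagrams_def)
qed

text \<open>With nothing marked on the outside, the admissible middle sets are the unions of
  components consisting of middle nodes only.\<close>

lemma card_middle_empty: "card {B. diag_rel n d1 {} B \<and> diag_rel n d2 B {}} = 2 ^ diag_loops n d1 d2"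
proof -
  let ?inner = "{K \<in> comps. K \<inter> outer_nodes n = {}}"
  have P: "partition_on (stack_nodes n) comps" by (rule partition_stack_components)
  have fin: "finite ?inner"
    using finite_elements[OF _ P] by (simp add: stack_nodes_def)
  have sat: "saturated comps B \<longleftrightarrow> diag_rel n d1 {} B \<and> diag_rel n d2 B {}" if "B \<subseteq> {1..int n}" for B
    using saturated_comps[of "{}" B "{}"] that by simp
  have split: "stack_nodes n = outer_nodes n \<union> {1..int n}" "outer_nodes n \<inter> {1..int n} = {}"
    by (auto simp: stack_nodes_def outer_nodes_def)
  have "Union ` Pow ?inner = {B. diag_rel n d1 {} B \<and> diag_rel n d2 B {}}"
  proof (intro set_eqI iffI)
    fix B assume "B \<in> Union ` Pow ?inner"
    then obtain X where X: "X \<subseteq> ?inner" "B = \<Union>X" by blast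
    then have "B \<subseteq> {1..int n}" using partition_onD1[OF P] split by blast
    moreover have "saturated comps B" unfolding X(2) by (rule saturated_Union[OF P]) (use X in blast)
    ultimately show "B \<in> {B. diag_rel n d1 {} B \<and> diag_rel n d2 B {}}" using sat by simp
  next
    fix B assume B: "B \<in> {B. diag_rel n d1 {} B \<and> diag_rel n d2 B {}}"
    then have sub: "B \<subseteq> {1..int n}" by (auto simp: diag_rel_def)
    then have satB: "saturated comps B" using sat B by simp
    let ?X = "{K \<in> comps. K \<inter> B \<noteq> {}}"
    have "K \<subseteq> B" if "K \<in> ?X" for K using that saturated_subset_block[OF satB] by blast
    then have "?X \<subseteq> ?inner" "\<Union>?X \<subseteq> B" using sub split by blast+
    moreover have "B \<subseteq> \<Union>?X"
    proof
      fix x assume x: "x \<in> B"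
      then have "x \<in> \<Union>comps" using sub split(1) partition_onD1[OF P] by blast
      then obtain K where "K \<in> comps" "x \<in> K" by blast
      with x show "x \<in> \<Union>?X" by (intro UnionI[of K]) auto
    qed
    ultimately show "B \<in> Union ` Pow ?inner"
      by (intro image_eqI[of _ _ ?X] equalityI) simp_all
  qed
  moreover have "inj_on Union (Pow ?inner)"
    by (rule inj_on_subset[OF Union_blocks_inj[OF P]]) blast
  then have "card (Union ` Pow ?inner) = card (Pow ?inner)" by (rule card_image)
  ultimately have "card {B. diag_rel n d1 {} B \<and> diag_rel n d2 B {}} = card (Pow ?inner)"
    by (simp only:)
  then show ?thesis using fin by (simp add: card_Pow diag_loops_def)
qed

text \<open>A solution \<open>B0\<close> translates the admissible middle sets to those for empty
  outer sets, so their number does not depend on \<open>A\<close> and \<open>C\<close>.\<close>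

lemma card_middle:
  assumes "diag_rel n (diag_comp n d1 d2) A C"
  shows "card {B. diag_rel n d1 A B \<and> diag_rel n d2 B C} = 2 ^ diag_loops n d1 d2"
proof -
  obtain B0 where B0: "diag_rel n d1 A B0" "diag_rel n d2 B0 C"
    using assms diag_rel_comp by blast
  have "bij_betw (\<lambda>B. symd B B0) {B. diag_rel n d1 A B \<and> diag_rel n d2 B C}
      {B. diag_rel n d1 {} B \<and> diag_rel n d2 B {}}"
  proof (rule bij_betw_byWitness[where f' = "\<lambda>B. symd B B0"])
    show "(\<lambda>B. symd B B0) ` {B. diag_rel n d1 A B \<and> diag_rel n d2 B C}
        \<subseteq> {B. diag_rel n d1 {} B \<and> diag_rel n d2 B {}}"
      using diag_rel_symd[OF _ B0(1)] diag_rel_symd[OF _ B0(2)] by fastforce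
    have "symd {} A = A" "symd {} C = C" by (auto simp: symd_def)
    then show "(\<lambda>B. symd B B0) ` {B. diag_rel n d1 {} B \<and> diag_rel n d2 B {}}
        \<subseteq> {B. diag_rel n d1 A B \<and> diag_rel n d2 B C}"
      using diag_rel_symd[OF _ B0(1), of "{}"] diag_rel_symd[OF _ B0(2), of _ "{}"] by fastforce
  qed auto
  then show ?thesis using card_middle_empty bij_betw_same_card by metis
qed

lemma diag_loops_eq_0:
  assumes "\<And>B. diag_rel n d1 {} B \<Longrightarrow> diag_rel n d2 B {} \<Longrightarrow> B = {}"
  shows "diag_loops n d1 d2 = 0"
proof -
  have "{B. diag_rel n d1 {} B \<and> diag_rel n d2 B {}} = {{}}"
    using assms diag_rel_empty by blast
  then have "(2::nat) ^ diag_loops n d1 d2 = 2 ^ 0" using card_middle_empty by simp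
  then show ?thesis by (subst (asm) power_inject_exp) simp_all
qed

end

section \<open>Associativity of diagrams and of loop numbers\<close>

lemma diag_comp_assoc:
  assumes "d1 \<in> diagrams n" "d2 \<in> diagrams n" "d3 \<in> diagrams n"
  shows "diag_comp n (diag_comp n d1 d2) d3 = diag_comp n d1 (diag_comp n d2 d3)"
  using assms by (intro diagram_eqI[of _ n]) (auto simp: diag_comp_in_diagrams diag_rel_comp)

text \<open>Double counting of the labellings of the two middle layers in a stack of three diagrams
  with empty outer sets: summing over either layer last gives 2 to one of the two sides.\<close>

lemma diag_loops_assoc:
  assumes d: "d1 \<in> diagrams n" "d2 \<in> diagrams n" "d3 \<in> diagrams n"
  shows "diag_loops n d1 d2 + diag_loops n (diag_comp n d1 d2) d3
       = diag_loops n d2 d3 + diag_loops n d1 (diag_comp n d2 d3)"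
proof -
  let ?T = "{(B, C). diag_rel n d1 {} B \<and> diag_rel n d2 B C \<and> diag_rel n d3 C {}}"
  have fin: "finite {B. diag_rel n e A B \<and> Q B}" for e A Q
    by (rule finite_subset[of _ "Pow {1..int n}"]) (auto simp: diag_rel_def)
  have comp: "diag_comp n d1 d2 \<in> diagrams n" "diag_comp n d2 d3 \<in> diagrams n"
    using d by (auto intro: diag_comp_in_diagrams)
  let ?X = "{C. diag_rel n (diag_comp n d1 d2) {} C \<and> diag_rel n d3 C {}}"
  let ?Y = "{B. diag_rel n d1 {} B \<and> diag_rel n (diag_comp n d2 d3) B {}}"
  have "bij_betw prod.swap ?T (SIGMA C:?X. {B. diag_rel n d1 {} B \<and> diag_rel n d2 B C})"
    by (rule bij_betw_byWitness[where f' = prod.swap]) (auto simp: diag_rel_comp[OF d(1,2)])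
  then have "card ?T = card (SIGMA C:?X. {B. diag_rel n d1 {} B \<and> diag_rel n d2 B C})"
    by (rule bij_betw_same_card)
  also have "\<dots> = (\<Sum>C\<in>?X. card {B. diag_rel n d1 {} B \<and> diag_rel n d2 B C})"
    using fin by (intro card_SigmaI) auto
  also have "\<dots> = (\<Sum>C\<in>?X. 2 ^ diag_loops n d1 d2)"
    using card_middle[OF d(1,2)] by (intro sum.cong) auto
  also have "\<dots> = 2 ^ (diag_loops n d1 d2 + diag_loops n (diag_comp n d1 d2) d3)"
    by (simp add: card_middle_empty[OF comp(1) d(3)] power_add)
  finally have 1: "card ?T = 2 ^ (diag_loops n d1 d2 + diag_loops n (diag_comp n d1 d2) d3)" .
  have "?T = (SIGMA B:?Y. {C. diag_rel n d2 B C \<and> diag_rel n d3 C {}})"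
    by (auto simp: diag_rel_comp[OF d(2,3)])
  then have "card ?T = (\<Sum>B\<in>?Y. card {C. diag_rel n d2 B C \<and> diag_rel n d3 C {}})"
    using fin by (simp add: card_SigmaI)
  also have "\<dots> = (\<Sum>B\<in>?Y. 2 ^ diag_loops n d2 d3)"
    using card_middle[OF d(2,3)] by (intro sum.cong) auto
  also have "\<dots> = 2 ^ (diag_loops n d2 d3 + diag_loops n d1 (diag_comp n d2 d3))"
    by (simp add: card_middle_empty[OF d(1) comp(2)] power_add)
  finally have "(2::nat) ^ (diag_loops n d1 d2 + diag_loops n (diag_comp n d1 d2) d3)
      = 2 ^ (diag_loops n d2 d3 + diag_loops n d1 (diag_comp n d2 d3))"
    using 1 by simp
  then show ?thesis by simp
qed


subsection \<open>Permutation diagrams\<close>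

lemma perms_mem: "p \<in> perms n \<Longrightarrow> j \<in> {1..n} \<Longrightarrow> p j \<in> {1..n}"
  unfolding perms_def by (metis mem_Collect_eq permutes_in_image)

lemma perm_diagram_in_diagrams:
  assumes p: "p \<in> perms n"
  shows "perm_diagram n p \<in> diagrams n"
proof -
  have perm: "p permutes {1..n}" using p by (simp add: perms_def)
  have inj: "p i = p j \<longleftrightarrow> i = j" for i j
    using permutes_inj[OF perm] by (auto simp: inj_def)
  have "partition_on (nodes n) (perm_diagram n p)"
  proof (rule partition_onI)
    show "\<Union>(perm_diagram n p) = nodes n"
    proof (intro set_eqI iffI)
      fix x assume "x \<in> nodes n"
      show "x \<in> \<Union>(perm_diagram n p)"
      proof (cases "x > 0")
        case True
        then have "x \<in> {- int (p (nat x)), int (nat x)}" "nat x \<in> {1..n}"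
          using \<open>x \<in> nodes n\<close> by (auto simp: nodes_def)
        then show ?thesis unfolding perm_diagram_def by blast
      next
        case False
        then have "nat (- x) \<in> {1..n}" using \<open>x \<in> nodes n\<close> by (auto simp: nodes_def)
        then obtain j where "j \<in> {1..n}" "p j = nat (- x)"
          using permutes_image[OF perm] by (metis imageE)
        then have "x \<in> {- int (p j), int j}" "j \<in> {1..n}"
          using False by auto
        then show ?thesis unfolding perm_diagram_def by blast
      qed
    next
      fix x assume "x \<in> \<Union>(perm_diagram n p)"
      then obtain j where "j \<in> {1..n}" "x = - int (p j) \<or> x = int j" by (auto simp: perm_diagram_def)
      then show "x \<in> nodes n" using perms_mem[OF p, of j] by (auto simp: nodes_def)
    qed
    fix K K' assume "K \<in> perm_diagram n p" "K' \<in> perm_diagram n p" "K \<noteq> K'"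
    then obtain i j where "K = {- int (p i), int i}" "K' = {- int (p j), int j}" "i \<in> {1..n}" "j \<in> {1..n}" "i \<noteq> j"
      by (auto simp: perm_diagram_def)
    then show "disjnt K K'" using perms_mem[OF p, of i] perms_mem[OF p, of j] inj[of i j]
      by (auto simp: disjnt_def)
  qed (auto simp: perm_diagram_def)
  then show ?thesis by (simp add: diagrams_def)
qed

lemma diag_rel_perm_diagram:
  assumes p: "p \<in> perms n"
  shows "diag_rel n (perm_diagram n p) A C \<longleftrightarrow>
    A \<subseteq> {1..int n} \<and> C \<subseteq> {1..int n} \<and> (\<forall>j\<in>{1..n}. int (p j) \<in> A \<longleftrightarrow> int j \<in> C)"
proof (cases "A \<subseteq> {1..int n} \<and> C \<subseteq> {1..int n}")
  case True
  have "- int (p j) \<in> uminus ` A \<union> C \<longleftrightarrow> int (p j) \<in> A" "int j \<in> uminus ` A \<union> C \<longleftrightarrow> int j \<in> C" if "j \<in> {1..n}" for j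
    using True by (auto simp: subset_iff)
  moreover have "saturated (perm_diagram n p) U \<longleftrightarrow> (\<forall>j\<in>{1..n}. - int (p j) \<in> U \<longleftrightarrow> int j \<in> U)" for U
  proof
    assume sat: "saturated (perm_diagram n p) U"
    show "\<forall>j\<in>{1..n}. - int (p j) \<in> U \<longleftrightarrow> int j \<in> U"
    proof
      fix j assume "j \<in> {1..n}"
      then have "{- int (p j), int j} \<in> perm_diagram n p" by (auto simp: perm_diagram_def)
      from saturated_subset_block[OF sat this] show "- int (p j) \<in> U \<longleftrightarrow> int j \<in> U" by auto
    qed
  next
    assume "\<forall>j\<in>{1..n}. - int (p j) \<in> U \<longleftrightarrow> int j \<in> U"
    then show "saturated (perm_diagram n p) U"
      by (auto simp: saturated_def perm_diagram_def)
  qed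
  ultimately have "saturated (perm_diagram n p) (uminus ` A \<union> C) \<longleftrightarrow> (\<forall>j\<in>{1..n}. int (p j) \<in> A \<longleftrightarrow> int j \<in> C)"
    by simp
  then show ?thesis using True by (simp add: diag_rel_def)
qed (auto simp: diag_rel_def)

lemma perms_comp: "p \<in> perms n \<Longrightarrow> q \<in> perms n \<Longrightarrow> p \<circ> q \<in> perms n"
  by (simp add: perms_def permutes_compose)

lemma perm_preimage:
  assumes "p \<in> perms n" "A \<subseteq> {1..int n}"
  obtains B where "diag_rel n (perm_diagram n p) A B"
  by (rule that[of "{x \<in> {1..int n}. int (p (nat x)) \<in> A}"])
    (use assms in \<open>auto simp: diag_rel_perm_diagram\<close>)

lemma diag_rel_perm_unique:
  assumes p: "p \<in> perms n" and A: "diag_rel n (perm_diagram n p) A C" "diag_rel n (perm_diagram n p) A' C"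
  shows "A = A'"
proof (rule set_eqI)
  have perm: "p permutes {1..n}" using p by (simp add: perms_def)
  fix x
  show "x \<in> A \<longleftrightarrow> x \<in> A'"
  proof (cases "x \<in> {1..int n}")
    case True
    then have "nat x \<in> {1..n}" by auto
    then obtain j where "j \<in> {1..n}" "p j = nat x" using permutes_image[OF perm] by (metis imageE)
    moreover have "int (nat x) = x" using True by simp
    moreover have "int (p j) \<in> A \<longleftrightarrow> int j \<in> C" "int (p j) \<in> A' \<longleftrightarrow> int j \<in> C"
      using A \<open>j \<in> {1..n}\<close> unfolding diag_rel_perm_diagram[OF p] by blast+
    ultimately show ?thesis by simp
  next
    case False
    then show ?thesis using A by (auto simp: diag_rel_perm_diagram[OF p])
  qed
qed

lemma diag_rel_perm_unique_right:
  assumes p: "p \<in> perms n" and "diag_rel n (perm_diagram n p) A C" "diag_rel n (perm_diagram n p) A C'"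
  shows "C = C'"
proof -
  have "C = {x \<in> {1..int n}. int (p (nat x)) \<in> A}" if "diag_rel n (perm_diagram n p) A C" for C
  proof (rule set_eqI)
    fix x show "x \<in> C \<longleftrightarrow> x \<in> {x \<in> {1..int n}. int (p (nat x)) \<in> A}"
    proof (cases "x \<in> {1..int n}")
      case True
      then have "nat x \<in> {1..n}" by auto
      then have "int (p (nat x)) \<in> A \<longleftrightarrow> int (nat x) \<in> C"
        using that unfolding diag_rel_perm_diagram[OF p] by blast
      then show ?thesis using True by simp
    next
      case False
      then show ?thesis using that by (auto simp: diag_rel_perm_diagram[OF p])
    qed
  qed
  then show ?thesis using assms by metis
qed

lemma diag_comp_perm:
  assumes p: "p \<in> perms n" and q: "q \<in> perms n"
  shows "diag_comp n (perm_diagram n p) (perm_diagram n q) = perm_diagram n (p \<circ> q)"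
    and "diag_loops n (perm_diagram n p) (perm_diagram n q) = 0"
proof -
  note pd = perm_diagram_in_diagrams[OF p] and qd = perm_diagram_in_diagrams[OF q]
    and pqd = perm_diagram_in_diagrams[OF perms_comp[OF p q]]
  show "diag_comp n (perm_diagram n p) (perm_diagram n q) = perm_diagram n (p \<circ> q)"
  proof (rule diagram_eqI[OF diag_comp_in_diagrams[OF pd qd] pqd])
    fix A C
    show "diag_rel n (diag_comp n (perm_diagram n p) (perm_diagram n q)) A C
        \<longleftrightarrow> diag_rel n (perm_diagram n (p \<circ> q)) A C"
    proof
      assume "diag_rel n (diag_comp n (perm_diagram n p) (perm_diagram n q)) A C"
      then show "diag_rel n (perm_diagram n (p \<circ> q)) A C"
        using perms_mem[OF q] by (auto simp: diag_rel_comp[OF pd qd] diag_rel_perm_diagram p q perms_comp)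
    next
      assume AC: "diag_rel n (perm_diagram n (p \<circ> q)) A C"
      then have "A \<subseteq> {1..int n}" by (simp add: diag_rel_def)
      then obtain B where B: "diag_rel n (perm_diagram n p) A B" by (rule perm_preimage[OF p])
      have "diag_rel n (perm_diagram n q) B C"
        using AC B perms_mem[OF q] by (auto simp: diag_rel_perm_diagram p q perms_comp)
      with B show "diag_rel n (diag_comp n (perm_diagram n p) (perm_diagram n q)) A C"
        by (auto simp: diag_rel_comp[OF pd qd])
    qed
  qed
  show "diag_loops n (perm_diagram n p) (perm_diagram n q) = 0"
    using diag_rel_perm_unique_right[OF p] diag_rel_empty by (intro diag_loops_eq_0[OF pd qd]) blast
qed

lemma inj_on_perm_diagram: "inj_on (perm_diagram n) (perms n)"
proof (rule inj_onI)
  fix p q assume pq: "p \<in> perms n" "q \<in> perms n" "perm_diagram n p = perm_diagram n q"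
  show "p = q"
  proof
    fix j show "p j = q j"
    proof (cases "j \<in> {1..n}")
      case True
      then have "{- int (p j), int j} \<in> perm_diagram n p"
        unfolding perm_diagram_def by blast
      then have "{- int (p j), int j} \<in> perm_diagram n q" by (simp only: pq(3))
      then obtain i where "{- int (p j), int j} = {- int (q i), int i}" by (auto simp: perm_diagram_def)
      then show ?thesis using True by (auto simp: doubleton_eq_iff)
    next
      case False
      then show ?thesis using pq by (simp add: perms_def permutes_not_in)
    qed
  qed
qed

lemma is_perm_diagram_iff: "is_perm_diagram n d \<longleftrightarrow> d \<in> perm_diagram n ` perms n"
proof
  assume "d \<in> perm_diagram n ` perms n"
  then obtain p where p: "p \<in> perms n" "d = perm_diagram n p" by blast
  have "\<exists>i j. B = {- i, j} \<and> 1 \<le> i \<and> 1 \<le> j" if B: "B \<in> d" for B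
  proof -
    obtain j where "B = {- int (p j), int j}" "j \<in> {1..n}"
      using B p by (auto simp: perm_diagram_def)
    then show ?thesis using perms_mem[OF p(1), of j] by (intro exI[of _ "int (p j)"] exI[of _ "int j"]) auto
  qed
  then show "is_perm_diagram n d"
    using perm_diagram_in_diagrams p by (simp add: is_perm_diagram_def)
next
  assume d: "is_perm_diagram n d"
  then have part: "partition_on (nodes n) d" by (simp add: is_perm_diagram_def diagrams_def)
  have nodes: "x \<in> nodes n" if "B \<in> d" "x \<in> B" for B x
    using partition_onD1[OF part] that by blast
  have ex: "\<exists>i\<in>{1..n}. {- int i, int j} \<in> d" if j: "j \<in> {1..n}" for j
  proof -
    have "int j \<in> nodes n" using j by (auto simp: nodes_def)
    then obtain B where B: "B \<in> d" "int j \<in> B" using partition_onD1[OF part] by blast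
    then obtain i j' where ij: "B = {- i, j'}" "1 \<le> i" "1 \<le> j'" using d by (auto simp: is_perm_diagram_def)
    then have "B = {- int (nat i), int j}" using B j by auto
    moreover have "- i \<in> nodes n" using nodes[OF B(1)] ij by auto
    then have "nat i \<in> {1..n}" using ij by (auto simp: nodes_def)
    ultimately show ?thesis using B by blast
  qed
  then obtain f where f: "\<And>j. j \<in> {1..n} \<Longrightarrow> f j \<in> {1..n} \<and> {- int (f j), int j} \<in> d" by metis
  define p where "p j = (if j \<in> {1..n} then f j else j)" for j
  have p_mem: "p j \<in> {1..n}" "{- int (p j), int j} \<in> d" if "j \<in> {1..n}" for j
    using f[OF that] that by (auto simp: p_def)
  have "inj_on p {1..n}"
  proof (rule inj_onI)
    fix j j' assume j: "j \<in> {1..n}" "j' \<in> {1..n}" "p j = p j'"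
    then have "{- int (p j), int j} = {- int (p j'), int j'}"
      using partition_on_same_block[OF part p_mem(2) p_mem(2), of j j' "- int (p j)"] by auto
    then show "j = j'" using j by (auto simp: doubleton_eq_iff)
  qed
  moreover have "p ` {1..n} \<subseteq> {1..n}" using p_mem by blast
  ultimately have "bij_betw p {1..n} {1..n}"
    by (simp add: bij_betw_def endo_inj_surj)
  then have p: "p \<in> perms n"
    unfolding perms_def by (auto intro!: bij_imp_permutes simp: p_def)
  have sub: "perm_diagram n p \<subseteq> d" using p_mem by (auto simp: perm_diagram_def)
  have part': "partition_on (nodes n) (perm_diagram n p)"
    using perm_diagram_in_diagrams[OF p] by (simp add: diagrams_def)
  \<comment> \<open>The blocks of \<open>perm_diagram n p\<close> already cover all nodes, which
    leaves no room for another block of \<open>d\<close>.\<close>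
  have "d \<subseteq> perm_diagram n p"
  proof
    fix B assume B: "B \<in> d"
    then obtain x where x: "x \<in> B" using partition_onD3[OF part] by (metis ex_in_conv)
    then obtain B' where B': "B' \<in> perm_diagram n p" "x \<in> B'"
      using nodes[OF B] partition_onD1[OF part'] by blast
    then have "B = B'" using partition_on_same_block[OF part B _ x B'(2)] sub by blast
    then show "B \<in> perm_diagram n p" using B' by simp
  qed
  with sub p show "d \<in> perm_diagram n ` perms n" by blast
qed

subsection \<open>Defects on the right\<close>

text \<open>Isolated nodes are put on the diagonal so that both kinds of defect share one index set
  of pairs.\<close>

definition right_defect :: "nat \<Rightarrow> int \<times> int \<Rightarrow> int set set set" where
  "right_defect n a = {d \<in> diagrams n. if fst a = snd a then {fst a} \<in> d
     else (\<exists>B\<in>d. fst a \<in> B \<and> snd a \<in> B)}"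

lemma right_defect_single_iff:
  assumes d: "d \<in> diagrams n" and j: "j \<in> {1..int n}"
  shows "d \<in> right_defect n (j, j) \<longleftrightarrow> diag_rel n d {} {j}"
proof
  have part: "partition_on (nodes n) d" using d by (simp add: diagrams_def)
  assume "d \<in> right_defect n (j, j)"
  then show "diag_rel n d {} {j}"
    using saturated_block[OF part, of "{j}"] j by (simp add: right_defect_def diag_rel_def)
next
  have part: "partition_on (nodes n) d" using d by (simp add: diagrams_def)
  assume "diag_rel n d {} {j}"
  then have sat: "saturated d {j}" by (simp add: diag_rel_def)
  have "j \<in> nodes n" using j by (simp add: nodes_def)
  then obtain B where B: "B \<in> d" "j \<in> B" using partition_onD1[OF part] by blast
  then have "B = {j}" using saturated_subset_block[OF sat B] by auto
  then show "d \<in> right_defect n (j, j)" using B d by (simp add: right_defect_def)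
qed

text \<open>For the converse it is enough to test the pair of sets cut out by the block of
  \<open>i\<close>.\<close>

lemma right_defect_pair_iff:
  assumes d: "d \<in> diagrams n" and ij: "i \<in> {1..int n}" "j \<in> {1..int n}" "i \<noteq> j"
  shows "d \<in> right_defect n (i, j) \<longleftrightarrow> (\<forall>A C. diag_rel n d A C \<longrightarrow> (i \<in> C \<longleftrightarrow> j \<in> C))"
proof
  assume "d \<in> right_defect n (i, j)"
  then obtain B where B: "B \<in> d" "i \<in> B" "j \<in> B" using ij by (auto simp: right_defect_def)
  show "\<forall>A C. diag_rel n d A C \<longrightarrow> (i \<in> C \<longleftrightarrow> j \<in> C)"
  proof (intro allI impI)
    fix A C assume AC: "diag_rel n d A C"
    then have "i \<in> uminus ` A \<union> C \<longleftrightarrow> j \<in> uminus ` A \<union> C"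
      using B unfolding diag_rel_def saturated_def by blast
    moreover have "- i \<notin> A" "- j \<notin> A" using AC ij by (auto simp: diag_rel_def subset_iff)
    ultimately show "i \<in> C \<longleftrightarrow> j \<in> C" by simp
  qed
next
  assume rel: "\<forall>A C. diag_rel n d A C \<longrightarrow> (i \<in> C \<longleftrightarrow> j \<in> C)"
  have part: "partition_on (nodes n) d" using d by (simp add: diagrams_def)
  have "i \<in> nodes n" using ij by (simp add: nodes_def)
  then obtain B where B: "B \<in> d" "i \<in> B" using partition_onD1[OF part] by blast
  let ?A = "{x \<in> {1..int n}. - x \<in> B}" and ?C = "B \<inter> {1..int n}"
  have "B \<subseteq> nodes n" using B partition_onD1[OF part] by blast
  then have "uminus ` ?A \<union> ?C = B" by (auto simp: nodes_def)
  then have "diag_rel n d ?A ?C" using saturated_block[OF part B(1)] by (auto simp: diag_rel_def)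
  then have "i \<in> ?C \<longleftrightarrow> j \<in> ?C" using rel by blast
  then have "j \<in> B" using B(2) ij by auto
  with B ij d show "d \<in> right_defect n (i, j)" by (auto simp: right_defect_def)
qed

text \<open>Both kinds of defect restrict or provide right sets of the relation of \<open>y\<close>,
  and composing with \<open>x\<close> on the left keeps such conditions because \<open>{}\<close> is
  related to \<open>{}\<close>.\<close>

lemma right_defect_comp:
  assumes x: "x \<in> diagrams n" and y: "y \<in> right_defect n (i, j)" and ij: "i \<in> {1..int n}" "j \<in> {1..int n}"
  shows "diag_comp n x y \<in> right_defect n (i, j)"
proof -
  have yd: "y \<in> diagrams n" using y by (simp add: right_defect_def)
  note xy = diag_comp_in_diagrams[OF x yd]
  show ?thesis
  proof (cases "i = j")
    case True
    then have "diag_rel n y {} {j}" using y right_defect_single_iff[OF yd ij(2)] by simp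
    then have "diag_rel n (diag_comp n x y) {} {j}"
      using diag_rel_comp[OF x yd] diag_rel_empty by blast
    then show ?thesis using True right_defect_single_iff[OF xy ij(2)] by simp
  next
    case False
    then have "\<forall>A C. diag_rel n y A C \<longrightarrow> (i \<in> C \<longleftrightarrow> j \<in> C)"
      using y right_defect_pair_iff[OF yd ij] by blast
    then have "\<forall>A C. diag_rel n (diag_comp n x y) A C \<longrightarrow> (i \<in> C \<longleftrightarrow> j \<in> C)"
      using diag_rel_comp[OF x yd] by blast
    then show ?thesis using right_defect_pair_iff[OF xy ij False] by blast
  qed
qed

lemma perm_no_right_defect:
  assumes "is_perm_diagram n d" "i \<in> {1..int n}" "j \<in> {1..int n}"
  shows "d \<notin> right_defect n (i, j)"
proof
  assume defect: "d \<in> right_defect n (i, j)"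
  have block: "\<exists>a b. B = {- a, b} \<and> 1 \<le> a \<and> 1 \<le> b" if "B \<in> d" for B
    using assms(1) that by (simp add: is_perm_diagram_def)
  show False
  proof (cases "i = j")
    case True
    then have "{i} \<in> d" using defect by (simp add: right_defect_def)
    then obtain a b where "{i} = {- a, b}" "1 \<le> a" "1 \<le> b" using block by blast
    then show False by (auto simp: singleton_insert_inj_eq)
  next
    case False
    then obtain B where B: "B \<in> d" "i \<in> B" "j \<in> B" using defect by (auto simp: right_defect_def)
    then obtain a b where "B = {- a, b}" "1 \<le> a" "1 \<le> b" using block by blast
    then show False using B False assms(2,3) by auto
  qed
qed

text \<open>Without a defect, every right node shares its block with a left node and with no other
  right node. Distinct right nodes then use distinct left nodes, by counting all of them, so the
  blocks are exactly such pairs.\<close>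

lemma nonperm_right_defect:
  assumes d: "d \<in> diagrams n" and nonperm: "\<not> is_perm_diagram n d"
  shows "\<exists>i\<in>{1..int n}. \<exists>j\<in>{1..int n}. d \<in> right_defect n (i, j)"
proof (rule ccontr)
  assume no: "\<not> ?thesis"
  let ?I = "{1..int n}"
  have part: "partition_on (nodes n) d" using d by (simp add: diagrams_def)
  have nodes: "x \<in> nodes n" if "B \<in> d" "x \<in> B" for B x
    using partition_onD1[OF part] that by blast
  have no': "d \<notin> right_defect n (i, j)" if "i \<in> ?I" "j \<in> ?I" for i j
    using no that by blast
  have pair: "i = j" if "B \<in> d" "i \<in> B" "j \<in> B" "i \<in> ?I" "j \<in> ?I" for B i j
    using no'[OF that(4,5)] that(1-3) d by (auto simp: right_defect_def split: if_splits)
  have single: "{j} \<notin> d" if "j \<in> ?I" for j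
    using no'[OF that that] d by (simp add: right_defect_def)
  have "\<exists>B i. B \<in> d \<and> j \<in> B \<and> - i \<in> B \<and> i \<in> ?I" if j: "j \<in> ?I" for j
  proof -
    have "j \<in> nodes n" using j by (simp add: nodes_def)
    then obtain B where B: "B \<in> d" "j \<in> B" using partition_onD1[OF part] by blast
    have "B \<noteq> {j}" using B(1) single[OF j] by auto
    then obtain x where x: "x \<in> B" "x \<noteq> j" using B(2) by blast
    then have "x \<notin> ?I" using pair[OF B(1) x(1) B(2)] j by blast
    then have "- x \<in> ?I" using nodes[OF B(1) x(1)] by (auto simp: nodes_def)
    then show ?thesis using B x by (intro exI[of _ B] exI[of _ "- x"]) simp
  qed
  then obtain blk g where bg: "\<And>j. j \<in> ?I \<Longrightarrow> blk j \<in> d \<and> j \<in> blk j \<and> - g j \<in> blk j \<and> g j \<in> ?I" by metis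
  have inj: "inj_on g ?I"
  proof (rule inj_onI)
    fix j j' assume j: "j \<in> ?I" "j' \<in> ?I" "g j = g j'"
    then have "blk j = blk j'" using partition_on_same_block[OF part, of "blk j" "blk j'" "- g j"] bg by metis
    then show "j = j'" using pair[of "blk j" j j'] bg j by metis
  qed
  then have surj: "g ` ?I = ?I" using bg by (intro endo_inj_surj) auto
  have neg: "\<exists>j\<in>?I. B = blk j \<and> x = - g j" if B: "B \<in> d" "x \<in> B" "x \<notin> ?I" for B x
  proof -
    have "- x \<in> g ` ?I" using nodes[OF B(1,2)] B(3) surj by (auto simp: nodes_def)
    then obtain j where j: "j \<in> ?I" "- x = g j" by blast
    then have "x = - g j" by simp
    then show ?thesis using j bg partition_on_same_block[OF part B(1) _ B(2), of "blk j"] by metis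
  qed
  have "\<exists>i j. B = {- i, j} \<and> 1 \<le> i \<and> 1 \<le> j" if B: "B \<in> d" for B
  proof -
    obtain x where x: "x \<in> B" using B partition_onD3[OF part] by (metis ex_in_conv)
    have "\<exists>j\<in>?I. B = blk j"
    proof (cases "x \<in> ?I")
      case True
      then show ?thesis using bg[of x] partition_on_same_block[OF part B _ x] by blast
    next
      case False
      then show ?thesis using neg[OF B x] by blast
    qed
    then obtain j where j: "j \<in> ?I" "B = blk j" by blast
    have "y = j \<or> y = - g j" if y: "y \<in> B" for y
    proof (cases "y \<in> ?I")
      case True
      then show ?thesis using pair[OF B y, of j] bg[OF j(1)] j by blast
    next
      case False
      then obtain j' where j': "j' \<in> ?I" "B = blk j'" "y = - g j'" using neg[OF B y] by blast
      then have "j = j'" using pair[OF B, of j j'] bg[OF j(1)] bg[OF j'(1)] j by simp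
      then show ?thesis using j' by simp
    qed
    then have "B = {- g j, j}" using bg[OF j(1)] j by blast
    then show ?thesis using bg[OF j(1)] j(1) by (intro exI[of _ "g j"] exI[of _ j]) auto
  qed
  then show False using nonperm d by (simp add: is_perm_diagram_def)
qed

text \<open>If x y is a permutation, then the relation of x, like that of x y, is onto and separates
points, which excludes every right defect of x.\<close>

lemma perm_comp_left_perm:
  assumes x: "x \<in> diagrams n" and y: "y \<in> diagrams n" and perm: "is_perm_diagram n (diag_comp n x y)"
  shows "is_perm_diagram n x"
proof (rule ccontr)
  assume "\<not> ?thesis"
  then obtain i j where ij: "i \<in> {1..int n}" "j \<in> {1..int n}" and defect: "x \<in> right_defect n (i, j)"
    using nonperm_right_defect[OF x] by blast
  obtain p where p: "p \<in> perms n" and xy: "diag_comp n x y = perm_diagram n p"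
    using perm is_perm_diagram_iff by auto
  note comp = diag_rel_comp[OF x y, unfolded xy]
  let ?S = "Pow {1..int n}"
  have "\<exists>B C. diag_rel n x A B \<and> diag_rel n y B C" if A: "A \<in> ?S" for A
  proof -
    obtain C where "diag_rel n (perm_diagram n p) A C" using perm_preimage[OF p] A by blast
    then show ?thesis using comp by blast
  qed
  then obtain f g where fg: "\<And>A. A \<in> ?S \<Longrightarrow> diag_rel n x A (f A) \<and> diag_rel n y (f A) (g A)" by metis
  have through: "A = A'" if "A' \<in> ?S" "diag_rel n x A (f A')" for A A'
    using diag_rel_perm_unique[OF p, of A "g A'" A'] comp fg[OF that(1)] that(2) by blast
  \<comment> \<open>Sets with the same value under \<open>f\<close> reach the same set under the
    product, whose relation separates points. Finiteness then makes every subset a value of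
    \<open>f\<close>, in particular \<open>{j}\<close> and \<open>{}\<close>.\<close>
  have "inj_on f ?S"
    by (rule inj_onI) (metis fg through)
  moreover have "f ` ?S \<subseteq> ?S" using fg by (auto simp: diag_rel_def)
  ultimately have surj: "f ` ?S = ?S" by (simp add: endo_inj_surj)
  have "{j} \<in> f ` ?S" "{} \<in> f ` ?S" unfolding surj using ij by simp_all
  then obtain A1 A0 where A: "A1 \<in> ?S" "f A1 = {j}" "A0 \<in> ?S" "f A0 = {}" by blast
  show False
  proof (cases "i = j")
    case True
    then have j1: "diag_rel n x {} {j}" using defect right_defect_single_iff[OF x ij(2)] by simp
    \<comment> \<open>If \<open>j\<close> is isolated, the values \<open>{j}\<close> and
      \<open>{}\<close> of \<open>f\<close> both have to come from the empty set.\<close>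
    then have "A1 = {}" using through[OF A(1), of "{}"] A(2) by simp
    moreover have "A0 = {}" using through[OF A(3), of "{}"] A(4) diag_rel_empty by simp
    ultimately show False using A by simp
  next
    case False
    then have "i \<in> {j} \<longleftrightarrow> j \<in> {j}"
      using right_defect_pair_iff[OF x ij False] defect fg[OF A(1)] A(2) by metis
    then show False using False by simp
  qed
qed

subsection \<open>Right units\<close>

lemma fiber_diagram:
  fixes g :: "int \<Rightarrow> 'b"
  obtains d where "d \<in> diagrams n"
    "\<And>A C. diag_rel n d A C \<longleftrightarrow> A \<subseteq> {1..int n} \<and> C \<subseteq> {1..int n} \<and>
      (\<forall>x\<in>nodes n. \<forall>y\<in>nodes n. g x = g y \<longrightarrow> x \<in> uminus ` A \<union> C \<longrightarrow> y \<in> uminus ` A \<union> C)"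
proof
  let ?d = "(\<lambda>x. {y \<in> nodes n. g y = g x}) ` nodes n"
  have "partition_on (nodes n) ?d"
    by (rule partition_onI) (auto simp: disjnt_def)
  then show "?d \<in> diagrams n" by (simp add: diagrams_def)
  fix A C
  have "saturated ?d U \<longleftrightarrow> (\<forall>x\<in>nodes n. \<forall>y\<in>nodes n. g x = g y \<longrightarrow> x \<in> U \<longrightarrow> y \<in> U)" for U
    unfolding saturated_def by auto
  then show "diag_rel n ?d A C \<longleftrightarrow> A \<subseteq> {1..int n} \<and> C \<subseteq> {1..int n} \<and>
      (\<forall>x\<in>nodes n. \<forall>y\<in>nodes n. g x = g y \<longrightarrow> x \<in> uminus ` A \<union> C \<longrightarrow> y \<in> uminus ` A \<union> C)"
    by (simp only: diag_rel_def)
qed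

text \<open>The identity diagram with the strands \<open>i\<close> and \<open>j\<close> joined; as a
  relation it is the identity on sets that do not separate \<open>i\<close> and
  \<open>j\<close>.\<close>

lemma merge_diagram:
  assumes ij: "i \<in> {1..int n}" "j \<in> {1..int n}"
  obtains e where "e \<in> diagrams n"
    "\<And>A C. diag_rel n e A C \<longleftrightarrow> C \<subseteq> {1..int n} \<and> A = C \<and> (i \<in> C \<longleftrightarrow> j \<in> C)"
proof -
  let ?g = "\<lambda>x. if \<bar>x\<bar> = j then i else \<bar>x\<bar>"
  obtain e where e: "e \<in> diagrams n" and rel: "\<And>A C. diag_rel n e A C \<longleftrightarrow> A \<subseteq> {1..int n} \<and> C \<subseteq> {1..int n} \<and>
      (\<forall>x\<in>nodes n. \<forall>y\<in>nodes n. ?g x = ?g y \<longrightarrow> x \<in> uminus ` A \<union> C \<longrightarrow> y \<in> uminus ` A \<union> C)"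
    by (rule fiber_diagram[of n ?g]) blast
  have "diag_rel n e A C \<longleftrightarrow> C \<subseteq> {1..int n} \<and> A = C \<and> (i \<in> C \<longleftrightarrow> j \<in> C)" for A C
  proof
    assume "diag_rel n e A C"
    then have sub: "A \<subseteq> {1..int n}" "C \<subseteq> {1..int n}"
      and closed: "\<And>x y. x \<in> nodes n \<Longrightarrow> y \<in> nodes n \<Longrightarrow> ?g x = ?g y \<Longrightarrow> x \<in> uminus ` A \<union> C \<Longrightarrow> y \<in> uminus ` A \<union> C"
      unfolding rel by blast+
    have pos: "x \<in> uminus ` A \<union> C \<longleftrightarrow> x \<in> C" "- x \<in> uminus ` A \<union> C \<longleftrightarrow> x \<in> A" if "x \<in> {1..int n}" for x
      using sub that by (auto simp: subset_iff)
    have nodes: "x \<in> nodes n" "- x \<in> nodes n" if "x \<in> {1..int n}" for x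
      using that by (auto simp: nodes_def)
    have iff: "x \<in> uminus ` A \<union> C \<longleftrightarrow> y \<in> uminus ` A \<union> C" if "x \<in> nodes n" "y \<in> nodes n" "?g x = ?g y" for x y
      using closed[OF that] closed[OF that(2,1) that(3)[symmetric]] by (rule iffI)
    have "x \<in> A \<longleftrightarrow> x \<in> C" if "x \<in> {1..int n}" for x
    proof -
      have "?g (- x) = ?g x" by (simp cong: if_cong)
      from iff[OF nodes(2,1) this] show ?thesis unfolding pos[OF that] using that by blast
    qed
    then have "A = C" using sub by blast
    moreover have "i \<in> C \<longleftrightarrow> j \<in> C"
    proof -
      have "?g i = ?g j" using ij by simp
      from iff[OF nodes(1) nodes(1) this] show ?thesis using ij pos(1)[OF ij(1)] pos(1)[OF ij(2)] by blast
    qed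
    ultimately show "C \<subseteq> {1..int n} \<and> A = C \<and> (i \<in> C \<longleftrightarrow> j \<in> C)" using sub by blast
  next
    assume C: "C \<subseteq> {1..int n} \<and> A = C \<and> (i \<in> C \<longleftrightarrow> j \<in> C)"
    have "x \<in> uminus ` C \<union> C \<longleftrightarrow> ?g x \<in> C" if "x \<in> nodes n" for x
    proof -
      have "x \<in> uminus ` C \<union> C \<longleftrightarrow> \<bar>x\<bar> \<in> C" using C that by (auto simp: nodes_def abs_if subset_iff)
      then show ?thesis using C by auto
    qed
    then show "diag_rel n e A C" using C unfolding rel by metis
  qed
  with e show thesis by (rule that)
qed

text \<open>The strand \<open>j\<close> is cut, and its left end is tied to the strand
  \<open>k\<close> instead of being left alone, which avoids loops in products. In
  \<open>?g\<close>, the value 0 is taken by no other node, so the right node \<open>j\<close> is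
  isolated.\<close>

lemma cut_diagram:
  assumes jk: "j \<in> {1..int n}" "k \<in> {1..int n}" "j \<noteq> k"
  obtains e where "e \<in> diagrams n"
    "\<And>A C. diag_rel n e A C \<longleftrightarrow> A \<subseteq> {1..int n} \<and> C \<subseteq> {1..int n} \<and> A - {j} = C - {j} \<and> (j \<in> A \<longleftrightarrow> k \<in> A)"
proof -
  let ?g = "\<lambda>x. if x = - j then k else if x = j then 0 else \<bar>x\<bar>"
  obtain e where e: "e \<in> diagrams n" and rel: "\<And>A C. diag_rel n e A C \<longleftrightarrow> A \<subseteq> {1..int n} \<and> C \<subseteq> {1..int n} \<and>
      (\<forall>x\<in>nodes n. \<forall>y\<in>nodes n. ?g x = ?g y \<longrightarrow> x \<in> uminus ` A \<union> C \<longrightarrow> y \<in> uminus ` A \<union> C)"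
    by (rule fiber_diagram[of n ?g]) blast
  have "diag_rel n e A C \<longleftrightarrow> A \<subseteq> {1..int n} \<and> C \<subseteq> {1..int n} \<and> A - {j} = C - {j} \<and> (j \<in> A \<longleftrightarrow> k \<in> A)" for A C
  proof (cases "A \<subseteq> {1..int n} \<and> C \<subseteq> {1..int n}")
    case True
    have pos: "x \<in> uminus ` A \<union> C \<longleftrightarrow> x \<in> C" "- x \<in> uminus ` A \<union> C \<longleftrightarrow> x \<in> A" if "x \<in> {1..int n}" for x
      using True that by (auto simp: subset_iff)
    have nodes: "x \<in> nodes n" "- x \<in> nodes n" if "x \<in> {1..int n}" for x
      using that by (auto simp: nodes_def)
    show ?thesis
    proof
      assume "diag_rel n e A C"
      then have closed: "\<And>x y. x \<in> nodes n \<Longrightarrow> y \<in> nodes n \<Longrightarrow> ?g x = ?g y \<Longrightarrow> x \<in> uminus ` A \<union> C \<Longrightarrow> y \<in> uminus ` A \<union> C"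
        unfolding rel by blast
      have iff: "x \<in> uminus ` A \<union> C \<longleftrightarrow> y \<in> uminus ` A \<union> C" if "x \<in> nodes n" "y \<in> nodes n" "?g x = ?g y" for x y
        using closed[OF that] closed[OF that(2,1) that(3)[symmetric]] by (rule iffI)
      have "x \<in> A \<longleftrightarrow> x \<in> C" if "x \<in> {1..int n}" "x \<noteq> j" for x
      proof -
        have "?g (- x) = ?g x" using that jk by simp
        from iff[OF nodes(2,1) this] show ?thesis unfolding pos[OF that(1)] using that by blast
      qed
      then have "A - {j} = C - {j}" using True by blast
      moreover have "j \<in> A \<longleftrightarrow> k \<in> A"
      proof -
        have "?g (- j) = ?g (- k)" using jk by simp
        from iff[OF nodes(2) nodes(2) this] show ?thesis using jk pos(2)[OF jk(1)] pos(2)[OF jk(2)] by blast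
      qed
      ultimately show "A \<subseteq> {1..int n} \<and> C \<subseteq> {1..int n} \<and> A - {j} = C - {j} \<and> (j \<in> A \<longleftrightarrow> k \<in> A)"
        using True by blast
    next
      assume AC: "A \<subseteq> {1..int n} \<and> C \<subseteq> {1..int n} \<and> A - {j} = C - {j} \<and> (j \<in> A \<longleftrightarrow> k \<in> A)"
      have mem: "x \<in> uminus ` A \<union> C \<longleftrightarrow> ?g x \<in> A" if x: "x \<in> nodes n" "x \<noteq> j" for x
      proof (cases "x > 0")
        case True
        then have "x \<in> {1..int n}" using x by (auto simp: nodes_def)
        then show ?thesis using pos(1) AC x True jk by auto
      next
        case False
        then have "- x \<in> {1..int n}" using x by (auto simp: nodes_def)
        then show ?thesis using pos(2)[of "- x"] AC x False jk by auto
      qed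
      have "y \<in> uminus ` A \<union> C" if "x \<in> nodes n" "y \<in> nodes n" "?g x = ?g y" "x \<in> uminus ` A \<union> C" for x y
      proof -
        have "?g z = 0 \<longleftrightarrow> z = j" if "z \<in> nodes n" for z
          using jk that by (auto simp: nodes_def)
        then have "x = j \<longleftrightarrow> y = j" using that by metis
        then show ?thesis using mem that by metis
      qed
      then show "diag_rel n e A C" using True unfolding rel by blast
    qed
  qed (auto simp: rel)
  with e show thesis by (rule that)
qed

text \<open>The unit grows by one elementary idempotent \<open>f\<close> per defect. Right
  multiplication by \<open>f\<close> could destroy earlier defects; \<open>compat\<close> and
  \<open>(k, k) \<notin> S\<close> prevent this by keeping isolated nodes apart from joined nodes
  and from \<open>k\<close>.\<close>

lemma right_unit_exists:
  assumes "finite S" "S \<subseteq> {1..int n} \<times> {1..int n}" and k: "k \<in> {1..int n}" "(k, k) \<notin> S"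
    and compat: "\<And>i j. (i, j) \<in> S \<Longrightarrow> i \<noteq> j \<Longrightarrow> (i, i) \<notin> S \<and> (j, j) \<notin> S"
  shows "\<exists>e\<in>diagrams n. (\<forall>a\<in>S. e \<in> right_defect n a) \<and>
    (\<forall>x\<in>diagrams n. (\<forall>a\<in>S. x \<in> right_defect n a) \<longrightarrow> diag_comp n x e = x \<and> diag_loops n x e = 0)"
  using assms
proof (induction S rule: finite_induct)
  case empty
  have id: "id \<in> perms n" by (simp add: perms_def permutes_id)
  let ?e = "perm_diagram n id"
  note e = perm_diagram_in_diagrams[OF id]
  have rel: "diag_rel n ?e A C \<longleftrightarrow> C \<subseteq> {1..int n} \<and> A = C" for A C
  proof -
    have "(\<forall>j\<in>{1..n}. int j \<in> A \<longleftrightarrow> int j \<in> C) \<longleftrightarrow> A = C" if "A \<subseteq> {1..int n}" "C \<subseteq> {1..int n}"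
    proof
      assume h: "\<forall>j\<in>{1..n}. int j \<in> A \<longleftrightarrow> int j \<in> C"
      have "x \<in> A \<longleftrightarrow> x \<in> C" if "x \<in> {1..int n}" for x
      proof -
        have "nat x \<in> {1..n}" "int (nat x) = x" using that by auto
        with h show ?thesis by metis
      qed
      then show "A = C" using that by blast
    qed simp
    then show ?thesis by (auto simp: diag_rel_perm_diagram[OF id])
  qed
  have "diag_comp n x ?e = x \<and> diag_loops n x ?e = 0" if x: "x \<in> diagrams n" for x
  proof
    show "diag_comp n x ?e = x"
      by (rule diagram_eqI[OF diag_comp_in_diagrams[OF x e] x])
        (auto simp: diag_rel_comp[OF x e] rel dest: diag_rel_subset)
    show "diag_loops n x ?e = 0"
      by (rule diag_loops_eq_0[OF x e]) (simp add: rel)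
  qed
  with e show ?case by blast
next
  case (insert a S)
  obtain i j where a: "a = (i, j)" by (cases a)
  have ij: "i \<in> {1..int n}" "j \<in> {1..int n}" using insert.prems(1) a by auto
  have "\<exists>e\<in>diagrams n. (\<forall>a\<in>S. e \<in> right_defect n a) \<and>
    (\<forall>x\<in>diagrams n. (\<forall>a\<in>S. x \<in> right_defect n a) \<longrightarrow> diag_comp n x e = x \<and> diag_loops n x e = 0)"
  proof (rule insert.IH)
    show "(u, u) \<notin> S \<and> (v, v) \<notin> S" if "(u, v) \<in> S" "u \<noteq> v" for u v
      using insert.prems(4)[of u v] that by simp
  qed (use insert.prems in simp_all)
  then obtain e where e: "e \<in> diagrams n" and e_S: "\<forall>b\<in>S. e \<in> right_defect n b"
    and unit: "\<forall>x\<in>diagrams n. (\<forall>b\<in>S. x \<in> right_defect n b) \<longrightarrow>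
      diag_comp n x e = x \<and> diag_loops n x e = 0" by (elim bexE conjE)
  have "\<exists>f\<in>diagrams n. diag_comp n e f \<in> right_defect n a \<and> (\<forall>b\<in>S. diag_comp n e f \<in> right_defect n b) \<and>
      (\<forall>x\<in>right_defect n a. diag_comp n x f = x \<and> diag_loops n x f = 0)"
  proof (cases "i = j")
    case False
    obtain f where f: "f \<in> diagrams n"
      and rel: "\<And>A C. diag_rel n f A C \<longleftrightarrow> C \<subseteq> {1..int n} \<and> A = C \<and> (i \<in> C \<longleftrightarrow> j \<in> C)"
      using merge_diagram[OF ij] by blast
    note ef = diag_comp_in_diagrams[OF e f] and ef_rel = diag_rel_comp[OF e f]
    have "diag_comp n e f \<in> right_defect n a"
      unfolding a right_defect_pair_iff[OF ef ij False] by (simp add: ef_rel rel)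
    moreover have "diag_comp n e f \<in> right_defect n b" if b: "b \<in> S" for b
    proof -
      obtain u v where uv: "b = (u, v)" by (cases b)
      have uv_mem: "u \<in> {1..int n}" "v \<in> {1..int n}" using insert.prems(1) b uv by auto
      show ?thesis
      proof (cases "u = v")
        case True
        have "u \<noteq> i" "u \<noteq> j" using insert.prems(4)[of i j] a b uv True False by auto
        then have "diag_rel n f {u} {u}" using uv_mem by (simp add: rel)
        moreover have "diag_rel n e {} {u}"
          using bspec[OF e_S b] right_defect_single_iff[OF e uv_mem(1)] uv True by simp
        ultimately show ?thesis
          using right_defect_single_iff[OF ef uv_mem(1)] uv True ef_rel by blast
      next
        case uv_ne: False
        then have "\<forall>A C. diag_rel n e A C \<longrightarrow> (u \<in> C \<longleftrightarrow> v \<in> C)"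
          using bspec[OF e_S b] right_defect_pair_iff[OF e uv_mem uv_ne] uv by simp
        then show ?thesis
          unfolding uv right_defect_pair_iff[OF ef uv_mem uv_ne] by (auto simp: ef_rel rel)
      qed
    qed
    moreover have "diag_comp n x f = x \<and> diag_loops n x f = 0" if x: "x \<in> right_defect n a" for x
    proof
      have xd: "x \<in> diagrams n" using x by (simp add: right_defect_def)
      have pair: "\<forall>A C. diag_rel n x A C \<longrightarrow> (i \<in> C \<longleftrightarrow> j \<in> C)"
        using x right_defect_pair_iff[OF xd ij False] a by simp
      show "diag_comp n x f = x"
        by (rule diagram_eqI[OF diag_comp_in_diagrams[OF xd f] xd])
          (use pair in \<open>auto simp: diag_rel_comp[OF xd f] rel dest: diag_rel_subset\<close>)
      show "diag_loops n x f = 0"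
        by (rule diag_loops_eq_0[OF xd f]) (simp add: rel)
    qed
    ultimately show ?thesis using f by blast
  next
    case True
    have jk: "j \<noteq> k" using insert.prems(3) a True by auto
    obtain f where f: "f \<in> diagrams n" and rel: "\<And>A C. diag_rel n f A C \<longleftrightarrow>
        A \<subseteq> {1..int n} \<and> C \<subseteq> {1..int n} \<and> A - {j} = C - {j} \<and> (j \<in> A \<longleftrightarrow> k \<in> A)"
      using cut_diagram[OF ij(2) insert.prems(2) jk] by blast
    note ef = diag_comp_in_diagrams[OF e f] and ef_rel = diag_rel_comp[OF e f]
    have "diag_rel n f {} {j}" using ij by (simp add: rel)
    then have "diag_comp n e f \<in> right_defect n a"
      using right_defect_single_iff[OF ef ij(2)] a True ef_rel diag_rel_empty by blast
    moreover have "diag_comp n e f \<in> right_defect n b" if b: "b \<in> S" for b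
    proof -
      obtain u v where uv: "b = (u, v)" by (cases b)
      have uv_mem: "u \<in> {1..int n}" "v \<in> {1..int n}" using insert.prems(1) b uv by auto
      show ?thesis
      proof (cases "u = v")
        case uv_eq: True
        have "u \<noteq> j" using insert.hyps(2) a b uv uv_eq True by auto
        moreover have "u \<noteq> k" using insert.prems(3) b uv uv_eq by auto
        ultimately have "diag_rel n f {u} {u}" using uv_mem by (simp add: rel)
        moreover have "diag_rel n e {} {u}"
          using bspec[OF e_S b] right_defect_single_iff[OF e uv_mem(1)] uv uv_eq by simp
        ultimately show ?thesis
          using right_defect_single_iff[OF ef uv_mem(1)] uv uv_eq ef_rel by blast
      next
        case uv_ne: False
        then have "u \<noteq> j" "v \<noteq> j" using insert.prems(4)[of u v] a b uv True by auto
        then have "u \<in> A \<longleftrightarrow> u \<in> C" "v \<in> A \<longleftrightarrow> v \<in> C" if "diag_rel n f A C" for A C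
          using that unfolding rel by blast+
        moreover have "\<forall>A C. diag_rel n e A C \<longrightarrow> (u \<in> C \<longleftrightarrow> v \<in> C)"
          using bspec[OF e_S b] right_defect_pair_iff[OF e uv_mem uv_ne] uv by simp
        ultimately show ?thesis
          unfolding uv right_defect_pair_iff[OF ef uv_mem uv_ne] ef_rel by metis
      qed
    qed
    moreover have "diag_comp n x f = x \<and> diag_loops n x f = 0" if x: "x \<in> right_defect n a" for x
    proof
      have xd: "x \<in> diagrams n" using x by (simp add: right_defect_def)
      have single: "diag_rel n x {} {j}"
        using x right_defect_single_iff[OF xd ij(2)] a True by simp
      \<comment> \<open>Since \<open>{}\<close> is related to \<open>{j}\<close>, membership of
        \<open>j\<close> in right sets can be switched freely.\<close>
      have symd: "diag_rel n x A (symd C {j})" if "diag_rel n x A C" for A C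
        using diag_rel_symd[OF that single] by simp
      have toggle: "diag_rel n x A B" if AC: "diag_rel n x A C" and B: "B \<subseteq> {1..int n}" "B - {j} = C - {j}" for A B C
      proof (cases "j \<in> B \<longleftrightarrow> j \<in> C")
        case True
        then have "B = C" using B by blast
        then show ?thesis using AC by simp
      next
        case False
        then have "B = symd C {j}" using B(2) unfolding symd_def by blast
        then show ?thesis using symd[OF AC] by simp
      qed
      show "diag_comp n x f = x"
      proof (rule diagram_eqI[OF diag_comp_in_diagrams[OF xd f] xd])
        fix A C
        show "diag_rel n (diag_comp n x f) A C \<longleftrightarrow> diag_rel n x A C"
        proof
          assume "diag_rel n (diag_comp n x f) A C"
          then show "diag_rel n x A C"
            using toggle by (auto simp: diag_rel_comp[OF xd f] rel)
        next
          assume AC: "diag_rel n x A C"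
          then have C: "C \<subseteq> {1..int n}" by (simp add: diag_rel_def)
          \<comment> \<open>\<open>f\<close> fixes everything off \<open>j\<close> and asks
            \<open>j\<close> to follow \<open>k\<close>, which dictates this middle set.\<close>
          define B where "B = (if k \<in> C then insert j C else C - {j})"
          have B: "B \<subseteq> {1..int n}" "B - {j} = C - {j}" "j \<in> B \<longleftrightarrow> k \<in> B"
            using C ij jk by (auto simp: B_def)
          then have "diag_rel n x A B" "diag_rel n f B C"
            using toggle[OF AC] C by (auto simp: rel)
          then show "diag_rel n (diag_comp n x f) A C"
            using diag_rel_comp[OF xd f] by blast
        qed
      qed
      \<comment> \<open>The middle node \<open>j\<close> is tied by \<open>f\<close> to
        \<open>k\<close>, which continues to the right, so no component stays in the middle.\<close>
      show "diag_loops n x f = 0"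
      proof (rule diag_loops_eq_0[OF xd f])
        fix B assume "diag_rel n f B {}"
        then show "B = {}" using jk unfolding rel by blast
      qed
    qed
    ultimately show ?thesis using f by blast
  qed
  then obtain f where f: "f \<in> diagrams n" "diag_comp n e f \<in> right_defect n a"
    "\<forall>b\<in>S. diag_comp n e f \<in> right_defect n b"
    "\<forall>x\<in>right_defect n a. diag_comp n x f = x \<and> diag_loops n x f = 0" by blast
  \<comment> \<open>Bracketing as \<open>(x e) f\<close> gives \<open>x\<close> with no loops; by
    additivity of loop numbers over the naturals, the other bracketing has none either.\<close>
  have "diag_comp n x (diag_comp n e f) = x \<and> diag_loops n x (diag_comp n e f) = 0"
    if x: "x \<in> diagrams n" "\<forall>b\<in>insert a S. x \<in> right_defect n b" for x
    using bspec[OF unit x(1)] f(4) x diag_comp_assoc[OF x(1) e f(1)] diag_loops_assoc[OF x(1) e f(1)] by simp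
  then show ?case
    using f diag_comp_in_diagrams[OF e f(1)] by (intro bexI[of _ "diag_comp n e f"]) auto
qed

lemma right_unit_of_defects:
  assumes T: "T \<subseteq> {1..int n} \<times> {1..int n}" "T \<noteq> {}" "card T < n"
    and ne: "(\<Inter>a\<in>T. right_defect n a) \<noteq> {}"
  shows "\<exists>e\<in>(\<Inter>a\<in>T. right_defect n a). \<forall>x\<in>(\<Inter>a\<in>T. right_defect n a). part_mult n \<delta> x e = (x, 1)"
proof -
  have fin: "finite T" by (rule finite_subset[OF T(1)]) simp
  obtain x where x: "\<And>a. a \<in> T \<Longrightarrow> x \<in> right_defect n a" using ne by blast
  have xd: "x \<in> diagrams n" using T(2) x by (auto simp: right_defect_def)
  then have part: "partition_on (nodes n) x" by (simp add: diagrams_def)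
  have "\<not> {1..int n} \<subseteq> fst ` T"
  proof
    assume "{1..int n} \<subseteq> fst ` T"
    then have "card {1..int n} \<le> card (fst ` T)" using fin by (intro card_mono) auto
    also have "\<dots> \<le> card T" by (rule card_image_le[OF fin])
    finally show False using T(3) by simp
  qed
  then obtain k where k: "k \<in> {1..int n}" "k \<notin> fst ` T" by blast
  have "(i, i) \<notin> T \<and> (j, j) \<notin> T" if ij: "(i, j) \<in> T" "i \<noteq> j" for i j
  proof -
    obtain B where B: "B \<in> x" "i \<in> B" "j \<in> B" using x[OF ij(1)] ij(2) by (auto simp: right_defect_def)
    have "False" if "(l, l) \<in> T" "l \<in> B" for l
    proof -
      have "{l} \<in> x" using x[OF that(1)] by (simp add: right_defect_def)
      then have "B = {l}" using partition_on_same_block[OF part B(1), of "{l}" l] that(2) by simp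
      then show False using B ij(2) by simp
    qed
    then show ?thesis using B by blast
  qed
  then obtain e where e: "\<forall>a\<in>T. e \<in> right_defect n a"
    "\<forall>x\<in>diagrams n. (\<forall>a\<in>T. x \<in> right_defect n a) \<longrightarrow> diag_comp n x e = x \<and> diag_loops n x e = 0"
    using right_unit_exists[OF fin T(1) k(1)] k(2) by (metis fst_conv image_eqI)
  have "part_mult n \<delta> y e = (y, 1)" if "y \<in> (\<Inter>a\<in>T. right_defect n a)" for y
  proof -
    have "y \<in> diagrams n" using that T(2) by (auto simp: right_defect_def)
    then show ?thesis using e(2) that by (simp add: part_mult_def)
  qed
  then show ?thesis using e(1) by blast
qed

subsection \<open>The partition algebra\<close>

definition nonperm :: "nat \<Rightarrow> int set set set" where
  "nonperm n = {d \<in> diagrams n. \<not> is_perm_diagram n d}"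

lemma nonperm_eq: "nonperm n = (\<Union>a\<in>{1..int n} \<times> {1..int n}. right_defect n a)"
proof (intro set_eqI iffI)
  fix d assume "d \<in> nonperm n"
  then obtain i j where "i \<in> {1..int n}" "j \<in> {1..int n}" "d \<in> right_defect n (i, j)"
    using nonperm_right_defect[of d n] unfolding nonperm_def by blast
  then show "d \<in> (\<Union>a\<in>{1..int n} \<times> {1..int n}. right_defect n a)"
    by (intro UN_I[of "(i, j)"]) simp_all
next
  fix d assume "d \<in> (\<Union>a\<in>{1..int n} \<times> {1..int n}. right_defect n a)"
  then obtain i j where ij: "i \<in> {1..int n}" "j \<in> {1..int n}" "d \<in> right_defect n (i, j)" by force
  then have "d \<in> diagrams n" by (simp add: right_defect_def)
  then show "d \<in> nonperm n" using perm_no_right_defect[of n d i j] ij by (auto simp: nonperm_def)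
qed

lemma perm_diagram_image: "perm_diagram n ` perms n = diagrams n - nonperm n"
  using is_perm_diagram_iff[of n] by (auto simp: nonperm_def perm_diagram_in_diagrams)

lemma augmented_partition_algebra:
  "augmented_algebra (diagrams n) (part_mult n \<delta>) (part_eps n :: _ \<Rightarrow> 'r::comm_ring_1) (nonperm n)"
proof
  show "finite (diagrams n)"
    unfolding diagrams_def by (rule finitely_many_partition_on) (simp add: nodes_def)
  have left: "diag_comp n x y \<in> nonperm n" if x: "x \<in> diagrams n" and y: "y \<in> nonperm n" for x y
  proof -
    obtain i j where "i \<in> {1..int n}" "j \<in> {1..int n}" "y \<in> right_defect n (i, j)"
      using y unfolding nonperm_eq by force
    then show ?thesis
      unfolding nonperm_eq using right_defect_comp[OF x, of y i j] by (intro UN_I[of "(i, j)"]) simp_all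
  qed
  \<comment> \<open>A given right defect need not survive right multiplication, so this side rests
    on \<open>perm_comp_left_perm\<close>.\<close>
  have right: "diag_comp n x y \<in> nonperm n" if "x \<in> nonperm n" "y \<in> diagrams n" for x y
    using perm_comp_left_perm[of x n y] that diag_comp_in_diagrams[of x n y] by (auto simp: nonperm_def)
  have perm: "diag_comp n x y \<in> diagrams n - nonperm n" "diag_loops n x y = 0"
    if xy: "x \<in> diagrams n - nonperm n" "y \<in> diagrams n - nonperm n" for x y
  proof -
    obtain p q where pq: "p \<in> perms n" "q \<in> perms n" "x = perm_diagram n p" "y = perm_diagram n q"
      using xy unfolding perm_diagram_image[symmetric] by blast
    show "diag_comp n x y \<in> diagrams n - nonperm n"
      unfolding perm_diagram_image[symmetric] pq(3,4) diag_comp_perm(1)[OF pq(1,2)]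
      using perms_comp[OF pq(1,2)] by blast
    show "diag_loops n x y = 0" unfolding pq(3,4) by (rule diag_comp_perm(2)[OF pq(1,2)])
  qed
  have eps: "(part_eps n d :: 'r) = (if d \<in> nonperm n then 0 else 1)" if "d \<in> diagrams n" for d
    using that by (simp add: part_eps_def nonperm_def)
  fix x y z
  show "part_eps n x * part_eps n y = snd (part_mult n \<delta> x y) * part_eps n (fst (part_mult n \<delta> x y))"
    if xy: "x \<in> diagrams n" "y \<in> diagrams n"
  proof (cases "x \<in> nonperm n \<or> y \<in> nonperm n")
    case True
    then have "diag_comp n x y \<in> nonperm n" using left right xy by blast
    then show ?thesis using True eps[OF xy(1)] eps[OF xy(2)] eps[of "diag_comp n x y"]
      by (auto simp: part_mult_def nonperm_def)
  next
    case False
    then show ?thesis using perm[of x y] xy eps[OF xy(1)] eps[OF xy(2)] eps[of "diag_comp n x y"]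
      by (simp add: part_mult_def)
  qed
  show "snd (part_mult n \<delta> x y) * snd (part_mult n \<delta> (fst (part_mult n \<delta> x y)) z)
      = snd (part_mult n \<delta> y z) * snd (part_mult n \<delta> x (fst (part_mult n \<delta> y z)))"
    if "x \<in> diagrams n" "y \<in> diagrams n" "z \<in> diagrams n"
    using diag_loops_assoc[OF that] by (simp add: part_mult_def flip: power_add)
  show "fst (part_mult n \<delta> x y) \<in> diagrams n - nonperm n"
    if "x \<in> diagrams n - nonperm n" "y \<in> diagrams n - nonperm n"
    using perm(1)[OF that] by (simp add: part_mult_def)
  show "fst (part_mult n \<delta> x y) \<in> nonperm n" if "x \<in> diagrams n" "y \<in> nonperm n"
    using left[OF that] by (simp add: part_mult_def)
  show "fst (part_mult n \<delta> x y) \<in> nonperm n" if "x \<in> nonperm n" "y \<in> diagrams n"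
    using right[OF that] by (simp add: part_mult_def)
qed (auto simp: part_mult_def diag_comp_in_diagrams diag_comp_assoc nonperm_def part_eps_def)

theorem theoremB:
  fixes \<delta> :: "'r::comm_ring_1" and n i :: nat
  assumes "n \<ge> 2 * i + 1"
  shows "induces_homology_iso (perms n) (perm_mult :: _ \<Rightarrow> _ \<Rightarrow> _ \<times> 'r) perm_eps
           (diagrams n) (part_mult n \<delta>) (part_eps n) (perm_diagram n) i"
proof -
  interpret augmented_algebra "diagrams n" "part_mult n \<delta>" "part_eps n" "nonperm n"
    by (rule augmented_partition_algebra)
  let ?F = "{1..int n} \<times> {1..int n}"
  have ideal: "left_ideal (right_defect n a)" if a: "a \<in> ?F" for a
  proof -
    obtain u v where uv: "a = (u, v)" "u \<in> {1..int n}" "v \<in> {1..int n}" using a by auto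
    have "right_defect n a \<subseteq> nonperm n" unfolding nonperm_eq using a by blast
    then show ?thesis
      using right_defect_comp[of _ n _ u v] uv by (auto simp: left_ideal_def part_mult_def)
  qed
  have acyclic: "acyclic_at s (nonperm n)" if s: "s < i" for s
  proof -
    have "acyclic_at s (nonperm n \<inter> (\<Inter>a\<in>{}. right_defect n a) \<inter> (\<Union>a\<in>?F. right_defect n a))"
    \<comment> \<open>Units exist for up to \<open>n - 1\<close> defects, whence \<open>N\<close>.
      With \<open>S\<close> empty the degree bound is \<open>s < n - 1\<close>, which follows from
      \<open>s < i\<close> and the hypothesis on \<open>n\<close>.\<close>
    proof (rule acyclic_Inter_Union[where N = "n - 1"])
      show "\<exists>e\<in>\<Inter>(right_defect n ` T). \<forall>x\<in>\<Inter>(right_defect n ` T). part_mult n \<delta> x e = (x, 1)"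
        if "T \<subseteq> ?F \<union> {}" "T \<noteq> {}" "card T \<le> n - 1" "\<Inter>(right_defect n ` T) \<noteq> {}" for T
        using right_unit_of_defects[of T n \<delta>] that assms by simp
    qed (use s assms ideal in auto)
    then show ?thesis by (simp add: nonperm_eq[symmetric])
  qed
  show ?thesis
  proof (rule induces_homology_iso_if_acyclic[OF acyclic inj_on_perm_diagram perm_diagram_image])
    fix p q assume pq: "p \<in> perms n" "q \<in> perms n"
    show "fst (perm_mult p q :: _ \<times> 'r) \<in> perms n"
      using perms_comp[OF pq] by (simp add: perm_mult_def)
    show "part_mult n \<delta> (perm_diagram n p) (perm_diagram n q)
        = (perm_diagram n (fst (perm_mult p q :: _ \<times> 'r)), snd (perm_mult p q))"
      using diag_comp_perm[OF pq] by (simp add: part_mult_def perm_mult_def)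
  next
    fix p assume "p \<in> perms n"
    then show "part_eps n (perm_diagram n p) = perm_eps p"
      by (simp add: part_eps_def perm_eps_def is_perm_diagram_iff)
  qed
qed

end
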